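(* Let $\Theta\subset\mathbb{R}^p$ be compact and convex, $\theta_0$ an interior point of $\Theta$, and let $\Theta\to M(T)$, $\theta\mapsto\mu_\theta$, be continuous and belong to $C^2(\Theta;M(T))$. Suppose that for $\theta\in\Theta$, $\mathcal{K}\mu_\theta(t)=\mathcal{K}\mu_{\theta_0}(t)$ for all $t\in T$ implies $\theta=\theta_0$, and that the $p\times p$ matrix $\Sigma$ with entries $\Sigma_{ij}=\langle\partial_i\mu_{\theta_0},\mathcal{K}\partial_j\mu_{\theta_0}\rangle$ is regular (invertible). For $\varepsilon>0$ and $\theta\in\Theta$ let $P^\varepsilon_\theta$ be the law on $C(T)$ of $\mathcal{K}\mu_\theta+\varepsilon Z$. Then the family $\{P^\varepsilon_\theta:\theta\in\Theta\}_{\varepsilon>0}$ is locally asymptotically normal at $\theta_0$ as $\varepsilon\to0$.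
   Context: $T\subset\mathbb{R}$ is a closed bounded interval; $C(T)$ is the Banach space of continuous real functions on $T$ with the sup norm; $M(T)=C(T)^*$ is the space of finite signed Borel measures on $T$ with the total variation norm; $\langle\mu,x\rangle=\int_T x_t\,\mu(dt)$. $Z$ is a centered Gaussian vector on $C(T)$, i.e. a $C(T)$-valued random vector on a probability space $(\Omega,\mathbb{P})$ such that $\langle\mu,Z\rangle$ is a centered normal variable for every $\mu\in M(T)$. Its covariance function $K(s,t)=\mathrm{Cov}[Z_s,Z_t]$ is continuous on $T^2$ and its covariance operator $\mathcal{K}:M(T)\to C(T)$ is $(\mathcal{K}\mu)(s)=\int_T K(s,t)\,\mu(dt)$. $C^k(\Theta;M(T))$ is the set of maps $\theta\mapsto\mu_\theta$ from $\Theta$ to $M(T)$ that are $k$ times Fréchet differentiable (total variation norm on $M(T)$) with uniformly continuous partial derivatives of order $k$; that is, differentiable in the interior of $\Theta$, with partial derivatives of order at most $k$ extending continuously to $\Theta$. $\partial_i=\partial/\partial\theta_i$. Locally asymptotically normal at $\theta_0$ means: there exist invertible $p\times p$ matrices $\varphi(\varepsilon)$ with $\varphi(\varepsilon)\to0$ as $\varepsilon\to0$ and $\mathbb{R}^p$-valued random vectors $\Delta_{\varepsilon,\theta_0}$ (measurable functions of $X^\varepsilon$) such that, with $X^\varepsilon=\mathcal{K}\mu_{\theta_0}+\varepsilon Z\sim P^\varepsilon_{\theta_0}$, for every $u\in\mathbb{R}^p$, $$\log\frac{dP^\varepsilon_{\theta_0+\varphi(\varepsilon)u}}{dP^\varepsilon_{\theta_0}}(X^\varepsilon)=u^{\mathsf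 T}\Delta_{\varepsilon,\theta_0}-\tfrac12|u|^2+o_p(1)\quad(\varepsilon\to0),$$ and $\Delta_{\varepsilon,\theta_0}$ converges in distribution to $N(0,I_p)$, $I_p$ being the $p\times p$ identity matrix. *)

theory Defs
  imports "HOL-Probability.Probability"
begin

section \<open>Finite signed Borel measures on the line\<close>

definition countably_additive_real :: "(real set \<Rightarrow> real) \<Rightarrow> bool" where
  "countably_additive_real m \<longleftrightarrow>
     (\<forall>A :: nat \<Rightarrow> real set. range A \<subseteq> sets borel \<longrightarrow> disjoint_family A \<longrightarrow>
        (\<lambda>n. m (A n)) sums m (\<Union>n. A n))"

text \<open>Set functions are total in HOL; the value \<open>0\<close> off the Borel sets makes equality of signed
  measures the equality on Borel sets.\<close>

typedef signed_measure =
  "{m :: real set \<Rightarrow> real. countably_additive_real m \<and> (\<forall>A. A \<notin> sets borel \<longrightarrow> m A = 0)}"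
  morphisms sm Abs_sm
  by (intro exI[of _ "\<lambda>_. 0"]) (auto simp: countably_additive_real_def)

setup_lifting type_definition_signed_measure

lemma sm_sums:
  "range A \<subseteq> sets borel \<Longrightarrow> disjoint_family A \<Longrightarrow> (\<lambda>n. sm m (A n)) sums sm m (\<Union>n. A n)"
  using sm[of m] by (auto simp: countably_additive_real_def)

lemma sm_not_borel: "A \<notin> sets borel \<Longrightarrow> sm m A = 0"
  using sm[of m] by auto

lemma sm_empty [simp]: "sm m {} = 0"
proof -
  have "(\<lambda>n::nat. sm m {}) sums sm m (\<Union>n::nat. {})"
    by (rule sm_sums) (auto simp: disjoint_family_on_def)
  hence "(\<lambda>n::nat. sm m {}) \<longlonglongrightarrow> 0"
    using sums_summable summable_LIMSEQ_zero by blast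
  thus ?thesis by (simp add: LIMSEQ_const_iff)
qed

lemma sm_Un:
  assumes "A \<in> sets borel" "B \<in> sets borel" "A \<inter> B = {}"
  shows "sm m (A \<union> B) = sm m A + sm m B"
proof -
  let ?F = "\<lambda>n::nat. if n = 0 then A else if n = 1 then B else {}"
  have "(\<lambda>n. sm m (?F n)) sums sm m (\<Union>n. ?F n)"
    using assms by (intro sm_sums) (auto simp: disjoint_family_on_def)
  moreover have "(\<Union>n. ?F n) = A \<union> B"
    by (auto split: if_splits)
  moreover have "(\<lambda>n. sm m (?F n)) sums (\<Sum>n\<in>{0,1}. sm m (?F n))"
    by (rule sums_finite) auto
  ultimately show ?thesis
    by (simp add: sums_iff)
qed

lemma sm_Diff:
  assumes "A \<in> sets borel" "B \<in> sets borel" "B \<subseteq> A"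
  shows "sm m (A - B) = sm m A - sm m B"
proof -
  have "sm m ((A - B) \<union> B) = sm m (A - B) + sm m B"
    using assms by (intro sm_Un) auto
  moreover have "(A - B) \<union> B = A" using assms by auto
  ultimately show ?thesis by simp
qed

lemma sm_finite_Union:
  assumes "finite P" "P \<subseteq> sets borel" "disjoint P"
  shows "sm m (\<Union>P) = (\<Sum>A\<in>P. sm m A)"
  using assms
proof (induction P rule: finite_induct)
  case (insert A P)
  have "sm m (A \<union> \<Union>P) = sm m A + sm m (\<Union>P)"
  proof (rule sm_Un)
    show "\<Union>P \<in> sets borel"
      using insert.prems insert.hyps by (intro sets.finite_Union) auto
    show "A \<inter> \<Union>P = {}"
      using insert.prems insert.hyps by (auto simp: disjoint_def)
  qed (use insert.prems in auto)
  moreover have "disjoint P"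
    using insert.prems by (auto simp: disjoint_def)
  ultimately show ?case using insert by simp
qed simp

text \<open>A finite signed measure is bounded, so that its total variation is finite.\<close>

lemma sm_bounded: "\<exists>B. \<forall>A\<in>sets borel. \<bar>sm m A\<bar> \<le> B"
proof (rule ccontr)
  assume unb: "\<not> ?thesis"
  define bad where
    "bad E \<longleftrightarrow> E \<in> sets borel \<and> (\<forall>B. \<exists>A\<in>sets borel. A \<subseteq> E \<and> \<bar>sm m A\<bar> > B)" for E
  have bad0: "bad UNIV"
    using unb by (auto simp: bad_def not_le)
  have badD: "\<exists>A. A \<in> sets borel \<and> A \<subseteq> E \<and> \<bar>sm m A\<bar> > B" if "bad E" for E B
    using that by (simp add: bad_def Bex_def)
  have not_badD: "\<exists>B. \<forall>C\<in>sets borel. C \<subseteq> E \<longrightarrow> \<bar>sm m C\<bar> \<le> B"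
    if "\<not> bad E" "E \<in> sets borel" for E
    using that by (simp add: bad_def Bex_def Ball_def not_less) meson
  have split: "\<exists>E'. bad E' \<and> E' \<subseteq> E \<and> \<bar>sm m (E - E')\<bar> \<ge> 1" if bE: "bad E" for E
  proof -
    have E: "E \<in> sets borel" using bE by (simp add: bad_def)
    obtain A where A: "A \<in> sets borel" "A \<subseteq> E" "\<bar>sm m A\<bar> > \<bar>sm m E\<bar> + 1"
      using badD[OF bE] by metis
    have D: "sm m (E - A) = sm m E - sm m A"
      using E A by (intro sm_Diff) auto
    have "bad A \<or> bad (E - A)"
    proof (rule ccontr)
      assume "\<not> ?thesis"
      hence nb: "\<not> bad A" "\<not> bad (E - A)" by auto
      have EA: "E - A \<in> sets borel" using E A by auto
      obtain B1 where B1: "\<And>C. C \<in> sets borel \<Longrightarrow> C \<subseteq> A \<Longrightarrow> \<bar>sm m C\<bar> \<le> B1"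
        using not_badD[OF nb(1) A(1)] by metis
      obtain B2 where B2: "\<And>C. C \<in> sets borel \<Longrightarrow> C \<subseteq> E - A \<Longrightarrow> \<bar>sm m C\<bar> \<le> B2"
        using not_badD[OF nb(2) EA] by metis
      obtain C where C: "C \<in> sets borel" "C \<subseteq> E" "\<bar>sm m C\<bar> > B1 + B2"
        using badD[OF bE] by metis
      have "sm m ((C \<inter> A) \<union> (C - A)) = sm m (C \<inter> A) + sm m (C - A)"
        using C A by (intro sm_Un) auto
      moreover have "(C \<inter> A) \<union> (C - A) = C" by auto
      moreover have "\<bar>sm m (C \<inter> A)\<bar> \<le> B1" using C A by (intro B1) auto
      moreover have "\<bar>sm m (C - A)\<bar> \<le> B2" using C A by (intro B2) auto
      ultimately show False using C(3) by auto
    qed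
    thus ?thesis
    proof
      assume "bad A"
      thus ?thesis using A D by (intro exI[of _ A]) auto
    next
      assume "bad (E - A)"
      moreover have "E - (E - A) = A" using A by auto
      ultimately show ?thesis using A D by (intro exI[of _ "E - A"]) auto
    qed
  qed
  obtain E where E: "\<And>n::nat. bad (E n)" "\<And>n. E (Suc n) \<subseteq> E n"
      "\<And>n. \<bar>sm m (E n - E (Suc n))\<bar> \<ge> 1"
    using dependent_nat_choice[of "\<lambda>_ E. bad E"
        "\<lambda>_ E E'. E' \<subseteq> E \<and> \<bar>sm m (E - E')\<bar> \<ge> 1"] bad0 split
    by metis
  have dec: "E n \<subseteq> E k" if "k \<le> n" for k n
    by (rule lift_Suc_antimono_le[of E, OF E(2) that])
  have disj: "(E i - E (Suc i)) \<inter> (E j - E (Suc j)) = {}" if "i < j" for i j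
    using dec[of "Suc i" j] that by auto
  have "disjoint_family (\<lambda>n. E n - E (Suc n))"
    unfolding disjoint_family_on_def
    by (metis disj inf_commute nat_neq_iff)
  moreover have "range (\<lambda>n. E n - E (Suc n)) \<subseteq> sets borel"
    using E(1) unfolding bad_def by auto
  ultimately have "(\<lambda>n. sm m (E n - E (Suc n))) \<longlonglongrightarrow> 0"
    using sm_sums sums_summable summable_LIMSEQ_zero by blast
  hence "eventually (\<lambda>n. dist (sm m (E n - E (Suc n))) 0 < 1) sequentially"
    by (rule tendstoD) simp
  then obtain n where "dist (sm m (E n - E (Suc n))) 0 < 1"
    unfolding eventually_sequentially by blast
  thus False using E(3)[of n] by simp
qed

definition borel_partitions :: "real set set set" where
  "borel_partitions = {P. finite P \<and> P \<subseteq> sets borel \<and> disjoint P \<and> \<Union>P = UNIV}"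

definition total_variation :: "(real set \<Rightarrow> real) \<Rightarrow> real" where
  "total_variation m = (SUP P\<in>borel_partitions. \<Sum>A\<in>P. \<bar>m A\<bar>)"

lemma UNIV_partition: "{UNIV} \<in> borel_partitions"
  by (auto simp: borel_partitions_def)

lemma compl_partition: "A \<in> sets borel \<Longrightarrow> {A, - A} \<in> borel_partitions"
  by (auto simp: borel_partitions_def disjoint_def)

lemma bdd_above_variation: "bdd_above ((\<lambda>P. \<Sum>A\<in>P. \<bar>sm m A\<bar>) ` borel_partitions)"
proof -
  obtain B where B: "\<And>A. A \<in> sets borel \<Longrightarrow> \<bar>sm m A\<bar> \<le> B" using sm_bounded by blast
  show ?thesis
  proof (rule bdd_aboveI2)
    fix P assume "P \<in> borel_partitions"
    hence P: "finite P" "P \<subseteq> sets borel" "disjoint P" by (auto simp: borel_partitions_def)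
    define Q where "Q = {A\<in>P. sm m A \<ge> 0}"
    define N where "N = {A\<in>P. sm m A < 0}"
    have sub: "Q \<subseteq> P" "N \<subseteq> P" by (auto simp: Q_def N_def)
    have fin: "finite Q" "finite N" using P sub finite_subset by blast+
    have disj: "disjoint Q" "disjoint N" using P(3) sub by (blast intro: pairwise_subset)+
    have U: "\<Union>Q \<in> sets borel" "\<Union>N \<in> sets borel"
      using fin P sub by (auto intro!: sets.finite_Union)
    have "(\<Sum>A\<in>P. \<bar>sm m A\<bar>) = (\<Sum>A\<in>Q \<union> N. \<bar>sm m A\<bar>)"
      by (rule sum.cong) (auto simp: Q_def N_def)
    also have "\<dots> = (\<Sum>A\<in>Q. \<bar>sm m A\<bar>) + (\<Sum>A\<in>N. \<bar>sm m A\<bar>)"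
      using fin by (intro sum.union_disjoint) (auto simp: Q_def N_def)
    also have "(\<Sum>A\<in>Q. \<bar>sm m A\<bar>) = (\<Sum>A\<in>Q. sm m A)"
      by (rule sum.cong) (auto simp: Q_def)
    also have "\<dots> = sm m (\<Union>Q)"
      using fin disj P sub by (subst sm_finite_Union) auto
    also have "(\<Sum>A\<in>N. \<bar>sm m A\<bar>) = - (\<Sum>A\<in>N. sm m A)"
      unfolding sum_negf[symmetric] by (rule sum.cong) (auto simp: N_def)
    also have "(\<Sum>A\<in>N. sm m A) = sm m (\<Union>N)"
      using fin disj P sub by (subst sm_finite_Union) auto
    finally show "(\<Sum>A\<in>P. \<bar>sm m A\<bar>) \<le> B + B"
      using B[OF U(1)] B[OF U(2)] by linarith
  qed
qed

instantiation signed_measure :: real_normed_vector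
begin

lift_definition zero_signed_measure :: signed_measure is "\<lambda>_. 0"
  by (auto simp: countably_additive_real_def)

lift_definition plus_signed_measure :: "signed_measure \<Rightarrow> signed_measure \<Rightarrow> signed_measure"
  is "\<lambda>m n A. m A + n A"
  by (auto simp: countably_additive_real_def intro!: sums_add)

lift_definition minus_signed_measure :: "signed_measure \<Rightarrow> signed_measure \<Rightarrow> signed_measure"
  is "\<lambda>m n A. m A - n A"
  by (auto simp: countably_additive_real_def intro!: sums_diff)

lift_definition uminus_signed_measure :: "signed_measure \<Rightarrow> signed_measure"
  is "\<lambda>m A. - m A"
  by (auto simp: countably_additive_real_def intro!: sums_minus)

lift_definition scaleR_signed_measure :: "real \<Rightarrow> signed_measure \<Rightarrow> signed_measure"
  is "\<lambda>c m A. c * m A"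
  by (auto simp: countably_additive_real_def intro!: sums_mult)

lift_definition norm_signed_measure :: "signed_measure \<Rightarrow> real"
  is total_variation .

definition sgn_signed_measure :: "signed_measure \<Rightarrow> signed_measure" where
  "sgn_signed_measure m = scaleR (inverse (norm m)) m"

definition dist_signed_measure :: "signed_measure \<Rightarrow> signed_measure \<Rightarrow> real" where
  "dist_signed_measure m n = norm (m - n)"

definition uniformity_signed_measure :: "(signed_measure \<times> signed_measure) filter" where
  "uniformity_signed_measure = (INF e\<in>{0<..}. principal {(m, n). dist m n < e})"

definition open_signed_measure :: "signed_measure set \<Rightarrow> bool" where
  "open_signed_measure S \<longleftrightarrow> (\<forall>m\<in>S. \<forall>\<^sub>F (m', n) in uniformity. m' = m \<longrightarrow> n \<in> S)"

instance
proof
  fix m n k :: signed_measure and c d :: real and S :: "signed_measure set"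
  show "m + n + k = m + (n + k)" by transfer (auto simp: algebra_simps)
  show "m + n = n + m" by transfer (auto simp: algebra_simps)
  show "0 + m = m" by transfer auto
  show "- m + m = 0" by transfer auto
  show "m - n = m + - n" by transfer auto
  show "c *\<^sub>R (m + n) = c *\<^sub>R m + c *\<^sub>R n" by transfer (auto simp: algebra_simps)
  show "(c + d) *\<^sub>R m = c *\<^sub>R m + d *\<^sub>R m" by transfer (auto simp: algebra_simps)
  show "c *\<^sub>R d *\<^sub>R m = (c * d) *\<^sub>R m" by transfer (auto simp: algebra_simps)
  show "1 *\<^sub>R m = m" by transfer auto
  show "sgn m = scaleR (inverse (norm m)) m" by (rule sgn_signed_measure_def)
  show "dist m n = norm (m - n)" by (rule dist_signed_measure_def)
  show "uniformity = (INF e\<in>{0<..}. principal {(m :: signed_measure, n). dist m n < e})"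
    by (rule uniformity_signed_measure_def)
  show "open S \<longleftrightarrow> (\<forall>m\<in>S. \<forall>\<^sub>F (m', n) in uniformity. m' = m \<longrightarrow> n \<in> S)"
    by (rule open_signed_measure_def)
  have norm_ge: "(\<Sum>A\<in>P. \<bar>sm m A\<bar>) \<le> norm m" if "P \<in> borel_partitions" for P m
    unfolding norm_signed_measure.rep_eq total_variation_def
    using that bdd_above_variation by (rule cSUP_upper)
  have norm_le: "norm m \<le> B" if "\<And>P. P \<in> borel_partitions \<Longrightarrow> (\<Sum>A\<in>P. \<bar>sm m A\<bar>) \<le> B" for m B
    unfolding norm_signed_measure.rep_eq total_variation_def
    using that UNIV_partition by (intro cSUP_least) auto
  show "norm m = 0 \<longleftrightarrow> m = 0"
  proof
    assume 0: "norm m = 0"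
    have "sm m A = 0" for A
    proof (cases "A \<in> sets borel")
      case True
      have "\<bar>sm m A\<bar> \<le> (\<Sum>A\<in>{A, - A}. \<bar>sm m A\<bar>)"
        by (rule member_le_sum) auto
      also have "\<dots> \<le> 0"
        using norm_ge[OF compl_partition[OF True], of m] 0 by simp
      finally show ?thesis by simp
    qed (simp add: sm_not_borel)
    thus "m = 0" by transfer auto
  next
    assume "m = 0"
    hence "sm m A = 0" for A by (simp add: zero_signed_measure.rep_eq)
    thus "norm m = 0"
      using norm_le[of m 0] norm_ge[OF UNIV_partition, of m] by (intro antisym) auto
  qed
  show "norm (m + n) \<le> norm m + norm n"
  proof (rule norm_le)
    fix P assume P: "P \<in> borel_partitions"
    have "(\<Sum>A\<in>P. \<bar>sm (m + n) A\<bar>) \<le> (\<Sum>A\<in>P. \<bar>sm m A\<bar>) + (\<Sum>A\<in>P. \<bar>sm n A\<bar>)"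
      unfolding sum.distrib[symmetric] by (rule sum_mono) (simp add: plus_signed_measure.rep_eq)
    also have "\<dots> \<le> norm m + norm n" by (intro add_mono norm_ge P)
    finally show "(\<Sum>A\<in>P. \<bar>sm (m + n) A\<bar>) \<le> norm m + norm n" .
  qed
  have scale: "(\<Sum>A\<in>P. \<bar>sm (c *\<^sub>R m) A\<bar>) = \<bar>c\<bar> * (\<Sum>A\<in>P. \<bar>sm m A\<bar>)" for c m P
    by (simp add: scaleR_signed_measure.rep_eq abs_mult sum_distrib_left)
  have le: "norm (c *\<^sub>R m) \<le> \<bar>c\<bar> * norm m" for c and m :: signed_measure
    by (rule norm_le) (auto simp: scale intro!: mult_left_mono norm_ge)
  show "norm (c *\<^sub>R m) = \<bar>c\<bar> * norm m"
  proof (cases "c = 0")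
    case True
    have "(0::real) \<le> norm (0 *\<^sub>R m)"
      using norm_ge[OF UNIV_partition, of "0 *\<^sub>R m"] by simp
    thus ?thesis using le[of c m] True by simp
  next
    case False
    have "(inverse c) *\<^sub>R (c *\<^sub>R m) = m"
      using False by transfer (auto simp: fun_eq_iff)
    hence "norm m \<le> \<bar>inverse c\<bar> * norm (c *\<^sub>R m)"
      using le[of "inverse c" "c *\<^sub>R m"] by simp
    hence "\<bar>c\<bar> * norm m \<le> norm (c *\<^sub>R m)"
      using False by (simp add: abs_inverse field_simps)
    thus ?thesis using le[of c m] by simp
  qed
qed

end

section \<open>Integration against signed measures\<close>

text \<open>Positive part of the Jordan decomposition; the negative part is \<open>pos_part (- m)\<close>.\<close>

definition pos_part :: "signed_measure \<Rightarrow> real measure" where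
  "pos_part m = measure_of UNIV (sets borel)
     (\<lambda>A. SUP B\<in>{B\<in>sets borel. B \<subseteq> A}. ennreal (sm m B))"

lemma emeasure_pos_part:
  assumes A: "A \<in> sets borel"
  shows "emeasure (pos_part m) A = (SUP B\<in>{B\<in>sets borel. B \<subseteq> A}. ennreal (sm m B))"
proof -
  define V where "V A = (SUP B\<in>{B\<in>sets borel. B \<subseteq> A}. ennreal (sm m B))" for A
  have V_ge: "ennreal (sm m B) \<le> V A" if "B \<in> sets borel" "B \<subseteq> A" for A B
    unfolding V_def using that by (intro SUP_upper) auto
  have mono: "V A \<le> V B" if "A \<subseteq> B" for A B
    unfolding V_def using that by (intro SUP_subset_mono) auto
  have super: "V A + V B \<le> V (A \<union> B)" if AB: "A \<inter> B = {}" for A B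
  proof -
    have "ennreal (sm m C) + ennreal (sm m D) \<le> V (A \<union> B)"
      if CD: "C \<in> sets borel" "C \<subseteq> A" "D \<in> sets borel" "D \<subseteq> B" for C D
    proof -
      consider "sm m C < 0" | "sm m D < 0" | "sm m C \<ge> 0" "sm m D \<ge> 0" by linarith
      thus ?thesis
      proof cases
        case 1
        thus ?thesis using V_ge[of D "A \<union> B"] CD by (auto simp: ennreal_neg)
      next
        case 2
        thus ?thesis using V_ge[of C "A \<union> B"] CD by (auto simp: ennreal_neg)
      next
        case 3
        have "C \<inter> D = {}" using CD AB by auto
        hence "sm m (C \<union> D) = sm m C + sm m D"
          using CD by (intro sm_Un) auto
        thus ?thesis using V_ge[of "C \<union> D" "A \<union> B"] CD 3 by (auto simp: ennreal_plus)
      qed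
    qed
    moreover have ne: "{B\<in>sets borel. B \<subseteq> X} \<noteq> {}" for X :: "real set" by auto
    ultimately show ?thesis
      unfolding V_def[of A] V_def[of B]
      by (subst ennreal_SUP_add_left[symmetric, OF ne], subst ennreal_SUP_add_right[OF ne])
         (auto intro!: SUP_least)
  qed
  have V0: "V {} = 0" by (simp add: V_def)
  have ca: "countably_additive (sets borel) V"
  proof (rule countably_additiveI)
    fix F :: "nat \<Rightarrow> real set"
    assume F: "range F \<subseteq> sets borel" "disjoint_family F" "(\<Union>i. F i) \<in> sets borel"
    have fin: "(\<Sum>i<n. V (F i)) \<le> V (\<Union>i<n. F i)" for n
    proof (induction n)
      case (Suc n)
      have "(\<Sum>i<Suc n. V (F i)) \<le> V (\<Union>i<n. F i) + V (F n)"
        using Suc by (auto intro: add_mono)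
      also have "\<dots> \<le> V ((\<Union>i<n. F i) \<union> F n)"
      proof (rule super)
        have "F i \<inter> F n = {}" if "i < n" for i
          using F(2) that by (intro disjoint_family_onD[of F UNIV]) auto
        thus "(\<Union>i<n. F i) \<inter> F n = {}" by blast
      qed
      also have "(\<Union>i<n. F i) \<union> F n = (\<Union>i<Suc n. F i)"
        by (auto simp: less_Suc_eq)
      finally show ?case .
    qed (simp add: V0)
    show "(\<Sum>i. V (F i)) = V (\<Union>i. F i)"
    proof (rule antisym)
      have "(\<Sum>i<n. V (F i)) \<le> V (\<Union>i. F i)" for n
        using fin[of n] by (rule order_trans) (intro mono UN_mono, auto)
      thus "(\<Sum>i. V (F i)) \<le> V (\<Union>i. F i)"
        by (auto simp: suminf_eq_SUP intro: SUP_least)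
      show "V (\<Union>i. F i) \<le> (\<Sum>i. V (F i))"
        unfolding V_def[of "\<Union>i. F i"]
      proof (rule SUP_least)
        fix B assume "B \<in> {B\<in>sets borel. B \<subseteq> (\<Union>i. F i)}"
        hence B: "B \<in> sets borel" "B \<subseteq> (\<Union>i. F i)" by auto
        have BF: "B \<inter> F i \<in> sets borel" for i using B F(1) by auto
        have "(\<lambda>i. sm m (B \<inter> F i)) sums sm m (\<Union>i. B \<inter> F i)"
          using BF F(2) by (intro sm_sums) (auto simp: disjoint_family_on_def)
        moreover have "(\<Union>i. B \<inter> F i) = B" using B by auto
        ultimately have s: "(\<lambda>n. \<Sum>i<n. sm m (B \<inter> F i)) \<longlonglongrightarrow> sm m B"
          by (simp add: sums_def)
        have "ennreal (\<Sum>i<n. sm m (B \<inter> F i)) \<le> (\<Sum>i. V (F i))" for n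
        proof -
          have "ennreal (\<Sum>i<n. sm m (B \<inter> F i)) \<le> ennreal (\<Sum>i<n. max 0 (sm m (B \<inter> F i)))"
            by (intro ennreal_leI sum_mono) auto
          also have "\<dots> = (\<Sum>i<n. ennreal (max 0 (sm m (B \<inter> F i))))"
            by (rule sum_ennreal[symmetric]) auto
          also have "\<dots> \<le> (\<Sum>i<n. V (F i))"
            using BF V_ge by (intro sum_mono) (auto simp: max_def)
          also have "\<dots> \<le> (\<Sum>i. V (F i))"
            by (rule sum_le_suminf) auto
          finally show ?thesis .
        qed
        with tendsto_ennrealI[OF s] show "ennreal (sm m B) \<le> (\<Sum>i. V (F i))"
          by (intro LIMSEQ_le_const2) auto
      qed
    qed
  qed
  have "sigma_algebra UNIV (sets (borel :: real measure))"
    using sets.sigma_algebra_axioms[of "borel :: real measure"] by simp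
  hence "emeasure (measure_of UNIV (sets borel) V) A = V A"
    using A ca V0 by (intro emeasure_measure_of_sigma) (auto simp: positive_def)
  thus ?thesis by (simp add: pos_part_def V_def[abs_def])
qed

lemma sets_pos_part [simp, measurable_cong]: "sets (pos_part m) = sets borel"
  using sets.sets_measure_of_eq[of "borel :: real measure"] by (simp add: pos_part_def)

lemma space_pos_part [simp]: "space (pos_part m) = UNIV"
  by (simp add: pos_part_def)

lemma finite_measure_pos_part: "finite_measure (pos_part m)"
proof
  obtain B where B: "\<And>A. A \<in> sets borel \<Longrightarrow> \<bar>sm m A\<bar> \<le> B" using sm_bounded by blast
  have "emeasure (pos_part m) UNIV \<le> ennreal B"
    using B by (subst emeasure_pos_part) (auto intro!: SUP_least ennreal_leI dest!: B)
  thus "emeasure (pos_part m) (space (pos_part m)) \<noteq> \<infinity>"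
    by (auto simp: top_unique)
qed

lemma jordan_decomposition:
  assumes A: "A \<in> sets borel"
  shows "sm m A = measure (pos_part m) A - measure (pos_part (- m)) A"
proof -
  have le: "sm m A + measure (pos_part (- m)) A \<le> measure (pos_part m) A" for m
  proof -
    have ub: "sm m B \<le> measure (pos_part m) A" if "B \<in> sets borel" "B \<subseteq> A" for B
    proof -
      interpret finite_measure "pos_part m" by (rule finite_measure_pos_part)
      have "ennreal (sm m B) \<le> emeasure (pos_part m) A"
        unfolding emeasure_pos_part[OF A] using that by (intro SUP_upper) auto
      thus ?thesis by (simp add: emeasure_eq_measure ennreal_le_iff)
    qed
    interpret N: finite_measure "pos_part (- m)" by (rule finite_measure_pos_part)
    have "emeasure (pos_part (- m)) A \<le> ennreal (measure (pos_part m) A - sm m A)"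
      unfolding emeasure_pos_part[OF A]
    proof (rule SUP_least)
      fix B assume "B \<in> {B\<in>sets borel. B \<subseteq> A}"
      hence B: "B \<in> sets borel" "B \<subseteq> A" by auto
      have "sm (- m) B = sm m (A - B) - sm m A"
        using A B by (simp add: sm_Diff uminus_signed_measure.rep_eq)
      also have "\<dots> \<le> measure (pos_part m) A - sm m A"
        using ub[of "A - B"] A B by auto
      finally show "ennreal (sm (- m) B) \<le> ennreal (measure (pos_part m) A - sm m A)"
        by (rule ennreal_leI)
    qed
    moreover have "0 \<le> measure (pos_part m) A - sm m A" using ub[of A] A by simp
    ultimately show ?thesis by (simp add: N.emeasure_eq_measure)
  qed
  show ?thesis
    using le[of m] le[of "- m"] by (simp add: uminus_signed_measure.rep_eq)
qed

definition signed_integral :: "real set \<Rightarrow> signed_measure \<Rightarrow> (real \<Rightarrow> real) \<Rightarrow> real" where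
  "signed_integral T m f =
     set_lebesgue_integral (pos_part m) T f - set_lebesgue_integral (pos_part (- m)) T f"

text \<open>\<open>M(T)\<close>: signed measures on a Borel set \<open>T\<close> are identified with the signed measures on the
  line that live on \<open>T\<close>. This is a closed subspace, and the identification preserves the total
  variation norm.\<close>

definition signed_measures_on :: "real set \<Rightarrow> signed_measure set" where
  "signed_measures_on T = {m. \<forall>A\<in>sets borel. A \<inter> T = {} \<longrightarrow> sm m A = 0}"

section \<open>Gaussian vectors in \<open>C(T)\<close>\<close>

text \<open>Elements of \<open>C(T)\<close> are functions \<open>real \<Rightarrow> real\<close> that are continuous on \<open>T\<close> and take the value
  \<open>undefined\<close> outside \<open>T\<close>; the metric is the supremum distance on \<open>T\<close>.\<close>

definition C_space :: "real set \<Rightarrow> (real \<Rightarrow> real) metric" where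
  "C_space T = cfunspace (top_of_set T) euclidean_metric"

definition C_borel :: "real set \<Rightarrow> (real \<Rightarrow> real) measure" where
  "C_borel T = sigma (mspace (C_space T)) {U. openin (mtopology_of (C_space T)) U}"

text \<open>Normal laws of variance zero (point mass at \<open>0\<close>) are allowed.\<close>

definition centered_normal :: "'w measure \<Rightarrow> ('w \<Rightarrow> real) \<Rightarrow> bool" where
  "centered_normal W X \<longleftrightarrow> X \<in> borel_measurable W \<and>
     ((\<exists>\<sigma>>0. distributed W lborel X (normal_density 0 \<sigma>)) \<or> (AE w in W. X w = 0))"

definition centered_gaussian_vector ::
    "'w measure \<Rightarrow> real set \<Rightarrow> ('w \<Rightarrow> real \<Rightarrow> real) \<Rightarrow> bool" where
  "centered_gaussian_vector W T Z \<longleftrightarrow>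
     Z \<in> measurable W (C_borel T) \<and>
     (\<forall>m\<in>signed_measures_on T. centered_normal W (\<lambda>w. signed_integral T m (Z w)))"

definition covariance :: "'w measure \<Rightarrow> ('w \<Rightarrow> real) \<Rightarrow> ('w \<Rightarrow> real) \<Rightarrow> real" where
  "covariance W X Y =
     (LINT w|W. (X w - (LINT v|W. X v)) * (Y w - (LINT v|W. Y v)))"

definition cov_fun :: "'w measure \<Rightarrow> ('w \<Rightarrow> real \<Rightarrow> real) \<Rightarrow> real \<Rightarrow> real \<Rightarrow> real" where
  "cov_fun W Z s t = covariance W (\<lambda>w. Z w s) (\<lambda>w. Z w t)"

definition cov_op ::
    "'w measure \<Rightarrow> real set \<Rightarrow> ('w \<Rightarrow> real \<Rightarrow> real) \<Rightarrow> signed_measure \<Rightarrow> real \<Rightarrow> real" where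
  "cov_op W T Z m = (\<lambda>s\<in>T. signed_integral T m (\<lambda>t. cov_fun W Z s t))"

definition shifted_law ::
    "'w measure \<Rightarrow> real set \<Rightarrow> ('w \<Rightarrow> real \<Rightarrow> real) \<Rightarrow> signed_measure \<Rightarrow> real
      \<Rightarrow> (real \<Rightarrow> real) measure" where
  "shifted_law W T Z m \<epsilon> =
     distr W (C_borel T) (\<lambda>w. \<lambda>t\<in>T. cov_op W T Z m t + \<epsilon> * Z w t)"

section \<open>Differentiability classes\<close>

definition partial_deriv ::
    "'p::finite \<Rightarrow> (real^'p \<Rightarrow> 'b::real_normed_vector) \<Rightarrow> real^'p \<Rightarrow> 'b" where
  "partial_deriv i f x = frechet_derivative f (at x) (axis i 1)"

fun iterated_partial_deriv ::
    "'p::finite list \<Rightarrow> (real^'p \<Rightarrow> 'b::real_normed_vector) \<Rightarrow> real^'p \<Rightarrow> 'b" where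
  "iterated_partial_deriv [] f = f"
| "iterated_partial_deriv (i # is) f = partial_deriv i (iterated_partial_deriv is f)"

text \<open>In finite dimension the derivative, as an operator-valued map, is differentiable iff all of
  its evaluations at fixed directions are.\<close>

fun times_differentiable_on ::
    "nat \<Rightarrow> (real^'p::finite \<Rightarrow> 'b::real_normed_vector) \<Rightarrow> (real^'p) set \<Rightarrow> bool" where
  "times_differentiable_on 0 f S \<longleftrightarrow> True"
| "times_differentiable_on (Suc k) f S \<longleftrightarrow>
     (\<forall>x\<in>S. f differentiable (at x)) \<and>
     (\<forall>v. times_differentiable_on k (\<lambda>x. frechet_derivative f (at x) v) S)"

definition C_k ::
    "nat \<Rightarrow> (real^'p::finite) set \<Rightarrow> 'b::real_normed_vector set \<Rightarrow> (real^'p \<Rightarrow> 'b) set" where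
  "C_k k \<Theta> M = {f. f ` \<Theta> \<subseteq> M \<and>
     times_differentiable_on k f (interior \<Theta>) \<and>
     (\<forall>is. length is \<le> k \<longrightarrow>
        (\<exists>g. continuous_on \<Theta> g \<and> (\<forall>x\<in>interior \<Theta>. g x = iterated_partial_deriv is f x)))}"

section \<open>Local asymptotic normality\<close>

text \<open>Logarithm with \<open>log 0 = -\<infinity>\<close> and \<open>log \<infinity> = \<infinity>\<close>, so that an exceptional value of a
  likelihood ratio is not hidden by a default value of \<^const>\<open>ln\<close>.\<close>

definition log_ennreal :: "ennreal \<Rightarrow> ereal" where
  "log_ennreal r = (if r = 0 then -\<infinity> else if r = \<infinity> then \<infinity> else ereal (ln (enn2real r)))"

definition small_o_prob ::
    "'i filter \<Rightarrow> ('i \<Rightarrow> 'x measure) \<Rightarrow> ('i \<Rightarrow> 'x \<Rightarrow> ereal) \<Rightarrow> bool" where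
  "small_o_prob F Q R \<longleftrightarrow>
     (\<forall>\<delta>>0. ((\<lambda>i. measure (Q i) {x\<in>space (Q i). ereal \<delta> < \<bar>R i x\<bar>}) \<longlongrightarrow> 0) F)"

definition converges_in_law ::
    "'i filter \<Rightarrow> ('i \<Rightarrow> 'x measure) \<Rightarrow> ('i \<Rightarrow> 'x \<Rightarrow> 'b::metric_space) \<Rightarrow> 'b measure \<Rightarrow> bool" where
  "converges_in_law F Q X N \<longleftrightarrow>
     (\<forall>f :: 'b \<Rightarrow>\<^sub>C real. ((\<lambda>i. LINT x|Q i. f (X i x)) \<longlongrightarrow> (LINT y|N. f y)) F)"

definition std_normal_vec :: "(real^'p::finite) measure" where
  "std_normal_vec = density lborel (\<lambda>x. \<Prod>i\<in>UNIV. ennreal (std_normal_density (x $ i)))"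

text \<open>The observation \<open>X\<^sup>\<epsilon>\<close> is the identity on the sample space under \<open>P \<epsilon> \<theta>\<^sub>0\<close>.
  The existence of the density is part of the definition: \<^const>\<open>RN_deriv\<close> is a default value
  without absolute continuity.\<close>

definition locally_asymptotically_normal ::
    "(real^'p::finite) set \<Rightarrow> (real \<Rightarrow> real^'p \<Rightarrow> 'x measure) \<Rightarrow> real^'p \<Rightarrow> bool" where
  "locally_asymptotically_normal \<Theta> P \<theta>\<^sub>0 \<longleftrightarrow>
     (\<exists>(\<phi> :: real \<Rightarrow> real^'p^'p) (\<Delta> :: real \<Rightarrow> 'x \<Rightarrow> real^'p).
        (\<forall>\<epsilon>>0. invertible (\<phi> \<epsilon>)) \<and>
        (\<phi> \<longlongrightarrow> 0) (at_right 0) \<and>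
        (\<forall>\<epsilon>>0. \<Delta> \<epsilon> \<in> borel_measurable (P \<epsilon> \<theta>\<^sub>0)) \<and>
        (\<forall>u. (\<forall>\<^sub>F \<epsilon> in at_right 0. \<theta>\<^sub>0 + \<phi> \<epsilon> *v u \<in> \<Theta> \<and>
                absolutely_continuous (P \<epsilon> \<theta>\<^sub>0) (P \<epsilon> (\<theta>\<^sub>0 + \<phi> \<epsilon> *v u))) \<and>
             small_o_prob (at_right 0) (\<lambda>\<epsilon>. P \<epsilon> \<theta>\<^sub>0)
               (\<lambda>\<epsilon> x. log_ennreal (RN_deriv (P \<epsilon> \<theta>\<^sub>0) (P \<epsilon> (\<theta>\<^sub>0 + \<phi> \<epsilon> *v u)) x)
                        - ereal (u \<bullet> \<Delta> \<epsilon> x - (norm u)\<^sup>2 / 2))) \<and>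
        converges_in_law (at_right 0) (\<lambda>\<epsilon>. P \<epsilon> \<theta>\<^sub>0) \<Delta> std_normal_vec)"

end

theory Submission
  imports Defs
begin

text \<open>Under the true parameter the observation is \<open>X = K \<mu>\<^bsub>\<theta>0\<^esub> + \<epsilon> Z\<close>, and a change of the
  parameter shifts it by \<open>K m\<close> with \<open>m = \<mu>\<^bsub>\<theta>\<^esub> - \<mu>\<^bsub>\<theta>0\<^esub>\<close>. The Cameron--Martin theorem gives
  the log-likelihood ratio \<open>\<langle>n, Z\<rangle> - \<langle>n, K n\<rangle> / 2\<close> with \<open>n = m / \<epsilon>\<close>. Choose the matrix \<open>A\<close> such
  that \<open>A\<close> transposed times \<open>\<Sigma> A\<close> is the identity and put \<open>\<phi>(\<epsilon>) = \<epsilon> A\<close>. For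
  \<open>\<theta> = \<theta>\<^sub>0 + \<phi>(\<epsilon>) u\<close> the measure \<open>n\<close> is a difference quotient and converges in total variation
  to the derivative \<open>d\<close> of \<open>\<mu>\<close> in direction \<open>A u\<close>. The remainder \<open>\<langle>n - d, Z\<rangle>\<close> has variance
  \<open>\<langle>n - d, K (n - d)\<rangle>\<close>, which is at most a multiple of the square of the norm of \<open>n - d\<close>, while
  \<open>\<langle>d, K d\<rangle> = |u|\<^sup>2\<close> by the choice of \<open>A\<close>. So the ratio is \<open>\<langle>d, Z\<rangle> - |u|\<^sup>2 / 2\<close> up to a
  term that vanishes in probability. The variable \<open>\<langle>d, Z\<rangle>\<close> is \<open>u \<bullet> \<Delta>\<close> for a vector \<open>\<Delta>\<close> that
  does not depend on \<open>u\<close>, and \<open>\<Delta>\<close> has exactly the standard normal law, because \<open>u \<bullet> \<Delta>\<close> is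
  centered normal with variance \<open>|u|\<^sup>2\<close> for every \<open>u\<close>.

  The Cameron--Martin theorem (\<open>cameron_martin\<close>) and the law of \<open>\<Delta>\<close> (\<open>distr_eq_std_normal_vec\<close>)
  both follow from the uniqueness theorem \<open>measures_eq_if_trig_integrals_eq\<close> for the characteristic
  functional. For \<open>C(T)\<close> this uses that the evaluations generate the Borel \<open>\<sigma>\<close>-algebra
  (\<open>sets_C_borel_subset_evaluations\<close>), and the characteristic functional of the weighted Gaussian
  law is computed by splitting \<open>\<langle>m, Z\<rangle>\<close> into a multiple of \<open>\<langle>n, Z\<rangle>\<close> and an independent part.
  The identity between covariances and \<open>\<langle>m, K n\<rangle>\<close> is Fubini's theorem; the boundedness of the
  variances that it needs is read off from the continuity of the paths.\<close>

section \<open>Uniqueness of the characteristic functional\<close>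

text \<open>Levy's uniqueness theorem in a form free of complex numbers and of the normalisation to total
  mass one, so that it applies to measures with an arbitrary bounded density.\<close>

lemma finite_measure_real_eqI:
  fixes P Q :: "real measure"
  assumes P: "finite_measure P" "sets P = sets borel" and Q: "finite_measure Q" "sets Q = sets borel"
    and c: "\<And>t. (LINT x|P. cos (t * x)) = (LINT x|Q. cos (t * x))"
    and s: "\<And>t. (LINT x|P. sin (t * x)) = (LINT x|Q. sin (t * x))"
  shows "P = Q"
proof -
  interpret P: finite_measure P by fact
  interpret Q: finite_measure Q by fact
  have [measurable_cong]: "sets P = sets borel" "sets Q = sets borel" by fact+
  define m where "m = measure P (space P)"
  have mQ: "measure Q (space Q) = m"
    using c[of 0] by (simp add: m_def)
  have m0: "m \<ge> 0" by (simp add: m_def)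
  show ?thesis
  proof (cases "m = 0")
    case True
    have "emeasure P A = 0" "emeasure Q A = 0" if "A \<in> sets borel" for A
      using emeasure_space[of P A] emeasure_space[of Q A] that P Q True mQ
      by (auto simp: P.emeasure_eq_measure Q.emeasure_eq_measure m_def intro!: antisym)
    thus ?thesis using P Q by (intro measure_eqI) auto
  next
    case False
    with m0 have m: "m > 0" by simp
    \<comment> \<open>Both measures have mass \<open>m\<close>; dividing by it gives probability measures.\<close>
    define D where "D R = density R (\<lambda>_. ennreal (1 / m))" for R :: "real measure"
    have D: "real_distribution (D R)" "char (D R) = (\<lambda>t. (1 / m) *\<^sub>R (CLINT x|R. iexp (t * x)))"
      "emeasure (D R) A = ennreal (1/m) * emeasure R A"
      if R: "finite_measure R" "sets R = sets borel" "measure R (space R) = m" and A: "A \<in> sets borel"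
        for R A
    proof -
      interpret finite_measure R by fact
      have [measurable_cong]: "sets R = sets borel" by fact
      have sp: "space R = UNIV" using R(2) sets_eq_imp_space_eq by fastforce
      have em: "emeasure (D R) A = ennreal (1/m) * emeasure R A" if "A \<in> sets borel" for A
        using that R(2) by (simp add: D_def emeasure_density nn_integral_cmult_indicator)
      show "emeasure (D R) A = ennreal (1/m) * emeasure R A" using em A by simp
      have "emeasure (D R) (space (D R)) = 1"
      proof -
        have "emeasure (D R) UNIV = ennreal (1/m) * ennreal m"
          using em[of UNIV] R(3) sp by (simp add: emeasure_eq_measure)
        also have "\<dots> = 1" using m by (simp add: ennreal_mult'[symmetric])
        finally show ?thesis by (simp add: D_def sp)
      qed
      hence "prob_space (D R)" by (rule prob_spaceI)
      moreover have "sets (D R) = sets borel" by (simp add: D_def R)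
      ultimately show "real_distribution (D R)"
        unfolding real_distribution_def real_distribution_axioms_def by simp
      show "char (D R) = (\<lambda>t. (1 / m) *\<^sub>R (CLINT x|R. iexp (t * x)))"
        unfolding char_def D_def using m by (subst integral_density) auto
    qed
    have tr: "(CLINT x|R. iexp (t * x)) = Complex (LINT x|R. cos (t * x)) (LINT x|R. sin (t * x))"
      if R: "finite_measure R" "sets R = sets borel" for R t
    proof -
      interpret finite_measure R by fact
      have [measurable_cong]: "sets R = sets borel" by fact
      have i: "integrable R (\<lambda>x. iexp (t * x))"
        by (rule integrable_const_bound[where B=1]) (auto intro!: AE_I2)
      show ?thesis
        using integral_bounded_linear[OF bounded_linear_Re i] integral_bounded_linear[OF bounded_linear_Im i]
        by (simp add: complex_eq_iff Re_exp Im_exp)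
    qed
    have U: "UNIV \<in> sets (borel :: real measure)" by simp
    have "D P = D Q"
    proof (rule Levy_uniqueness)
      show "char (D P) = char (D Q)"
        using D(2)[OF P m_def[symmetric] U] D(2)[OF Q mQ U]
        by (simp only: tr[OF P] tr[OF Q] c s)
    qed (use D(1)[OF P m_def[symmetric] U] D(1)[OF Q mQ U] in auto)
    show ?thesis
    proof (rule measure_eqI)
      fix A assume "A \<in> sets P"
      hence A: "A \<in> sets borel" using P by simp
      have "ennreal (1/m) * emeasure P A = ennreal (1/m) * emeasure Q A"
        using D(3)[OF P m_def[symmetric] A] D(3)[OF Q mQ A] \<open>D P = D Q\<close> by simp
      thus "emeasure P A = emeasure Q A"
        using m by (subst (asm) ennreal_mult_cancel_left) auto
    qed (simp add: P Q)
  qed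
qed

lemma integral_distr_density:
  fixes f :: "real \<Rightarrow> 'd::{banach,second_countable_topology}"
  assumes [measurable]: "w \<in> borel_measurable R" "U \<in> borel_measurable R" "f \<in> borel_measurable borel"
    and w: "\<And>x. x \<in> space R \<Longrightarrow> 0 \<le> w x"
  shows "(LINT y|distr (density R (\<lambda>x. ennreal (w x))) borel U. f y) = (LINT x|R. w x *\<^sub>R f (U x))"
proof -
  have "(LINT y|distr (density R (\<lambda>x. ennreal (w x))) borel U. f y) = (LINT x|density R (\<lambda>x. ennreal (w x)). f (U x))"
    by (rule integral_distr) simp_all
  also have "\<dots> = (LINT x|R. w x *\<^sub>R f (U x))"
    by (rule integral_density) (simp_all add: w AE_I2)
  finally show ?thesis .
qed

lemma finite_measure_distr_density:
  assumes R: "finite_measure R"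
    and [measurable]: "w \<in> borel_measurable R" "U \<in> borel_measurable R"
    and w: "\<And>x. x \<in> space R \<Longrightarrow> w x \<le> B"
  shows "finite_measure (distr (density R (\<lambda>x. ennreal (w x))) borel (U :: _ \<Rightarrow> real))"
proof -
  interpret finite_measure R by fact
  have "emeasure (density R (\<lambda>x. ennreal (w x))) (space R) \<le> (\<integral>\<^sup>+x. ennreal B \<partial>R)"
    by (subst emeasure_density) (auto intro!: nn_integral_mono ennreal_leI w simp del: nn_integral_const split: split_indicator)
  also have "\<dots> < \<infinity>" by (simp add: ennreal_mult_less_top emeasure_eq_measure)
  finally have "finite_measure (density R (\<lambda>x. ennreal (w x)))"
    by (intro finite_measureI) auto
  thus ?thesis by (rule finite_measure.finite_measure_distr) simp
qed

text \<open>The weights \<open>h\<close> and \<open>k\<close> turn \<open>M\<close> and \<open>N\<close> into measures under which \<open>X\<close> and \<open>Y\<close> have the same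
  characteristic function. With \<open>N = M\<close>, \<open>Y = X\<close> and \<open>k\<close> constant the conclusion says that \<open>h\<close> is
  uncorrelated with every function of \<open>X\<close>.\<close>

lemma weighted_trig_eq_imp_integral_eq:
  fixes \<psi> :: "real \<Rightarrow> 'c::{banach,second_countable_topology}"
  assumes M: "finite_measure M" and N: "finite_measure N"
    and [measurable]: "X \<in> borel_measurable M" "h \<in> borel_measurable M"
      "Y \<in> borel_measurable N" "k \<in> borel_measurable N" "\<psi> \<in> borel_measurable borel"
    and h: "\<And>x. x \<in> space M \<Longrightarrow> 0 \<le> h x" "\<And>x. x \<in> space M \<Longrightarrow> h x \<le> B"
    and k: "\<And>x. x \<in> space N \<Longrightarrow> 0 \<le> k x" "\<And>x. x \<in> space N \<Longrightarrow> k x \<le> C"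
    and c: "\<And>t. (LINT x|M. h x * cos (t * X x)) = (LINT x|N. k x * cos (t * Y x))"
    and s: "\<And>t. (LINT x|M. h x * sin (t * X x)) = (LINT x|N. k x * sin (t * Y x))"
  shows "(LINT x|M. h x *\<^sub>R \<psi> (X x)) = (LINT x|N. k x *\<^sub>R \<psi> (Y x))"
proof -
  let ?P = "distr (density M (\<lambda>x. ennreal (h x))) borel X"
  let ?Q = "distr (density N (\<lambda>x. ennreal (k x))) borel Y"
  have "?P = ?Q"
  proof (rule finite_measure_real_eqI)
    show "finite_measure ?P" by (rule finite_measure_distr_density[OF M _ _ h(2)]) auto
    show "finite_measure ?Q" by (rule finite_measure_distr_density[OF N _ _ k(2)]) auto
  qed (use c s h k in \<open>simp_all add: integral_distr_density\<close>)
  thus ?thesis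
    using integral_distr_density[of h M X \<psi>] integral_distr_density[of k N Y \<psi>] h k by simp
qed

text \<open>Uniqueness of the characteristic functional: a finite measure is determined on the
  \<open>\<sigma>\<close>-algebra generated by a vector space \<open>F\<close> of functions by the integrals of \<open>cos f\<close> and
  \<open>sin f\<close> for \<open>f \<in> F\<close>. No multivariate inversion formula is needed: the indicators of the
  conditions \<open>g x \<in> A\<close> are introduced one at a time, each by the univariate theorem with the
  nonnegative weights \<open>1 + cos f\<close> and \<open>1 + sin f\<close> on the cylinder built so far.\<close>

lemma measures_eq_if_trig_integrals_eq:
  fixes F :: "('a \<Rightarrow> real) set"
  assumes M: "finite_measure M" and N: "finite_measure N" and sets_eq: "sets N = sets M"
    and Fm: "\<And>f. f \<in> F \<Longrightarrow> f \<in> borel_measurable M"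
    and F0: "(\<lambda>x. 0) \<in> F"
    and Fadd: "\<And>f g c. f \<in> F \<Longrightarrow> g \<in> F \<Longrightarrow> (\<lambda>x. f x + c * g x) \<in> F"
    and c: "\<And>f. f \<in> F \<Longrightarrow> (LINT x|M. cos (f x)) = (LINT x|N. cos (f x))"
    and s: "\<And>f. f \<in> F \<Longrightarrow> (LINT x|M. sin (f x)) = (LINT x|N. sin (f x))"
    and gen: "sets M \<subseteq> sigma_sets (space M) {f -` A \<inter> space M | f A. f \<in> F \<and> A \<in> sets borel}"
  shows "M = N"
proof -
  interpret M: finite_measure M by fact
  interpret N: finite_measure N by fact
  have sp: "space N = space M" using sets_eq by (rule sets_eq_imp_space_eq)
  have FmN: "f \<in> borel_measurable N" if "f \<in> F" for f
    using Fm[OF that] sets_eq by (simp cong: measurable_cong_sets)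
  \<comment> \<open>Cylinder sets, given by finitely many conditions \<open>g x \<in> A\<close>.\<close>
  define cyl where "cyl l = {x\<in>space M. \<forall>(g, A)\<in>set l. g x \<in> A}" for l :: "(('a \<Rightarrow> real) \<times> real set) list"
  define ok where "ok l \<longleftrightarrow> (\<forall>(g, A)\<in>set l. g \<in> F \<and> A \<in> sets borel)" for l :: "(('a \<Rightarrow> real) \<times> real set) list"
  have cyl_sets: "cyl l \<in> sets M" if "ok l" for l
    using that
  proof (induction l)
    case Nil
    thus ?case by (simp add: cyl_def)
  next
    case (Cons gA l)
    obtain g A where gA: "gA = (g, A)" by (cases gA)
    have "cyl (gA # l) = cyl l \<inter> (g -` A \<inter> space M)"
      by (auto simp: cyl_def gA)
    moreover have "g -` A \<inter> space M \<in> sets M"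
      using Cons.prems Fm[of g] by (auto simp: ok_def gA)
    ultimately show ?case using Cons by (auto simp: ok_def)
  qed
  have int: "integrable M (\<lambda>x. indicator (cyl l) x * u (f x))" 
            "integrable N (\<lambda>x. indicator (cyl l) x * u (f x))"
    if l: "ok l" and f: "f \<in> F" and [measurable]: "u \<in> borel_measurable borel" and u: "\<And>y. \<bar>u y\<bar> \<le> (1::real)"
    for l f u
  proof -
    have [measurable]: "cyl l \<in> sets M" "cyl l \<in> sets N" "f \<in> borel_measurable M" "f \<in> borel_measurable N"
      using cyl_sets[OF l] sets_eq Fm[OF f] FmN[OF f] by auto
    show "integrable M (\<lambda>x. indicator (cyl l) x * u (f x))" 
      by (rule M.integrable_const_bound[where B=1]) (auto simp: u abs_mult indicator_def)
    show "integrable N (\<lambda>x. indicator (cyl l) x * u (f x))" 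
      by (rule N.integrable_const_bound[where B=1]) (auto simp: u abs_mult indicator_def)
  qed
  have main: "\<forall>f\<in>F. (LINT x|M. indicator (cyl l) x * cos (f x)) = (LINT x|N. indicator (cyl l) x * cos (f x)) \<and>
        (LINT x|M. indicator (cyl l) x * sin (f x)) = (LINT x|N. indicator (cyl l) x * sin (f x))"
    if "ok l" for l
    using that
  proof (induction l)
    case Nil
    have 1: "(LINT x|R. indicator (cyl []) x * u x) = (LINT x|R. u x)" if "space R = space M" for R and u :: "'a \<Rightarrow> real"
      using that by (intro Bochner_Integration.integral_cong) (auto simp: cyl_def)
    show ?case using c s sp by (simp add: 1)
  next
    case (Cons gA l)
    obtain g A where gA: "gA = (g, A)" by (cases gA)
    have g: "g \<in> F" and A[measurable]: "A \<in> sets borel" and l: "ok l" using Cons.prems by (auto simp: ok_def gA)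
    note IH = Cons.IH[OF l]
    have [measurable]: "cyl l \<in> sets M" "cyl l \<in> sets N" "g \<in> borel_measurable M" "g \<in> borel_measurable N"
      using cyl_sets[OF l] sets_eq Fm[OF g] FmN[OF g] by auto
    have ind: "indicator (cyl (gA # l)) x * y = indicator (cyl l) x * y * indicator A (g x)" for x and y :: real
      by (auto simp: cyl_def gA indicator_def)
    have tr: "indicator (cyl (gA # l)) x * y = indicator (cyl l) x * (1 + y) * indicator A (g x)
        - indicator (cyl l) x * indicator A (g x)" for x and y :: real
      unfolding ind by (simp add: algebra_simps)
    have base: "(LINT x|M. indicator (cyl l) x * indicator A (g x)) = (LINT x|N. indicator (cyl l) x * indicator A (g x) :: real)"
    proof (rule weighted_trig_eq_imp_integral_eq[OF M N, where B=1 and C=1 and X=g and Y=g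
          and h="indicator (cyl l)" and k="indicator (cyl l)" and \<psi>="indicator A :: real \<Rightarrow> real", unfolded real_scaleR_def])
      fix t
      have tg: "(\<lambda>x. t * g x) \<in> F" using Fadd[OF F0 g, of t] by simp
      show "(LINT x|M. indicator (cyl l) x * cos (t * g x)) = (LINT x|N. indicator (cyl l) x * cos (t * g x))"
           "(LINT x|M. indicator (cyl l) x * sin (t * g x)) = (LINT x|N. indicator (cyl l) x * sin (t * g x))"
        using IH tg by auto
    qed (auto simp: indicator_def)
    \<comment> \<open>The cases \<open>u = cos\<close>, \<open>u' = sin\<close> and \<open>u = sin\<close>, \<open>u' = - cos\<close> of the following claim are needed.\<close>
    have wt: "(LINT x|M. indicator (cyl (gA # l)) x * u (f x)) = (LINT x|N. indicator (cyl (gA # l)) x * u (f x))"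
      if f: "f \<in> F" and [measurable]: "u \<in> borel_measurable borel" and u: "\<And>y. \<bar>u y\<bar> \<le> (1::real)"
        and uc: "\<And>a b. u a * cos b = (u (a + b) + u (a - b)) / 2"
        and us: "\<And>a b. u a * sin b = (u' (a + b) - u' (a - b)) / 2"
        and [measurable]: "u' \<in> borel_measurable borel" and u'1: "\<And>y. \<bar>u' y\<bar> \<le> (1::real)"
        and eq: "\<And>f. f \<in> F \<Longrightarrow> (LINT x|M. indicator (cyl l) x * u (f x)) = (LINT x|N. indicator (cyl l) x * u (f x))"
        and eq': "\<And>f. f \<in> F \<Longrightarrow> (LINT x|M. indicator (cyl l) x * u' (f x)) = (LINT x|N. indicator (cyl l) x * u' (f x))"
      for f u u'
    proof -
      have [measurable]: "f \<in> borel_measurable M" "f \<in> borel_measurable N" using Fm[OF f] FmN[OF f] by auto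
      have u1: "0 \<le> 1 + u y" "1 + u y \<le> 2" for y using u[of y] by linarith+
      have w: "(LINT x|M. (indicator (cyl l) x * (1 + u (f x))) * indicator A (g x)) =
            (LINT x|N. (indicator (cyl l) x * (1 + u (f x))) * indicator A (g x) :: real)"
      proof (rule weighted_trig_eq_imp_integral_eq[OF M N, where B=2 and C=2 and X=g and Y=g
          and h="\<lambda>x. indicator (cyl l) x * (1 + u (f x))" and k="\<lambda>x. indicator (cyl l) x * (1 + u (f x))"
          and \<psi>="indicator A :: real \<Rightarrow> real", unfolded real_scaleR_def])
        fix t
        have F: "(\<lambda>x. t * g x) \<in> F" "(\<lambda>x. f x + t * g x) \<in> F" "(\<lambda>x. f x - t * g x) \<in> F"
          using Fadd[OF F0 g, of t] Fadd[OF f g, of t] Fadd[OF f g, of "-t"] by auto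
        have 1: "indicator (cyl l) x * (1 + u (f x)) * cos (t * g x) =
            indicator (cyl l) x * cos (t * g x) + (1/2) * (indicator (cyl l) x * u (f x + t * g x)) + (1/2) * (indicator (cyl l) x * u (f x - t * g x))" for x
          using uc[of "f x" "t * g x"] by (simp add: indicator_def algebra_simps)
        have 2: "indicator (cyl l) x * (1 + u (f x)) * sin (t * g x) =
            indicator (cyl l) x * sin (t * g x) + (1/2) * (indicator (cyl l) x * u' (f x + t * g x)) - (1/2) * (indicator (cyl l) x * u' (f x - t * g x))" for x
          using us[of "f x" "t * g x"] by (simp add: indicator_def algebra_simps)
        note i = int[OF l F(1), of cos] int[OF l F(1), of sin] int[OF l F(2), of u] int[OF l F(3), of u]
           int[OF l F(2), of u'] int[OF l F(3), of u']
        show "(LINT x|M. indicator (cyl l) x * (1 + u (f x)) * cos (t * g x)) = (LINT x|N. indicator (cyl l) x * (1 + u (f x)) * cos (t * g x))"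
          unfolding 1 using i u u'1 eq[OF F(2)] eq[OF F(3)] IH F(1) by simp
        show "(LINT x|M. indicator (cyl l) x * (1 + u (f x)) * sin (t * g x)) = (LINT x|N. indicator (cyl l) x * (1 + u (f x)) * sin (t * g x))"
          unfolding 2 using i u u'1 eq'[OF F(2)] eq'[OF F(3)] IH F(1) by simp
      qed (use u1 in \<open>auto simp: indicator_def\<close>)
      have i: "integrable R (\<lambda>x. (indicator (cyl l) x * (1 + u (f x))) * indicator A (g x))"
         "integrable R (\<lambda>x. indicator (cyl l) x * indicator A (g x) :: real)"
         if R: "finite_measure R" and [measurable]: "cyl l \<in> sets R" "g \<in> borel_measurable R" "f \<in> borel_measurable R" for R
        using u1 by (auto intro!: finite_measure.integrable_const_bound[OF R, where B=2] simp: indicator_def)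
      show ?thesis unfolding tr using i[OF M] i[OF N] w base by simp
    qed
    show ?case
    proof (intro ballI conjI)
      fix f assume f: "f \<in> F"
      show "(LINT x|M. indicator (cyl (gA # l)) x * cos (f x)) = (LINT x|N. indicator (cyl (gA # l)) x * cos (f x))"
      proof (rule wt[OF f, where u'=sin])
        show "cos a * cos b = (cos (a + b) + cos (a - b)) / 2" for a b :: real
          by (simp add: cos_times_cos)
        show "cos a * sin b = (sin (a + b) - sin (a - b)) / 2" for a b :: real
          by (simp add: cos_times_sin)
      qed (simp_all add: IH)
      show "(LINT x|M. indicator (cyl (gA # l)) x * sin (f x)) = (LINT x|N. indicator (cyl (gA # l)) x * sin (f x))"
      proof (rule wt[OF f, where u'="\<lambda>x. - cos x"])
        show "sin a * cos b = (sin (a + b) + sin (a - b)) / 2" for a b :: real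
          by (simp add: sin_times_cos)
        show "sin a * sin b = (- cos (a + b) - - cos (a - b)) / 2" for a b :: real
          by (simp add: sin_times_sin)
        show "(LINT x|M. indicator (cyl l) x * - cos (h x)) = (LINT x|N. indicator (cyl l) x * - cos (h x))"
          if "h \<in> F" for h
          using IH that by simp
        show "(LINT x|M. indicator (cyl l) x * sin (h x)) = (LINT x|N. indicator (cyl l) x * sin (h x))"
          if "h \<in> F" for h
          using IH that by blast
      qed simp_all
    qed
  qed
  let ?E = "cyl ` {l. ok l}"
  show ?thesis
  proof (rule measure_eqI_generator_eq[where E="?E" and \<Omega>="space M" and A="\<lambda>_::nat. space M"])
    show "Int_stable ?E"
    proof (rule Int_stableI)
      fix a b assume "a \<in> ?E" "b \<in> ?E"
      then obtain l l' where l: "ok l" "ok l'" "a = cyl l" "b = cyl l'" by auto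
      have "ok (l @ l')" using l by (auto simp: ok_def)
      moreover have "a \<inter> b = cyl (l @ l')" using l by (auto simp: cyl_def)
      ultimately show "a \<inter> b \<in> ?E" by blast
    qed
    show "?E \<subseteq> Pow (space M)" by (auto simp: cyl_def)
    have sub: "sigma_sets (space M) ?E \<subseteq> sets M"
      using cyl_sets by (intro sets.sigma_sets_subset) auto
    have "{f -` A \<inter> space M | f A. f \<in> F \<and> A \<in> sets borel} \<subseteq> ?E"
    proof clarify
      fix f A assume fA: "f \<in> F" "A \<in> sets (borel :: real measure)"
      have "ok [(f, A)]" "f -` A \<inter> space M = cyl [(f, A)]" using fA by (auto simp: ok_def cyl_def)
      thus "f -` A \<inter> space M \<in> ?E" by blast
    qed
    from order_trans[OF gen sigma_sets_mono'[OF this]]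
    have "sets M \<subseteq> sigma_sets (space M) ?E" .
    with sub show "sets M = sigma_sets (space M) ?E" by auto
    thus "sets N = sigma_sets (space M) ?E" using sets_eq by simp
    have "ok []" "space M = cyl []" by (auto simp: ok_def cyl_def)
    thus "range (\<lambda>_::nat. space M) \<subseteq> ?E" by blast
    fix X assume "X \<in> ?E"
    then obtain l where l: "ok l" "X = cyl l" by auto
    have [measurable]: "X \<in> sets M" "X \<in> sets N" using cyl_sets[OF l(1)] l(2) sets_eq by auto
    have "(LINT x|M. indicator X x * cos 0) = (LINT x|N. indicator X x * cos (0::real))"
      using main[OF l(1)] F0 l(2) by fast
    hence "measure M X = measure N X" by (simp add: sp)
    thus "emeasure M X = emeasure N X" by (simp add: M.emeasure_eq_measure N.emeasure_eq_measure)
  qed auto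
qed

section \<open>Integration against signed measures\<close>

lemma abs_sm_le_norm:
  assumes "A \<in> sets borel"
  shows "\<bar>sm m A\<bar> \<le> norm m"
proof -
  have "\<bar>sm m A\<bar> \<le> (\<Sum>B\<in>{A, - A}. \<bar>sm m B\<bar>)" by (rule member_le_sum) auto
  also have "\<dots> \<le> norm m"
    unfolding norm_signed_measure.rep_eq total_variation_def
    using compl_partition[OF assms] bdd_above_variation by (rule cSUP_upper)
  finally show ?thesis .
qed

lemma measure_pos_part_le_norm: "measure (pos_part m) UNIV \<le> norm m"
proof -
  interpret finite_measure "pos_part m" by (rule finite_measure_pos_part)
  have "emeasure (pos_part m) UNIV \<le> ennreal (norm m)"
    using abs_sm_le_norm[of _ m] by (subst emeasure_pos_part) (auto intro!: SUP_least ennreal_leI dest: abs_le_D1)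
  thus ?thesis by (simp add: emeasure_eq_measure)
qed

text \<open>A linear relation between finite measures is inherited by the integrals of bounded functions.
  This makes the integral against a signed measure independent of the decomposition into positive
  measures, which is what its linearity in the measure rests on.\<close>

lemma sum_integral_eq_0_if_sum_measure_eq_0:
  fixes M :: "'i \<Rightarrow> real measure" and c :: "'i \<Rightarrow> real" and g :: "real \<Rightarrow> real"
  assumes I: "finite I" and fin: "\<And>i. i \<in> I \<Longrightarrow> finite_measure (M i)"
    and sets: "\<And>i. i \<in> I \<Longrightarrow> sets (M i) = sets borel"
    and zero: "\<And>A. A \<in> sets borel \<Longrightarrow> (\<Sum>i\<in>I. c i * measure (M i) A) = 0"
    and g: "g \<in> borel_measurable borel" and bd: "\<And>x. \<bar>g x\<bar> \<le> B"
  shows "(\<Sum>i\<in>I. c i * (LINT x|M i. g x)) = 0"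
proof -
  have space: "space (M i) = UNIV" if "i \<in> I" for i
    using sets_eq_imp_space_eq[OF sets[OF that]] by simp
  have meas: "u \<in> borel_measurable (M i)" if "i \<in> I" "u \<in> borel_measurable borel" for i and u :: "real \<Rightarrow> real"
    using that sets[OF that(1)] by (simp cong: measurable_cong_sets)
  \<comment> \<open>First for nonnegative functions; then \<open>g = (g + B) - B\<close>.\<close>
  have pos: "(\<forall>i\<in>I. integrable (M i) u) \<longrightarrow> (\<Sum>i\<in>I. c i * (LINT x|M i. u x)) = 0"
    if "u \<in> borel_measurable borel" "\<And>x. 0 \<le> u x" for u
    using that
  proof (induction u rule: borel_measurable_induct_real)
    case (set A)
    have "(LINT x|M i. indicator A x) = measure (M i) A" if "i \<in> I" for i
      using space[OF that] by simp
    thus ?case using zero[OF set] by simp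
  next
    case (mult u d)
    show ?case
    proof (cases "d = 0")
      case False
      have "(\<Sum>i\<in>I. c i * (LINT x|M i. d * u x)) = d * (\<Sum>i\<in>I. c i * (LINT x|M i. u x))"
        by (simp add: sum_distrib_left algebra_simps)
      thus ?thesis using mult False by simp
    qed simp
  next
    case (add u v)
    show ?case
    proof
      assume int: "\<forall>i\<in>I. integrable (M i) (\<lambda>x. v x + u x)"
      have i: "integrable (M i) u" "integrable (M i) v" if i: "i \<in> I" for i
      proof -
        have vu: "integrable (M i) (\<lambda>x. v x + u x)" using int i by blast
        show "integrable (M i) u"
          by (rule Bochner_Integration.integrable_bound[OF vu meas[OF i add.hyps(1)]])
             (simp add: add.hyps(2,4))
        show "integrable (M i) v"
          by (rule Bochner_Integration.integrable_bound[OF vu meas[OF i add.hyps(3)]])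
             (simp add: add.hyps(2,4))
      qed
      have "(\<Sum>i\<in>I. c i * (LINT x|M i. v x + u x)) = (\<Sum>i\<in>I. c i * (LINT x|M i. v x)) + (\<Sum>i\<in>I. c i * (LINT x|M i. u x))"
        using i by (simp add: sum.distrib[symmetric] algebra_simps)
      thus "(\<Sum>i\<in>I. c i * (LINT x|M i. v x + u x)) = 0" using add.IH i by simp
    qed
  next
    case (seq U)
    show ?case
    proof
      assume int: "\<forall>i\<in>I. integrable (M i) u"
      have le: "U n x \<le> u x" for n x
        using seq.hyps(3) seq.hyps(4)[of x] by (intro incseq_le) (auto simp: incseq_def le_fun_def)
      have iU: "integrable (M i) (U n)" if i: "i \<in> I" for i n
        by (rule Bochner_Integration.integrable_bound[OF int[rule_format, OF i] meas[OF i seq.hyps(1)]])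
           (simp add: le seq.hyps(2) order_trans[OF seq.hyps(2) le])
      have conv: "(\<lambda>n. LINT x|M i. U n x) \<longlonglongrightarrow> (LINT x|M i. u x)" if i: "i \<in> I" for i
      proof (rule integral_dominated_convergence[where w=u])
        show "AE x in M i. norm (U n x) \<le> u x" for n using le seq.hyps(2) by simp
        show "AE x in M i. (\<lambda>n. U n x) \<longlonglongrightarrow> u x" using seq.hyps(4) by simp
        show "u \<in> borel_measurable (M i)" using int i by auto
        show "U n \<in> borel_measurable (M i)" for n using iU[OF i] by auto
      qed (use int i in auto)
      have "(\<lambda>n. \<Sum>i\<in>I. c i * (LINT x|M i. U n x)) \<longlonglongrightarrow> (\<Sum>i\<in>I. c i * (LINT x|M i. u x))"
        by (intro tendsto_intros conv)
      moreover have "(\<Sum>i\<in>I. c i * (LINT x|M i. U n x)) = 0" for n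
        using seq.IH[of n] iU by blast
      ultimately show "(\<Sum>i\<in>I. c i * (LINT x|M i. u x)) = 0"
        by (simp add: LIMSEQ_const_iff)
    qed
  qed
  have intg: "integrable (M i) u" if "i \<in> I" "u \<in> borel_measurable borel" "\<And>x. \<bar>u x\<bar> \<le> C" for i u and C :: real
    using that by (intro finite_measure.integrable_const_bound[OF fin, where B=C] meas) auto
  have B: "\<bar>g x + B\<bar> \<le> 2 * B" "0 \<le> g x + B" "\<bar>B\<bar> \<le> B" for x
    using bd[of x] by linarith+
  have "(\<Sum>i\<in>I. c i * (LINT x|M i. g x + B)) = 0"
  proof (rule pos[THEN mp])
    show "\<forall>i\<in>I. integrable (M i) (\<lambda>x. g x + B)"
      using intg[of _ "\<lambda>x. g x + B" "2 * B"] g B(1) by auto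
  qed (use g B(2) in auto)
  moreover have "(\<Sum>i\<in>I. c i * (LINT x|M i. B)) = 0"
  proof (rule pos[THEN mp])
    show "\<forall>i\<in>I. integrable (M i) (\<lambda>x. B)"
      using finite_measure.integrable_const[OF fin] by blast
  qed (use B(3) in auto)
  moreover have "(LINT x|M i. g x + B) = (LINT x|M i. g x) + (LINT x|M i. B)" if "i \<in> I" for i
    using intg[OF that, of g B] intg[OF that, of "\<lambda>_. B" B] g bd B(3) by (intro Bochner_Integration.integral_add) auto
  ultimately show ?thesis by (simp add: algebra_simps sum.distrib)
qed

lemma indicator_continuous_bounded:
  fixes f :: "real \<Rightarrow> real"
  assumes "compact T" "continuous_on T f"
  obtains B where "(\<lambda>x. indicator T x * f x) \<in> borel_measurable borel"
    "\<And>x. \<bar>indicator T x * f x\<bar> \<le> B" "B \<ge> 0"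
proof -
  have "(\<lambda>x. indicator T x *\<^sub>R f x) \<in> borel_measurable borel"
    using assms by (intro borel_measurable_continuous_on_indicator borel_compact) auto
  moreover obtain B where "\<And>x. x \<in> T \<Longrightarrow> \<bar>f x\<bar> \<le> B" "B > 0"
    using compact_imp_bounded[OF compact_continuous_image[OF assms(2,1)]] by (auto simp: bounded_pos)
  ultimately show ?thesis by (intro that[of B]) (auto simp: indicator_def)
qed

lemma set_integrable_pos_part:
  fixes f :: "real \<Rightarrow> real"
  assumes "compact T" "continuous_on T f"
  shows "set_integrable (pos_part m) T f"
proof -
  obtain B where [measurable]: "(\<lambda>x. indicator T x * f x) \<in> borel_measurable borel"
    and "\<And>x. \<bar>indicator T x * f x\<bar> \<le> B" by (rule indicator_continuous_bounded[OF assms]) blast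
  thus ?thesis unfolding set_integrable_def
    by (intro finite_measure.integrable_const_bound[OF finite_measure_pos_part, where B=B]) auto
qed

lemma signed_integral_linear_measure:
  assumes T: "compact T" "continuous_on T f"
  shows "signed_integral T (c *\<^sub>R m + d *\<^sub>R n) f = c * signed_integral T m f + d * signed_integral T n f"
proof -
  obtain B where g: "(\<lambda>x. indicator T x * f x) \<in> borel_measurable borel"
    "\<And>x. \<bar>indicator T x * f x\<bar> \<le> B" by (rule indicator_continuous_bounded[OF T]) blast
  let ?k = "c *\<^sub>R m + d *\<^sub>R n"
  let ?M = "(!) [pos_part ?k, pos_part (- ?k), pos_part m, pos_part (- m), pos_part n, pos_part (- n)]"
  let ?c = "(!) [1, - 1, - c, c, - d, d]"
  have I: "{..<6::nat} = {0, 1, 2, 3, 4, 5}" by auto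
  have "(\<Sum>i\<in>{..<6::nat}. ?c i * (LINT x|?M i. indicator T x * f x)) = 0"
  proof (rule sum_integral_eq_0_if_sum_measure_eq_0[OF _ _ _ _ g])
    fix A :: "real set" assume A: "A \<in> sets borel"
    have "sm ?k A = c * sm m A + d * sm n A"
      by (simp add: plus_signed_measure.rep_eq scaleR_signed_measure.rep_eq)
    thus "(\<Sum>i<6::nat. ?c i * measure (?M i) A) = 0"
      unfolding I jordan_decomposition[OF A] by (simp add: algebra_simps)
  qed (auto simp: I finite_measure_pos_part)
  thus ?thesis
    unfolding I signed_integral_def set_lebesgue_integral_def by (simp add: algebra_simps)
qed

lemma signed_integral_linear_fun:
  assumes T: "compact T" "continuous_on T f" "continuous_on T g"
  shows "signed_integral T m (\<lambda>t. c * f t + d * g t) = c * signed_integral T m f + d * signed_integral T m g"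
  using set_integrable_pos_part[OF T(1,2)] set_integrable_pos_part[OF T(1,3)]
  by (simp add: signed_integral_def algebra_simps)

lemma signed_integral_cong:
  assumes "\<And>t. t \<in> T \<Longrightarrow> f t = g t"
  shows "signed_integral T m f = signed_integral T m g"
  unfolding signed_integral_def set_lebesgue_integral_def
  by (intro arg_cong2[where f="(-)"] Bochner_Integration.integral_cong) (auto simp: assms indicator_def)

text \<open>The constant \<open>2\<close> comes from bounding the positive and the negative part separately.\<close>

lemma abs_signed_integral_le:
  assumes T: "compact T" "continuous_on T f" and B: "\<And>t. t \<in> T \<Longrightarrow> \<bar>f t\<bar> \<le> B" and "B \<ge> 0"
  shows "\<bar>signed_integral T m f\<bar> \<le> 2 * norm m * B"
proof -
  have "\<bar>set_lebesgue_integral (pos_part k) T f\<bar> \<le> B * norm k" for k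
  proof -
    interpret finite_measure "pos_part k" by (rule finite_measure_pos_part)
    have "\<bar>set_lebesgue_integral (pos_part k) T f\<bar> \<le> (LINT x|pos_part k. \<bar>indicator T x *\<^sub>R f x\<bar>)"
      unfolding set_lebesgue_integral_def by (rule integral_abs_bound)
    also have "\<dots> \<le> (LINT x|pos_part k. B)"
      using set_integrable_pos_part[OF T, of k] B \<open>B \<ge> 0\<close>
      by (intro integral_mono) (auto simp: set_integrable_def indicator_def)
    also have "\<dots> \<le> B * norm k"
      using measure_pos_part_le_norm[of k] \<open>B \<ge> 0\<close> by (simp add: mult.commute mult_left_mono)
    finally show ?thesis .
  qed
  from this[of m] this[of "- m"] show ?thesis
    unfolding signed_integral_def by (simp add: algebra_simps)
qed

text \<open>The unit mass at \<open>s\<close>; integration against it is evaluation at \<open>s\<close>.\<close>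

lift_definition point_mass :: "real \<Rightarrow> signed_measure" is
  "\<lambda>s A. if A \<in> sets borel \<and> s \<in> A then 1 else 0"
proof -
  fix s :: real
  have "(\<lambda>n. if A n \<in> sets borel \<and> s \<in> A n then 1 else 0) sums
        (if (\<Union>n. A n) \<in> sets borel \<and> s \<in> (\<Union>n. A n) then 1 else (0::real))"
    if A: "range A \<subseteq> sets borel" "disjoint_family A" for A :: "nat \<Rightarrow> real set"
  proof (cases "s \<in> (\<Union>n. A n)")
    case True
    then obtain k where k: "s \<in> A k" by auto
    hence "s \<in> A n \<longleftrightarrow> n = k" for n
      using A(2) by (auto simp: disjoint_family_on_def)
    hence "(\<lambda>n. if A n \<in> sets borel \<and> s \<in> A n then 1 else 0) = (\<lambda>n. if n = k then 1 else (0::real))"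
      using A(1) by (auto simp: fun_eq_iff)
    thus ?thesis using sums_single[of k "\<lambda>_. 1::real"] A(1) True by (auto simp: sets.countable_UN)
  next
    case False
    thus ?thesis by auto
  qed
  thus "countably_additive_real (\<lambda>A. if A \<in> sets borel \<and> s \<in> A then 1 else 0) \<and>
         (\<forall>A. A \<notin> sets borel \<longrightarrow> (if A \<in> sets borel \<and> s \<in> A then 1 else 0) = (0::real))"
    unfolding countably_additive_real_def by simp
qed

lemma point_mass_on: "s \<in> T \<Longrightarrow> point_mass s \<in> signed_measures_on T"
  by (auto simp: signed_measures_on_def point_mass.rep_eq)

lemma signed_integral_point_mass:
  assumes T: "compact T" "continuous_on T f" and s: "s \<in> T"
  shows "signed_integral T (point_mass s) f = f s"
proof -
  obtain B where g: "(\<lambda>x. indicator T x * f x) \<in> borel_measurable borel"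
    "\<And>x. \<bar>indicator T x * f x\<bar> \<le> B" by (rule indicator_continuous_bounded[OF T]) blast
  let ?m = "point_mass s"
  let ?M = "(!) [pos_part ?m, pos_part (- ?m), return borel s]"
  let ?c = "(!) [1, - 1, - 1]"
  have I: "{..<3::nat} = {0, 1, 2}" by auto
  have fin: "finite_measure (return borel s)"
    by (intro prob_space.finite_measure prob_space_return) simp
  have "(\<Sum>i\<in>{..<3::nat}. ?c i * (LINT x|?M i. indicator T x * f x)) = 0"
  proof (rule sum_integral_eq_0_if_sum_measure_eq_0[OF _ _ _ _ g])
    fix A :: "real set" assume A: "A \<in> sets borel"
    have "measure (return borel s) A = sm ?m A"
      using A by (simp add: point_mass.rep_eq measure_return indicator_def)
    thus "(\<Sum>i<3::nat. ?c i * measure (?M i) A) = 0"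
      unfolding I jordan_decomposition[OF A] by simp
  qed (auto simp: I finite_measure_pos_part fin)
  moreover have "(LINT x|return borel s. indicator T x * f x) = f s"
    using s by (subst integral_return) (auto intro: g(1))
  ultimately show ?thesis
    unfolding I signed_integral_def set_lebesgue_integral_def by simp
qed

lemma signed_measures_on_linear:
  assumes "m \<in> signed_measures_on T" "n \<in> signed_measures_on T"
  shows "c *\<^sub>R m + d *\<^sub>R n \<in> signed_measures_on T"
  using assms by (auto simp: signed_measures_on_def plus_signed_measure.rep_eq scaleR_signed_measure.rep_eq)

section \<open>The Borel sets of the space of continuous functions\<close>

lemma mspace_C_space:
  assumes "compact T"
  shows "mspace (C_space T) = {f. f \<in> extensional T \<and> continuous_on T f}"
proof -
  have "mspace (C_space T) = {f \<in> topspace (top_of_set T) \<rightarrow>\<^sub>E mspace euclidean_metric.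
      continuous_map (top_of_set T) (mtopology_of euclidean_metric) f}"
    unfolding C_space_def
    using assms by (subst compactin_mspace_cfunspace) (auto simp: compactin_subtopology PiE_def)
  also have "\<dots> = {f. f \<in> extensional T \<and> continuous_on T f}"
    by (auto simp: PiE_def)
  finally show ?thesis .
qed

text \<open>With closed instead of open balls the description of the topology needs no supremum.\<close>

lemma openin_C_space:
  assumes T: "compact T"
  shows "openin (mtopology_of (C_space T)) U \<longleftrightarrow> U \<subseteq> mspace (C_space T) \<and>
    (\<forall>x\<in>U. \<exists>r>0. \<forall>y\<in>mspace (C_space T). (\<forall>t\<in>T. \<bar>x t - y t\<bar> \<le> r) \<longrightarrow> y \<in> U)"
proof -
  interpret Metric_space "mspace (C_space T)" "mdist (C_space T)" by (rule Metric_space_mspace_mdist)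
  have le: "mdist (C_space T) x y \<le> r \<longleftrightarrow> (\<forall>t\<in>T. \<bar>x t - y t\<bar> \<le> r)"
    if "x \<in> mspace (C_space T)" "y \<in> mspace (C_space T)" "r > 0" for x y r
  proof -
    have "mdist (C_space T) x y \<le> r" if "\<forall>t\<in>T. \<bar>x t - y t\<bar> \<le> r"
      unfolding C_space_def using that \<open>r > 0\<close> by (intro mdist_cfunspace_le) (auto simp: dist_real_def)
    moreover have "\<bar>x t - y t\<bar> \<le> r" if "mdist (C_space T) x y \<le> r" "t \<in> T" for t
      using mdist_cfunspace_imp_mdist_le[of x "top_of_set T" euclidean_metric y r t] that
        \<open>x \<in> _\<close> \<open>y \<in> _\<close> by (simp add: C_space_def dist_real_def)
    ultimately show ?thesis by blast
  qed
  have "(\<exists>r>0. mball x r \<subseteq> U) \<longleftrightarrow> (\<exists>r>0. \<forall>y\<in>mspace (C_space T). (\<forall>t\<in>T. \<bar>x t - y t\<bar> \<le> r) \<longrightarrow> y \<in> U)"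
    if x: "x \<in> mspace (C_space T)" for x
  proof
    assume "\<exists>r>0. mball x r \<subseteq> U"
    then obtain r where r: "r > 0" "mball x r \<subseteq> U" by blast
    show "\<exists>r>0. \<forall>y\<in>mspace (C_space T). (\<forall>t\<in>T. \<bar>x t - y t\<bar> \<le> r) \<longrightarrow> y \<in> U"
    proof (intro exI[of _ "r/2"] conjI ballI impI)
      fix y assume y: "y \<in> mspace (C_space T)" "\<forall>t\<in>T. \<bar>x t - y t\<bar> \<le> r/2"
      hence "mdist (C_space T) x y \<le> r/2" using le[OF x y(1), of "r/2"] r by simp
      thus "y \<in> U" using r x y by (auto simp: subset_iff)
    qed (use r in auto)
  next
    assume "\<exists>r>0. \<forall>y\<in>mspace (C_space T). (\<forall>t\<in>T. \<bar>x t - y t\<bar> \<le> r) \<longrightarrow> y \<in> U"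
    then obtain r where r: "r > 0" "\<And>y. y \<in> mspace (C_space T) \<Longrightarrow> (\<forall>t\<in>T. \<bar>x t - y t\<bar> \<le> r) \<Longrightarrow> y \<in> U"
      by blast
    have "mball x r \<subseteq> U" using r le[OF x _ r(1)] by (auto intro!: r(2)) (metis less_imp_le)
    thus "\<exists>r>0. mball x r \<subseteq> U" using r by blast
  qed
  moreover have "openin (mtopology_of (C_space T)) U \<longleftrightarrow> U \<subseteq> mspace (C_space T) \<and> (\<forall>x\<in>U. \<exists>r>0. mball x r \<subseteq> U)"
    unfolding mtopology_of_def openin_mtopology by auto
  ultimately show ?thesis by blast
qed

lemma space_C_borel [simp]: "space (C_borel T) = mspace (C_space T)"
  by (simp add: C_borel_def space_measure_of_conv)

lemma sets_C_borel:
  "sets (C_borel T) = sigma_sets (mspace (C_space T)) {U. openin (mtopology_of (C_space T)) U}"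
proof -
  have "{U. openin (mtopology_of (C_space T)) U} \<subseteq> Pow (mspace (C_space T))"
    using openin_subset[of "mtopology_of (C_space T)"] by auto
  thus ?thesis by (simp add: C_borel_def)
qed

lemma borel_measurable_C_borelI:
  fixes L :: "(real \<Rightarrow> real) \<Rightarrow> real"
  assumes T: "compact T"
    and lip: "\<And>x y r. x \<in> mspace (C_space T) \<Longrightarrow> y \<in> mspace (C_space T) \<Longrightarrow> r \<ge> 0 \<Longrightarrow>
       (\<And>t. t \<in> T \<Longrightarrow> \<bar>x t - y t\<bar> \<le> r) \<Longrightarrow> \<bar>L x - L y\<bar> \<le> c * r"
  shows "L \<in> borel_measurable (C_borel T)"
proof (rule borel_measurableI)
  fix S :: "real set" assume S: "open S"
  have "openin (mtopology_of (C_space T)) (L -` S \<inter> space (C_borel T))"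
    unfolding openin_C_space[OF T]
  proof (intro conjI ballI)
    fix x assume x: "x \<in> L -` S \<inter> space (C_borel T)"
    then obtain e where e: "e > 0" "\<And>v. \<bar>v - L x\<bar> < e \<Longrightarrow> v \<in> S"
      using S by (auto simp: open_dist dist_real_def)
    define r where "r = e / (2 * (\<bar>c\<bar> + 1))"
    have r: "r > 0" using e by (simp add: r_def)
    have "c * r \<le> (\<bar>c\<bar> + 1) * r" using r by (intro mult_right_mono) auto
    also have "\<dots> = e / 2" by (simp add: r_def field_simps)
    also have "\<dots> < e" using e by simp
    finally have cr: "c * r < e" .
    show "\<exists>r>0. \<forall>y\<in>mspace (C_space T). (\<forall>t\<in>T. \<bar>x t - y t\<bar> \<le> r) \<longrightarrow> y \<in> L -` S \<inter> space (C_borel T)"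
    proof (intro exI[of _ r] conjI r ballI impI)
      fix y assume y: "y \<in> mspace (C_space T)" "\<forall>t\<in>T. \<bar>x t - y t\<bar> \<le> r"
      have "\<bar>L x - L y\<bar> \<le> c * r" using x y r by (intro lip) auto
      with cr have "\<bar>L y - L x\<bar> < e" by linarith
      thus "y \<in> L -` S \<inter> space (C_borel T)" using e y by auto
    qed
  qed auto
  thus "L -` S \<inter> space (C_borel T) \<in> sets (C_borel T)"
    unfolding sets_C_borel by (intro sigma_sets.Basic) simp
qed

lemma affine_in_C_space:
  assumes "compact T" "continuous_on T h" "z \<in> mspace (C_space T)"
  shows "(\<lambda>t\<in>T. h t + c * z t) \<in> mspace (C_space T)"
  using assms by (auto simp: mspace_C_space intro!: continuous_intros cong: continuous_on_cong)

lemma measurable_affine_C_borel: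
  assumes T: "compact T" and h: "continuous_on T h"
  shows "(\<lambda>z. \<lambda>t\<in>T. h t + c * z t) \<in> measurable (C_borel T) (C_borel T)"
proof (rule measurable_sigma_sets[OF sets_C_borel])
  let ?\<Phi> = "\<lambda>z. \<lambda>t\<in>T. h t + c * z t"
  show "{U. openin (mtopology_of (C_space T)) U} \<subseteq> Pow (mspace (C_space T))"
    using openin_subset[of "mtopology_of (C_space T)"] by auto
  show "?\<Phi> \<in> space (C_borel T) \<rightarrow> mspace (C_space T)"
    using affine_in_C_space[OF T h] by auto
  fix U assume "U \<in> {U. openin (mtopology_of (C_space T)) U}"
  hence U: "U \<subseteq> mspace (C_space T)"
    "\<forall>x\<in>U. \<exists>r>0. \<forall>y\<in>mspace (C_space T). (\<forall>t\<in>T. \<bar>x t - y t\<bar> \<le> r) \<longrightarrow> y \<in> U"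
    unfolding mem_Collect_eq openin_C_space[OF T] by auto
  have "openin (mtopology_of (C_space T)) (?\<Phi> -` U \<inter> space (C_borel T))"
    unfolding openin_C_space[OF T]
  proof (intro conjI ballI)
    fix x assume x: "x \<in> ?\<Phi> -` U \<inter> space (C_borel T)"
    then obtain e where e: "e > 0" "\<And>y. y \<in> mspace (C_space T) \<Longrightarrow> (\<forall>t\<in>T. \<bar>?\<Phi> x t - y t\<bar> \<le> e) \<Longrightarrow> y \<in> U"
      using U(2) by blast
    define r where "r = e / (\<bar>c\<bar> + 1)"
    have r: "r > 0" using e by (simp add: r_def)
    have "\<bar>c\<bar> * r \<le> (\<bar>c\<bar> + 1) * r" using r by (intro mult_right_mono) auto
    also have "\<dots> = e" by (simp add: r_def field_simps)
    finally have cr: "\<bar>c\<bar> * r \<le> e" .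
    show "\<exists>r>0. \<forall>y\<in>mspace (C_space T). (\<forall>t\<in>T. \<bar>x t - y t\<bar> \<le> r) \<longrightarrow> y \<in> ?\<Phi> -` U \<inter> space (C_borel T)"
    proof (intro exI[of _ r] conjI r ballI impI)
      fix y assume y: "y \<in> mspace (C_space T)" "\<forall>t\<in>T. \<bar>x t - y t\<bar> \<le> r"
      have "\<bar>?\<Phi> x t - ?\<Phi> y t\<bar> \<le> e" if t: "t \<in> T" for t
      proof -
        have "\<bar>?\<Phi> x t - ?\<Phi> y t\<bar> = \<bar>c\<bar> * \<bar>x t - y t\<bar>"
          using t by (simp add: abs_mult[symmetric] algebra_simps)
        also have "\<dots> \<le> \<bar>c\<bar> * r" using y t by (intro mult_left_mono) auto
        finally show ?thesis using cr by linarith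
      qed
      hence "?\<Phi> y \<in> U" using affine_in_C_space[OF T h y(1)] by (intro e(2)) auto
      thus "y \<in> ?\<Phi> -` U \<inter> space (C_borel T)" using y by auto
    qed
  qed auto
  thus "?\<Phi> -` U \<inter> space (C_borel T) \<in> sets (C_borel T)"
    unfolding sets_C_borel by (intro sigma_sets.Basic) simp
qed

text \<open>The approximants are step functions with rational values. They need not lie in \<open>C(T)\<close>: a
  countable family of uniform approximants serves as well as a countable dense set.\<close>

lemma countable_uniform_approximants:
  fixes T :: "real set"
  assumes T: "T = {a..b}"
  obtains Q :: "(real \<Rightarrow> real) set" where "countable Q"
    "\<And>f e. continuous_on T f \<Longrightarrow> e > 0 \<Longrightarrow> \<exists>q\<in>Q. \<forall>t\<in>T. \<bar>f t - q t\<bar> \<le> e"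
proof -
  \<comment> \<open>\<open>step (n, l)\<close> takes the value \<open>l ! k\<close> on the \<open>k\<close>-th interval of length \<open>1 / n\<close>.\<close>
  define step :: "nat \<times> rat list \<Rightarrow> real \<Rightarrow> real" where
    "step = (\<lambda>(n, l) t. of_rat (l ! nat \<lfloor>real n * (t - a)\<rfloor>))"
  show ?thesis
  proof (rule that[of "range step"])
    fix f :: "real \<Rightarrow> real" and e :: real
    assume f: "continuous_on T f" and e: "e > 0"
    have "uniformly_continuous_on T f" using f T by (intro compact_uniformly_continuous) auto
    then obtain d where d: "d > 0" "\<And>s t. s \<in> T \<Longrightarrow> t \<in> T \<Longrightarrow> \<bar>s - t\<bar> < d \<Longrightarrow> \<bar>f s - f t\<bar> < e / 2"
      using e unfolding uniformly_continuous_on_def dist_real_def by (metis half_gt_zero)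
    obtain n :: nat where n: "n > 0" "1 / real n < d"
      using reals_Archimedean[OF d(1)] by (metis inverse_eq_divide zero_less_Suc)
    define K where "K = Suc (nat \<lfloor>real n * (b - a)\<rfloor>)"
    have "\<exists>q::rat. \<bar>f (a + real k / real n) - of_rat q\<bar> < e / 2" for k
    proof -
      obtain q :: rat where "f (a + real k / real n) - e/2 < of_rat q" "of_rat q < f (a + real k / real n) + e/2"
        using of_rat_dense[of "f (a + real k / real n) - e/2" "f (a + real k / real n) + e/2"] e by auto
      hence "\<bar>f (a + real k / real n) - of_rat q\<bar> < e / 2" by linarith
      thus ?thesis by blast
    qed
    then obtain q :: "nat \<Rightarrow> rat" where q: "\<And>k. \<bar>f (a + real k / real n) - of_rat (q k)\<bar> < e / 2"
      by metis
    have "\<bar>f t - step (n, map q [0..<K]) t\<bar> \<le> e" if t: "t \<in> T" for t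
    proof -
      define k where "k = nat \<lfloor>real n * (t - a)\<rfloor>"
      have t0: "0 \<le> real n * (t - a)" using t T by simp
      have k: "real k \<le> real n * (t - a)" "real n * (t - a) < real k + 1"
        using t0 by (auto simp: k_def) 
      have "k < K" unfolding k_def K_def less_Suc_eq_le
        using t T n by (intro nat_mono floor_mono mult_left_mono) auto
      hence st: "step (n, map q [0..<K]) t = of_rat (q k)" by (simp add: step_def k_def)
      have 1: "real k / real n \<le> t - a" "t - a < real k / real n + 1 / real n"
        using k n by (auto simp: field_simps)
      have "a + real k / real n \<in> T" using t T 1 by auto
      moreover have "\<bar>t - (a + real k / real n)\<bar> < d" using 1 n by (auto simp: abs_if)
      ultimately have "\<bar>f t - f (a + real k / real n)\<bar> < e / 2" using t by (intro d(2)) auto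
      with q[of k] show ?thesis unfolding st by linarith
    qed
    thus "\<exists>q\<in>range step. \<forall>t\<in>T. \<bar>f t - q t\<bar> \<le> e" by blast
  qed simp
qed

text \<open>The Borel \<open>\<sigma>\<close>-algebra of \<open>C(T)\<close> is generated by the evaluations. An open set is a countable
  union of sets \<open>B q n\<close> of functions that are \<open>1 / (n + 1)\<close>-close to a step function \<open>q\<close>; closeness
  is only required on a countable dense set \<open>D\<close>, so that \<open>B q n\<close> is a countable intersection of
  cylinders, although \<open>q\<close> is discontinuous.\<close>

lemma sets_C_borel_subset_evaluations:
  assumes T: "T = {a..b}"
  shows "sets (C_borel T) \<subseteq>
    sigma_sets (mspace (C_space T)) {(\<lambda>z. z t) -` A \<inter> mspace (C_space T) | t A. t \<in> T \<and> A \<in> sets borel}"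
    (is "_ \<subseteq> sigma_sets ?C ?G")
proof -
  have cT: "compact T" using T by simp
  obtain D where D: "countable D" "D \<subseteq> T" "T \<subseteq> closure D" using separable by metis
  obtain Q :: "(real \<Rightarrow> real) set" where Q: "countable Q" "\<And>f e. continuous_on T f \<Longrightarrow> e > 0 \<Longrightarrow> \<exists>q\<in>Q. \<forall>t\<in>T. \<bar>f t - q t\<bar> \<le> e"
    by (rule countable_uniform_approximants[OF T]) blast
  interpret G: sigma_algebra ?C "sigma_sets ?C ?G"
    by (rule sigma_algebra_sigma_sets) blast
  define B where "B q n = {z\<in>?C. \<forall>t\<in>D. \<bar>z t - q t\<bar> \<le> 1 / real (Suc n)}" for q n
  have abs_le: "\<bar>x - y\<bar> \<le> e \<longleftrightarrow> x \<in> {y - e..y + e}" for x y e :: real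
    by auto
  have Bsets: "B q n \<in> sigma_sets ?C ?G" for q n
  proof -
    let ?I = "\<lambda>t. (\<lambda>z. z t) -` {q t - 1 / real (Suc n)..q t + 1 / real (Suc n)} \<inter> ?C"
    have I: "?I t \<in> sigma_sets ?C ?G" if "t \<in> D" for t
    proof (intro sigma_sets.Basic CollectI exI conjI)
      show "t \<in> T" using that D by blast
      show "{q t - 1 / real (Suc n)..q t + 1 / real (Suc n)} \<in> sets borel" by simp
    qed (rule refl)
    have eq: "B q n = (\<Inter>t\<in>D. ?I t) \<inter> ?C"
      unfolding B_def abs_le by blast
    show ?thesis
    proof (cases "D = {}")
      case True
      have "B q n = ?C" unfolding eq True by blast
      thus ?thesis using G.top by metis
    next
      case False
      show ?thesis unfolding eq
      proof (intro G.Int G.countable_INT' G.top D(1) False)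
        show "?I ` D \<subseteq> sigma_sets ?C ?G" using I by blast
      qed
    qed
  qed
  have open_sets: "U \<in> sigma_sets ?C ?G" if U: "openin (mtopology_of (C_space T)) U" for U
  proof -
    have U': "U \<subseteq> ?C" "\<forall>x\<in>U. \<exists>r>0. \<forall>y\<in>?C. (\<forall>t\<in>T. \<bar>x t - y t\<bar> \<le> r) \<longrightarrow> y \<in> U"
      using U unfolding openin_C_space[OF cT] by simp_all
    define J where "J = {(q, n). q \<in> Q \<and> B q n \<subseteq> U}"
    have U_eq: "U = (\<Union>(q, n)\<in>J. B q n)"
    proof
      show "U \<subseteq> (\<Union>(q, n)\<in>J. B q n)"
      proof
        fix z assume z: "z \<in> U"
        have zC: "z \<in> ?C" using U'(1) z by blast
        from U'(2)[rule_format, OF z] obtain r where r: "r > 0"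
          "\<And>y. y \<in> ?C \<Longrightarrow> (\<forall>t\<in>T. \<bar>z t - y t\<bar> \<le> r) \<Longrightarrow> y \<in> U" by metis
        have zc: "continuous_on T z" using zC by (simp add: mspace_C_space cT)
        obtain n where n: "1 / real (Suc n) < r / 2"
          using reals_Archimedean[of "r/2"] r(1) by (metis half_gt_zero inverse_eq_divide)
        have "1 / real (Suc n) > 0" by simp
        from Q(2)[OF zc this] obtain q where q: "q \<in> Q" "\<forall>t\<in>T. \<bar>z t - q t\<bar> \<le> 1 / real (Suc n)"
          by blast
        have "y \<in> U" if y: "y \<in> B q n" for y
        proof (rule r(2))
          show yC: "y \<in> ?C" using y by (simp add: B_def)
          have le: "\<bar>z t - y t\<bar> \<le> r" if "t \<in> D" for t
          proof -
            have "\<bar>z t - q t\<bar> \<le> 1 / real (Suc n)" using q(2) that D by auto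
            moreover have "\<bar>y t - q t\<bar> \<le> 1 / real (Suc n)" using y that by (auto simp: B_def)
            ultimately show ?thesis using n by linarith
          qed
          have "continuous_on T y" using yC by (simp add: mspace_C_space cT)
          with zc have "continuous_on T (\<lambda>t. \<bar>z t - y t\<bar>)"
            by (intro continuous_intros)
          moreover have "closure D \<subseteq> T"
            by (rule closure_minimal[OF D(2)]) (rule compact_imp_closed[OF cT])
          ultimately have "continuous_on (closure D) (\<lambda>t. \<bar>z t - y t\<bar>)"
            by (rule continuous_on_subset)
          hence "\<bar>z t - y t\<bar> \<le> r" if "t \<in> closure D" for t
            using that le by (rule continuous_le_on_closure)
          thus "\<forall>t\<in>T. \<bar>z t - y t\<bar> \<le> r" using D by auto
        qed
        hence "(q, n) \<in> J" using q by (auto simp: J_def)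
        moreover have "z \<in> B q n" using q zC D by (auto simp: B_def)
        ultimately show "z \<in> (\<Union>(q, n)\<in>J. B q n)" by blast
      qed
    qed (auto simp: J_def)
    have "countable J"
      by (rule countable_subset[of _ "Q \<times> UNIV"]) (auto simp: J_def Q)
    hence "(\<Union>(q, n)\<in>J. B q n) \<in> sigma_sets ?C ?G"
      by (rule G.countable_UN'') (simp only: case_prod_beta Bsets)
    thus ?thesis unfolding U_eq[symmetric] .
  qed
  show ?thesis unfolding sets_C_borel
    by (rule G.sigma_sets_subset) (use open_sets in blast)
qed

section \<open>Gaussian vectors and their covariance\<close>

text \<open>The last property is the one-dimensional Cameron--Martin formula: the density
  \<open>exp (x - v / 2)\<close> shifts the centered normal law of variance \<open>v\<close> by \<open>v\<close>. The variance may be zero.\<close>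

lemma (in prob_space) centered_normal_props:
  assumes X: "centered_normal M X"
  defines "v \<equiv> expectation (\<lambda>w. (X w)\<^sup>2)"
  shows "X \<in> borel_measurable M" "integrable M (\<lambda>w. (X w)\<^sup>2)" "expectation X = 0"
    "integrable M (\<lambda>w. exp (X w))"
    "expectation (\<lambda>w. cos (t * X w)) = exp (- (t\<^sup>2 * v / 2))" "expectation (\<lambda>w. sin (t * X w)) = 0"
    "\<And>g :: real \<Rightarrow> real. g \<in> borel_measurable borel \<Longrightarrow>
       expectation (\<lambda>w. exp (X w - v / 2) * g (X w)) = expectation (\<lambda>w. g (X w + v))"
proof -
  show [measurable]: "X \<in> borel_measurable M" using X by (simp add: centered_normal_def)
  consider (normal) \<sigma> where "\<sigma> > 0" "distributed M lborel X (normal_density 0 \<sigma>)" | (zero) "AE w in M. X w = 0"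
    using X by (auto simp: centered_normal_def)
  hence "integrable M (\<lambda>w. (X w)\<^sup>2) \<and> expectation X = 0 \<and> integrable M (\<lambda>w. exp (X w)) \<and>
    expectation (\<lambda>w. cos (t * X w)) = exp (- (t\<^sup>2 * v / 2)) \<and> expectation (\<lambda>w. sin (t * X w)) = 0 \<and>
    (\<forall>g :: real \<Rightarrow> real. g \<in> borel_measurable borel \<longrightarrow>
       expectation (\<lambda>w. exp (X w - v / 2) * g (X w)) = expectation (\<lambda>w. g (X w + v)))"
  proof cases
    case zero
    have v: "v = 0"
      unfolding v_def using zero by (intro integral_eq_zero_AE) auto
    have 1: "integrable M (\<lambda>w. f (X w)) \<and> expectation (\<lambda>w. f (X w)) = f 0"
      if [measurable]: "f \<in> borel_measurable borel" for f :: "real \<Rightarrow> real"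
    proof
      have "AE w in M. f (X w) = f 0" using zero by eventually_elim simp
      thus "integrable M (\<lambda>w. f (X w))"
        by (subst integrable_cong_AE[where g="\<lambda>_. f 0"]) auto
      have "expectation (\<lambda>w. f (X w)) = expectation (\<lambda>w. f 0)"
        using \<open>AE w in M. f (X w) = f 0\<close> by (intro integral_cong_AE) auto
      thus "expectation (\<lambda>w. f (X w)) = f 0" by (simp add: prob_space)
    qed
    show ?thesis
      using 1[of "\<lambda>x. x\<^sup>2"] 1[of "\<lambda>x. x"] 1[of exp] 1[of "\<lambda>x. cos (t * x)"] 1[of "\<lambda>x. sin (t * x)"]
        1[of "\<lambda>x. exp x * g x" for g :: "real \<Rightarrow> real"]
      by (simp add: v 1)
  next
    case normal
    note dist = normal(2) and s = normal(1)
    have E: "expectation (\<lambda>w. f (X w)) = (LBINT x. normal_density 0 \<sigma> x * f x)"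
      "integrable M (\<lambda>w. f (X w)) \<longleftrightarrow> integrable lborel (\<lambda>x. normal_density 0 \<sigma> x * f x)"
      if [measurable]: "f \<in> borel_measurable borel" for f :: "real \<Rightarrow> real"
      using distributed_integral[OF dist, of f] distributed_integrable[OF dist, of f] by auto
    have ex: "expectation X = 0" using normal_distributed_expectation[OF s dist] .
    have v: "v = \<sigma>\<^sup>2"
      using normal_distributed_variance[OF s dist] by (simp add: ex v_def)
    have i2: "integrable M (\<lambda>w. (X w)\<^sup>2)"
      using integrable_normal_moment[OF s, of 0 2] by (subst E) auto
    have shift: "normal_density 0 \<sigma> x * exp (x - v / 2) = normal_density 0 \<sigma> (x - v)" for x
      using s unfolding normal_density_def v
      by (simp add: exp_add[symmetric] power2_eq_square field_simps)
    have g: "expectation (\<lambda>w. exp (X w - v / 2) * g (X w)) = expectation (\<lambda>w. g (X w + v))"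
      if [measurable]: "g \<in> borel_measurable borel" for g :: "real \<Rightarrow> real"
    proof -
      have "expectation (\<lambda>w. exp (X w - v / 2) * g (X w)) = (LBINT x. normal_density 0 \<sigma> x * exp (x - v / 2) * g x)"
        by (subst E) (auto simp: mult.assoc)
      also have "\<dots> = (LBINT x. normal_density 0 \<sigma> (x - v) * g x)"
        by (simp add: shift)
      also have "\<dots> = (LBINT x. normal_density 0 \<sigma> x * g (x + v))"
        by (subst lborel_integral_real_affine[where c=1 and t=v]) (auto simp: add.commute)
      also have "\<dots> = expectation (\<lambda>w. g (X w + v))"
        by (subst E) auto
      finally show ?thesis .
    qed
    have "integrable lborel (\<lambda>x. normal_density 0 \<sigma> (- v + 1 * x))"
      by (rule lborel_integrable_real_affine[OF integrable_normal_density[OF s] one_neq_zero])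
    hence "integrable lborel (\<lambda>x. normal_density 0 \<sigma> (x - v))"
      by (simp only: mult_1 uminus_add_conv_diff)
    hence "integrable lborel (\<lambda>x. normal_density 0 \<sigma> x * exp (x - v / 2))" by (simp only: shift)
    hence "integrable M (\<lambda>w. exp (X w - v / 2))" by (subst E) auto
    hence "integrable M (\<lambda>w. exp (v / 2) * exp (X w - v / 2))" by (rule integrable_mult_right)
    hence ie: "integrable M (\<lambda>w. exp (X w))" by (simp add: exp_add[symmetric])
    have "distributed M lborel (\<lambda>x. (X x - 0) / \<sigma>) std_normal_density"
      using normal_standard_normal_convert[OF s, of X 0] dist by simp
    hence ds: "distr M lborel (\<lambda>x. X x / \<sigma>) = density lborel std_normal_density"
      by (simp add: distributed_def)
    have "char (distr M lborel (\<lambda>x. X x / \<sigma>)) (t * \<sigma>) = complex_of_real (exp (- (t * \<sigma>)\<^sup>2 / 2))"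
      unfolding ds char_std_normal_distribution by simp
    moreover have "char (distr M lborel (\<lambda>x. X x / \<sigma>)) (t * \<sigma>) = (CLINT w|M. iexp (t * X w))"
      unfolding char_def using s by (subst integral_distr) auto
    ultimately have c: "(CLINT w|M. iexp (t * X w)) = complex_of_real (exp (- (t * \<sigma>)\<^sup>2 / 2))" by simp
    have i: "integrable M (\<lambda>w. iexp (t * X w))"
      by (rule integrable_const_bound[where B=1]) (auto intro!: AE_I2)
    have "expectation (\<lambda>w. cos (t * X w)) = exp (- (t\<^sup>2 * v / 2))" "expectation (\<lambda>w. sin (t * X w)) = 0"
      using integral_bounded_linear[OF bounded_linear_Re i] integral_bounded_linear[OF bounded_linear_Im i]
      unfolding c v by (simp_all add: Re_exp Im_exp power_mult_distrib)
    with i2 ex ie g show ?thesis by blast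
  qed
  thus "integrable M (\<lambda>w. (X w)\<^sup>2)" "expectation X = 0"
    "integrable M (\<lambda>w. exp (X w))"
    "expectation (\<lambda>w. cos (t * X w)) = exp (- (t\<^sup>2 * v / 2))" "expectation (\<lambda>w. sin (t * X w)) = 0"
    "\<And>g :: real \<Rightarrow> real. g \<in> borel_measurable borel \<Longrightarrow>
       expectation (\<lambda>w. exp (X w - v / 2) * g (X w)) = expectation (\<lambda>w. g (X w + v))"
    by blast+
qed

text \<open>A centered Gaussian vector \<open>Z\<close> in \<open>C(T)\<close> with \<open>T = [a, b]\<close>, defined on the probability space \<open>W\<close>.\<close>

locale gaussian_vector = prob_space W for W :: "'w measure" +
  fixes a b :: real and T :: "real set" and Z :: "'w \<Rightarrow> real \<Rightarrow> real"
  assumes ab: "a \<le> b" and T_eq: "T = {a..b}" and gaussian: "centered_gaussian_vector W T Z"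
begin

lemma compact_T: "compact T" by (simp add: T_eq)

lemma Z_measurable [measurable]: "Z \<in> measurable W (C_borel T)"
  using gaussian by (simp add: centered_gaussian_vector_def)

lemma Z_in_C: "w \<in> space W \<Longrightarrow> Z w \<in> mspace (C_space T)"
  using measurable_space[OF Z_measurable] by simp

lemma Z_continuous: "w \<in> space W \<Longrightarrow> continuous_on T (Z w)"
  using Z_in_C[of w] by (simp add: mspace_C_space compact_T)

text \<open>The Gaussian variable \<open>\<langle>m, Z\<rangle>\<close>.\<close>

definition \<xi> :: "signed_measure \<Rightarrow> 'w \<Rightarrow> real" where
  "\<xi> m w = signed_integral T m (Z w)"

text \<open>The covariance of \<open>\<langle>m, Z\<rangle>\<close> and \<open>\<langle>n, Z\<rangle>\<close>, as a second moment because both variables are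
  centered. It equals \<open>\<langle>m, K n\<rangle>\<close>, where \<open>K\<close> is the covariance operator.\<close>

definition cov :: "signed_measure \<Rightarrow> signed_measure \<Rightarrow> real" where
  "cov m n = expectation (\<lambda>w. \<xi> m w * \<xi> n w)"

abbreviation MT :: "signed_measure set" where "MT \<equiv> signed_measures_on T"

lemma normal_\<xi>: "m \<in> MT \<Longrightarrow> centered_normal W (\<xi> m)"
  using gaussian unfolding centered_gaussian_vector_def \<xi>_def by blast

lemma measurable_\<xi> [measurable]: "m \<in> MT \<Longrightarrow> \<xi> m \<in> borel_measurable W"
  using centered_normal_props(1)[OF normal_\<xi>] .

lemma expectation_\<xi>: "m \<in> MT \<Longrightarrow> expectation (\<xi> m) = 0"
  using centered_normal_props(3)[OF normal_\<xi>] .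

lemma square_integrable_\<xi>: "m \<in> MT \<Longrightarrow> integrable W (\<lambda>w. (\<xi> m w)\<^sup>2)"
  using centered_normal_props(2)[OF normal_\<xi>] .

lemma \<xi>_linear:
  "w \<in> space W \<Longrightarrow> \<xi> (c *\<^sub>R m + d *\<^sub>R n) w = c * \<xi> m w + d * \<xi> n w"
  unfolding \<xi>_def by (rule signed_integral_linear_measure[OF compact_T Z_continuous])

lemma integrable_mult_\<xi>:
  assumes m: "m \<in> MT" and n: "n \<in> MT"
  shows "integrable W (\<lambda>w. \<xi> m w * \<xi> n w)"
proof (rule Bochner_Integration.integrable_bound)
  show "integrable W (\<lambda>w. (\<xi> m w)\<^sup>2 + (\<xi> n w)\<^sup>2)"
    using assms by (intro Bochner_Integration.integrable_add square_integrable_\<xi>)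
  have "\<bar>x * y\<bar> \<le> x\<^sup>2 + y\<^sup>2" for x y :: real
    using sum_squares_bound[of "\<bar>x\<bar>" "\<bar>y\<bar>"] mult_nonneg_nonneg[of "\<bar>x\<bar>" "\<bar>y\<bar>"]
    unfolding abs_mult power2_abs by linarith
  thus "AE w in W. norm (\<xi> m w * \<xi> n w) \<le> norm ((\<xi> m w)\<^sup>2 + (\<xi> n w)\<^sup>2)"
    by (intro AE_I2) simp
  show "(\<lambda>w. \<xi> m w * \<xi> n w) \<in> borel_measurable W"
    using measurable_\<xi>[OF m] measurable_\<xi>[OF n] by simp
qed

lemma cov_commute: "cov m n = cov n m"
  by (simp add: cov_def mult.commute)

lemma cov_nonneg: "0 \<le> cov m m"
  unfolding cov_def by (rule Bochner_Integration.integral_nonneg) simp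

lemma cov_square: "cov m m = expectation (\<lambda>w. (\<xi> m w)\<^sup>2)"
  by (simp add: cov_def power2_eq_square)

lemma cov_linear_left:
  assumes "m \<in> MT" "n \<in> MT" "k \<in> MT"
  shows "cov (c *\<^sub>R m + d *\<^sub>R n) k = c * cov m k + d * cov n k"
proof -
  have "cov (c *\<^sub>R m + d *\<^sub>R n) k = expectation (\<lambda>w. c * (\<xi> m w * \<xi> k w) + d * (\<xi> n w * \<xi> k w))"
    unfolding cov_def by (intro Bochner_Integration.integral_cong) (simp_all add: \<xi>_linear algebra_simps)
  also have "\<dots> = c * cov m k + d * cov n k"
    using integrable_mult_\<xi> assms by (simp add: cov_def)
  finally show ?thesis .
qed

lemma cov_linear_right:
  assumes "m \<in> MT" "n \<in> MT" "k \<in> MT"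
  shows "cov k (c *\<^sub>R m + d *\<^sub>R n) = c * cov k m + d * cov k n"
  using cov_linear_left[OF assms] by (simp add: cov_commute)

lemma MT_linear: "m \<in> MT \<Longrightarrow> n \<in> MT \<Longrightarrow> c *\<^sub>R m + d *\<^sub>R n \<in> MT"
  by (rule signed_measures_on_linear)

lemma expectation_cos_\<xi>: "m \<in> MT \<Longrightarrow> expectation (\<lambda>w. cos (\<xi> m w)) = exp (- (cov m m / 2))"
  and expectation_sin_\<xi>: "m \<in> MT \<Longrightarrow> expectation (\<lambda>w. sin (\<xi> m w)) = 0"
  using centered_normal_props(5,6)[OF normal_\<xi>, of m 1] by (simp_all add: cov_square)

lemma \<xi>_point_mass: "w \<in> space W \<Longrightarrow> s \<in> T \<Longrightarrow> \<xi> (point_mass s) w = Z w s"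
  unfolding \<xi>_def by (rule signed_integral_point_mass[OF compact_T Z_continuous])

lemma cov_fun_eq:
  assumes s: "s \<in> T" and t: "t \<in> T"
  shows "cov_fun W Z s t = cov (point_mass s) (point_mass t)"
proof -
  have 0: "expectation (\<lambda>w. Z w r) = 0" if "r \<in> T" for r
  proof -
    have "expectation (\<lambda>w. Z w r) = expectation (\<xi> (point_mass r))"
      by (intro Bochner_Integration.integral_cong) (simp_all add: \<xi>_point_mass that)
    thus ?thesis by (simp add: expectation_\<xi> point_mass_on that)
  qed
  show ?thesis unfolding cov_fun_def covariance_def cov_def 0[OF s] 0[OF t]
    by (intro Bochner_Integration.integral_cong) (simp_all add: \<xi>_point_mass s t)
qed

text \<open>Continuity of the covariance function is a consequence of the continuity of the paths:
  \<open>E cos (Z\<^sub>s + \<langle>n, Z\<rangle>) = exp (- v(s) / 2)\<close>, with \<open>v(s)\<close> the variance in question, is continuous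
  in \<open>s\<close> by dominated convergence.\<close>

lemma continuous_cov_point_mass_sum:
  assumes n: "n \<in> MT"
  shows "continuous_on T (\<lambda>s. cov (point_mass s + n) (point_mass s + n))"
proof -
  have M: "point_mass s + n \<in> MT" if "s \<in> T" for s
    using MT_linear[of "point_mass s" n 1 1] n point_mass_on[OF that] by simp
  have e: "\<xi> (point_mass s + n) w = Z w s + \<xi> n w" if "w \<in> space W" "s \<in> T" for w s
    using \<xi>_linear[OF that(1), of 1 "point_mass s" 1 n] \<xi>_point_mass[OF that] by simp
  have c: "expectation (\<lambda>w. cos (Z w s + \<xi> n w)) = exp (- (cov (point_mass s + n) (point_mass s + n) / 2))"
    if "s \<in> T" for s
    unfolding expectation_cos_\<xi>[OF M[OF that], symmetric]
    by (intro Bochner_Integration.integral_cong) (simp_all add: e that)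
  have "continuous_on T (\<lambda>s. expectation (\<lambda>w. cos (Z w s + \<xi> n w)))"
    unfolding continuous_on_sequentially
  proof (intro allI ballI impI, elim conjE)
    fix x :: "nat \<Rightarrow> real" and s assume s: "s \<in> T" and x: "\<forall>n. x n \<in> T" "x \<longlonglongrightarrow> s"
    have meas: "(\<lambda>w. cos (Z w r + \<xi> n w)) \<in> borel_measurable W" if "r \<in> T" for r
    proof -
      have "(\<lambda>w. cos (\<xi> (point_mass r + n) w)) \<in> borel_measurable W"
        using measurable_\<xi>[OF M[OF that]] by simp
      thus ?thesis by (subst measurable_cong[of _ _ "\<lambda>w. cos (\<xi> (point_mass r + n) w)"]) (simp_all add: e that)
    qed
    show "((\<lambda>s. expectation (\<lambda>w. cos (Z w s + \<xi> n w))) \<circ> x) \<longlonglongrightarrow> expectation (\<lambda>w. cos (Z w s + \<xi> n w))"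
      unfolding comp_def
    proof (rule integral_dominated_convergence[where w="\<lambda>_. 1"])
      show "AE w in W. (\<lambda>i. cos (Z w (x i) + \<xi> n w)) \<longlonglongrightarrow> cos (Z w s + \<xi> n w)"
      proof (rule AE_I2)
        fix w assume "w \<in> space W"
        hence "(\<lambda>i. Z w (x i)) \<longlonglongrightarrow> Z w s"
          using Z_continuous x s unfolding continuous_on_sequentially comp_def by blast
        thus "(\<lambda>i. cos (Z w (x i) + \<xi> n w)) \<longlonglongrightarrow> cos (Z w s + \<xi> n w)"
          by (intro tendsto_intros)
      qed
    qed (use meas s x in auto)
  qed
  moreover have "expectation (\<lambda>w. cos (Z w s + \<xi> n w)) \<noteq> 0" if "s \<in> T" for s
    by (simp add: c that)
  ultimately have "continuous_on T (\<lambda>s. - 2 * ln (expectation (\<lambda>w. cos (Z w s + \<xi> n w))))"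
    by (intro continuous_intros) auto
  thus ?thesis by (rule continuous_on_eq) (simp add: c)
qed

lemma continuous_cov_point_mass:
  assumes n: "n \<in> MT"
  shows "continuous_on T (\<lambda>s. cov (point_mass s) n)"
proof -
  have 0: "(0::signed_measure) \<in> MT" by (simp add: signed_measures_on_def zero_signed_measure.rep_eq)
  \<comment> \<open>Polarisation; the summand \<open>0\<close> puts the variance of \<open>Z\<^sub>s\<close> into the form of the previous lemma.\<close>
  have eq: "cov (point_mass s) n = (cov (point_mass s + n) (point_mass s + n)
      - cov (point_mass s + 0) (point_mass s + 0) - cov n n) / 2" if "s \<in> T" for s
  proof -
    have P: "point_mass s \<in> MT" using point_mass_on[OF that] .
    have S: "point_mass s + n \<in> MT" using MT_linear[OF P n, of 1 1] by simp
    show ?thesis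
      using cov_linear_left[OF P n S, of 1 1] cov_linear_right[OF P n P, of 1 1] cov_linear_right[OF P n n, of 1 1]
      by (simp add: cov_commute)
  qed
  have "continuous_on T (\<lambda>s. (cov (point_mass s + n) (point_mass s + n)
      - cov (point_mass s + 0) (point_mass s + 0) - cov n n) / 2)"
    by (intro continuous_on_divide continuous_on_diff continuous_on_const
        continuous_cov_point_mass_sum[OF n] continuous_cov_point_mass_sum[OF 0]) simp
  thus ?thesis by (rule continuous_on_eq) (simp only: eq)
qed

lemma variance_bounded: obtains C where "C \<ge> 0" "\<And>s. s \<in> T \<Longrightarrow> cov (point_mass s) (point_mass s) \<le> C"
proof -
  have 0: "(0::signed_measure) \<in> MT" by (simp add: signed_measures_on_def zero_signed_measure.rep_eq)
  have "bounded ((\<lambda>s. cov (point_mass s + 0) (point_mass s + 0)) ` T)"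
    by (intro compact_imp_bounded compact_continuous_image continuous_cov_point_mass_sum 0 compact_T)
  then obtain C where "C > 0" "\<And>s. s \<in> T \<Longrightarrow> \<bar>cov (point_mass s) (point_mass s)\<bar> \<le> C"
    by (auto simp: bounded_pos)
  thus ?thesis by (intro that[of C]) (auto dest: abs_le_D1)
qed

lemma expectation_abs_mult_le:
  assumes m: "m \<in> MT" and n: "n \<in> MT"
  shows "expectation (\<lambda>w. \<bar>\<xi> m w * \<xi> n w\<bar>) \<le> (cov m m + cov n n) / 2"
proof -
  have le: "\<bar>x * y\<bar> \<le> (x * x + y * y) / 2" for x y :: real
    using sum_squares_bound[of "\<bar>x\<bar>" "\<bar>y\<bar>"] by (simp add: abs_mult power2_eq_square)
  have "expectation (\<lambda>w. \<bar>\<xi> m w * \<xi> n w\<bar>) \<le> expectation (\<lambda>w. (\<xi> m w * \<xi> m w + \<xi> n w * \<xi> n w) / 2)"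
    using integrable_mult_\<xi> m n le by (intro integral_mono) auto
  also have "\<dots> = (cov m m + cov n n) / 2"
    using integrable_mult_\<xi> m n by (simp add: cov_def)
  finally show ?thesis .
qed

lemma abs_cov_le:
  assumes m: "m \<in> MT" and n: "n \<in> MT"
  shows "\<bar>cov m n\<bar> \<le> (cov m m + cov n n) / 2"
proof -
  have "\<bar>cov m n\<bar> \<le> expectation (\<lambda>w. \<bar>\<xi> m w * \<xi> n w\<bar>)"
    unfolding cov_def by (rule integral_abs_bound)
  thus ?thesis using expectation_abs_mult_le[OF m n] by linarith
qed

text \<open>Joint measurability: \<open>Z w s\<close> is the limit of \<open>Z w (g n s)\<close>, where \<open>g n s\<close> takes countably
  many values.\<close>

lemma measurable_paths:
  "(\<lambda>(s, w). indicator T s * Z w s) \<in> borel_measurable (borel \<Otimes>\<^sub>M W)"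
proof -
  \<comment> \<open>The nearest point of the interval: paths are continuous only on \<open>T\<close>.\<close>
  define clip where "clip s = max a (min b s)" for s
  have clip: "clip s \<in> T" "s \<in> T \<Longrightarrow> clip s = s" for s
    using ab by (auto simp: clip_def T_eq)
  define g where "g n s = clip (real_of_int \<lfloor>real (Suc n) * s\<rfloor> / real (Suc n))" for n s
  have Zm: "(\<lambda>w. Z w r) \<in> borel_measurable W" if "r \<in> T" for r
    using measurable_\<xi>[OF point_mass_on[OF that]]
    by (subst measurable_cong[of _ _ "\<xi> (point_mass r)"]) (simp_all add: \<xi>_point_mass that)
  have gm: "(\<lambda>(s, w). Z w (g n s)) \<in> borel_measurable (borel \<Otimes>\<^sub>M W)" for n
  proof -
    have 1: "(\<lambda>p. Z (snd p) (clip (real_of_int k / real (Suc n)))) \<in> borel_measurable (borel \<Otimes>\<^sub>M W)" for k :: int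
      using measurable_compose[OF measurable_snd Zm[OF clip(1)]] by simp
    have 2: "(\<lambda>p. \<lfloor>real (Suc n) * fst p\<rfloor>) \<in> measurable (borel \<Otimes>\<^sub>M W) (count_space UNIV)"
      by measurable
    have "(\<lambda>p. Z (snd p) (clip (real_of_int \<lfloor>real (Suc n) * fst p\<rfloor> / real (Suc n)))) \<in> borel_measurable (borel \<Otimes>\<^sub>M W)"
      by (rule measurable_compose_countable[OF 1 2])
    thus ?thesis by (simp add: g_def case_prod_beta)
  qed
  have conv: "(\<lambda>n. Z w (g n s)) \<longlonglongrightarrow> Z w (clip s)" if "w \<in> space W" for w s
  proof -
    have le: "\<bar>real_of_int \<lfloor>real (Suc n) * s\<rfloor> / real (Suc n) - s\<bar> \<le> 1 / real (Suc n)" for n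
    proof -
      have "\<bar>real_of_int \<lfloor>real (Suc n) * s\<rfloor> - real (Suc n) * s\<bar> \<le> 1" by linarith
      hence "\<bar>real_of_int \<lfloor>real (Suc n) * s\<rfloor> - real (Suc n) * s\<bar> / real (Suc n) \<le> 1 / real (Suc n)"
        by (intro divide_right_mono) auto
      also have "\<bar>real_of_int \<lfloor>real (Suc n) * s\<rfloor> - real (Suc n) * s\<bar> / real (Suc n)
          = \<bar>(real_of_int \<lfloor>real (Suc n) * s\<rfloor> - real (Suc n) * s) / real (Suc n)\<bar>" by simp
      also have "(real_of_int \<lfloor>real (Suc n) * s\<rfloor> - real (Suc n) * s) / real (Suc n) =
          real_of_int \<lfloor>real (Suc n) * s\<rfloor> / real (Suc n) - s"
        by (simp add: diff_divide_distrib del: of_nat_Suc)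
      finally show ?thesis .
    qed
    have "(\<lambda>n. real_of_int \<lfloor>real (Suc n) * s\<rfloor> / real (Suc n) - s) \<longlonglongrightarrow> 0"
      by (rule Lim_null_comparison[OF _ LIMSEQ_inverse_real_of_nat])
         (use le in \<open>auto simp: inverse_eq_divide simp del: of_nat_Suc\<close>)
    hence "(\<lambda>n. real_of_int \<lfloor>real (Suc n) * s\<rfloor> / real (Suc n)) \<longlonglongrightarrow> s"
      by (simp add: LIM_zero_iff)
    hence "(\<lambda>n. g n s) \<longlonglongrightarrow> clip s"
      unfolding g_def clip_def by (intro tendsto_intros)
    moreover have "\<forall>\<^sub>F n in sequentially. g n s \<in> T" by (simp add: g_def clip)
    ultimately show ?thesis
      using continuous_on_tendsto_compose[OF Z_continuous[OF that] _ clip(1)[of s]] by blast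
  qed
  have Tm: "T \<in> sets borel" by (simp add: T_eq)
  have "(\<lambda>(s, w). Z w (clip s)) \<in> borel_measurable (borel \<Otimes>\<^sub>M W)"
    by (rule borel_measurable_LIMSEQ_real[OF _ gm], clarsimp simp: space_pair_measure, rule conv)
  hence "(\<lambda>p. indicator T (fst p) * (\<lambda>(s, w). Z w (clip s)) p) \<in> borel_measurable (borel \<Otimes>\<^sub>M W)"
    using Tm by measurable
  moreover have "indicator T (fst p) * (\<lambda>(s, w). Z w (clip s)) p = (\<lambda>(s, w). indicator T s * Z w s) p" for p
    by (auto simp: indicator_def clip split: prod.splits)
  ultimately show ?thesis by simp
qed

text \<open>Fubini's theorem for one of the two positive parts of a signed measure. The integrand is
  dominated because the variances of \<open>Z\<^sub>s\<close> are bounded.\<close>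

lemma expectation_integral_mult_\<xi>:
  assumes n: "n \<in> MT"
  shows "integrable W (\<lambda>w. set_lebesgue_integral (pos_part k) T (Z w) * \<xi> n w)" (is ?I)
    and "expectation (\<lambda>w. set_lebesgue_integral (pos_part k) T (Z w) * \<xi> n w) =
          set_lebesgue_integral (pos_part k) T (\<lambda>s. cov (point_mass s) n)" (is ?E)
proof -
  interpret P: finite_measure "pos_part k" by (rule finite_measure_pos_part)
  interpret PW: pair_sigma_finite "pos_part k" W ..
  let ?f = "\<lambda>s w. indicator T s * Z w s * \<xi> n w"
  obtain C where C: "C \<ge> 0" "\<And>s. s \<in> T \<Longrightarrow> cov (point_mass s) (point_mass s) \<le> C"
    by (rule variance_bounded) blast
  have [measurable]: "\<xi> n \<in> borel_measurable W" by (rule measurable_\<xi>[OF n])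
  have "(\<lambda>p. (\<lambda>(s, w). indicator T s * Z w s) p * \<xi> n (snd p)) \<in> borel_measurable (borel \<Otimes>\<^sub>M W)"
    using measurable_paths by measurable
  hence meas: "case_prod ?f \<in> borel_measurable (pos_part k \<Otimes>\<^sub>M W)"
    by (simp add: case_prod_beta cong: measurable_cong_sets sets_pair_measure_cong)
  have bound: "expectation (\<lambda>w. norm (?f s w)) \<le> (C + cov n n) / 2" for s
  proof (cases "s \<in> T")
    case True
    have "expectation (\<lambda>w. norm (?f s w)) = expectation (\<lambda>w. \<bar>\<xi> (point_mass s) w * \<xi> n w\<bar>)"
      using True by (intro Bochner_Integration.integral_cong) (simp_all add: \<xi>_point_mass)
    also have "\<dots> \<le> (cov (point_mass s) (point_mass s) + cov n n) / 2"
      by (rule expectation_abs_mult_le[OF point_mass_on[OF True] n])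
    also have "\<dots> \<le> (C + cov n n) / 2" using C(2)[OF True] by simp
    finally show ?thesis .
  qed (use C cov_nonneg[of n] in simp)
  have inner: "integrable W (?f s)" for s
  proof (cases "s \<in> T")
    case True
    have "integrable W (\<lambda>w. \<xi> (point_mass s) w * \<xi> n w)"
      by (rule integrable_mult_\<xi>[OF point_mass_on[OF True] n])
    thus ?thesis
      by (subst Bochner_Integration.integrable_cong[OF refl, of _ _ "\<lambda>w. \<xi> (point_mass s) w * \<xi> n w"])
         (simp_all add: \<xi>_point_mass True)
  qed simp
  have int: "integrable (pos_part k \<Otimes>\<^sub>M W) (case_prod ?f)"
  proof (rule PW.Fubini_integrable[OF meas])
    show "integrable (pos_part k) (\<lambda>s. expectation (\<lambda>w. norm (case_prod ?f (s, w))))"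
    proof (rule P.integrable_const_bound)
      show "AE s in pos_part k. norm (expectation (\<lambda>w. norm (case_prod ?f (s, w)))) \<le> (C + cov n n) / 2"
        using bound by (simp add: Bochner_Integration.integral_nonneg)
      show "(\<lambda>s. expectation (\<lambda>w. norm (case_prod ?f (s, w)))) \<in> borel_measurable (pos_part k)"
        using meas by measurable
    qed
  qed (use inner in simp)
  have eq: "(LINT s|pos_part k. ?f s w) = set_lebesgue_integral (pos_part k) T (Z w) * \<xi> n w" for w
    by (simp add: set_lebesgue_integral_def)
  have "integrable W (\<lambda>w. LINT s|pos_part k. ?f s w)"
    using PW.integrable_snd[OF int] by simp
  thus ?I unfolding eq .
  have "expectation (\<lambda>w. LINT s|pos_part k. ?f s w) = (LINT s|pos_part k. expectation (?f s))"
    using PW.Fubini_integral[OF int] .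
  also have "(LINT s|pos_part k. expectation (?f s)) = set_lebesgue_integral (pos_part k) T (\<lambda>s. cov (point_mass s) n)"
    unfolding set_lebesgue_integral_def
  proof (rule Bochner_Integration.integral_cong[OF refl])
    fix s
    have "expectation (?f s) = cov (point_mass s) n" if "s \<in> T"
      unfolding cov_def using that by (intro Bochner_Integration.integral_cong) (simp_all add: \<xi>_point_mass)
    thus "expectation (?f s) = indicator T s *\<^sub>R cov (point_mass s) n"
      by (cases "s \<in> T") simp_all
  qed
  finally show ?E unfolding eq .
qed

lemma cov_eq_signed_integral:
  assumes n: "n \<in> MT"
  shows "cov m n = signed_integral T m (\<lambda>s. cov (point_mass s) n)"
proof -
  have "cov m n = expectation (\<lambda>w. set_lebesgue_integral (pos_part m) T (Z w) * \<xi> n w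
      - set_lebesgue_integral (pos_part (- m)) T (Z w) * \<xi> n w)"
    unfolding cov_def \<xi>_def[of m] signed_integral_def by (simp add: algebra_simps)
  thus ?thesis
    using expectation_integral_mult_\<xi>[OF n] by (simp add: signed_integral_def)
qed

lemma cov_op_eq:
  assumes n: "n \<in> MT" and s: "s \<in> T"
  shows "cov_op W T Z n s = cov (point_mass s) n"
proof -
  have "cov_op W T Z n s = signed_integral T n (\<lambda>t. cov_fun W Z s t)"
    using s by (simp add: cov_op_def)
  also have "\<dots> = signed_integral T n (\<lambda>t. cov (point_mass t) (point_mass s))"
    by (rule signed_integral_cong) (simp add: cov_fun_eq s cov_commute)
  also have "\<dots> = cov n (point_mass s)"
    by (rule cov_eq_signed_integral[symmetric, OF point_mass_on[OF s]])
  finally show ?thesis by (simp add: cov_commute)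
qed

lemma continuous_cov_op: "n \<in> MT \<Longrightarrow> continuous_on T (cov_op W T Z n)"
  by (rule continuous_on_eq[OF continuous_cov_point_mass]) (simp_all only: cov_op_eq)

lemma signed_integral_cov_op:
  assumes "n \<in> MT"
  shows "signed_integral T m (cov_op W T Z n) = cov m n"
  by (subst cov_eq_signed_integral[OF assms], rule signed_integral_cong) (simp only: cov_op_eq[OF assms])

lemma cov_le_norm:
  obtains C where "C \<ge> 0" "\<And>m. m \<in> MT \<Longrightarrow> cov m m \<le> C * (norm m)\<^sup>2"
proof -
  obtain C where C: "C \<ge> 0" "\<And>s. s \<in> T \<Longrightarrow> cov (point_mass s) (point_mass s) \<le> C"
    by (rule variance_bounded) blast
  have 1: "\<bar>cov (point_mass s) (point_mass t)\<bar> \<le> C" if "s \<in> T" "t \<in> T" for s t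
  proof -
    have "\<bar>cov (point_mass s) (point_mass t)\<bar>
        \<le> (cov (point_mass s) (point_mass s) + cov (point_mass t) (point_mass t)) / 2"
      by (intro abs_cov_le point_mass_on that)
    also have "\<dots> \<le> (C + C) / 2" by (intro divide_right_mono add_mono C(2) that) simp
    finally show ?thesis by simp
  qed
  have 2: "\<bar>cov m (point_mass t)\<bar> \<le> 2 * norm m * C" if "t \<in> T" for t m
    by (subst cov_eq_signed_integral[OF point_mass_on[OF that]],
        rule abs_signed_integral_le[OF compact_T continuous_cov_point_mass[OF point_mass_on[OF that]]])
       (use 1 that C in auto)
  have "cov m m \<le> 4 * C * (norm m)\<^sup>2" if m: "m \<in> MT" for m
  proof -
    have "\<bar>cov m m\<bar> \<le> 2 * norm m * (2 * norm m * C)"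
      by (subst cov_eq_signed_integral[OF m],
          rule abs_signed_integral_le[OF compact_T continuous_cov_point_mass[OF m]])
         (use 2[of _ m] C in \<open>auto simp: cov_commute\<close>)
    thus ?thesis by (simp add: power2_eq_square algebra_simps)
  qed
  thus ?thesis using C by (intro that[of "4 * C"]) auto
qed

end

section \<open>The Cameron--Martin theorem\<close>

context gaussian_vector
begin

lemma cov_add_scaled:
  assumes "m \<in> MT" "n \<in> MT"
  shows "cov (m + c *\<^sub>R n) (m + c *\<^sub>R n) = cov m m + 2 * c * cov m n + c\<^sup>2 * cov n n"
proof -
  have s: "m + c *\<^sub>R n \<in> MT" using MT_linear[OF assms, of 1 c] by simp
  have "cov (m + c *\<^sub>R n) (m + c *\<^sub>R n) = cov m (m + c *\<^sub>R n) + c * cov n (m + c *\<^sub>R n)"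
    using cov_linear_left[OF assms s, of 1 c] by simp
  also have "cov m (m + c *\<^sub>R n) = cov m m + c * cov m n"
    using cov_linear_right[OF assms assms(1), of 1 c] by simp
  also have "cov n (m + c *\<^sub>R n) = cov m n + c * cov n n"
    using cov_linear_right[OF assms assms(2), of 1 c] cov_commute[of n m] by simp
  finally show ?thesis by (simp add: algebra_simps power2_eq_square)
qed

lemma uncorrelated_trig:
  assumes m: "m \<in> MT" and n: "n \<in> MT" and 0: "cov m n = 0"
  shows "expectation (\<lambda>w. cos (\<xi> m w) * cos (t * \<xi> n w)) = exp (- (cov m m / 2)) * exp (- (t\<^sup>2 * cov n n / 2))"
    and "expectation (\<lambda>w. cos (\<xi> m w) * sin (t * \<xi> n w)) = 0"
    and "expectation (\<lambda>w. sin (\<xi> m w) * cos (t * \<xi> n w)) = 0"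
    and "expectation (\<lambda>w. sin (\<xi> m w) * sin (t * \<xi> n w)) = 0"
proof -
  define p where "p = m + t *\<^sub>R n"
  define q where "q = m + (- t) *\<^sub>R n"
  have pq: "p \<in> MT" "q \<in> MT"
    using MT_linear[OF m n, of 1 t] MT_linear[OF m n, of 1 "- t"] by (simp_all add: p_def q_def)
  have c: "cov p p = cov m m + t\<^sup>2 * cov n n" "cov q q = cov m m + t\<^sup>2 * cov n n"
    unfolding p_def q_def cov_add_scaled[OF m n] 0 by simp_all
  have e: "\<xi> p w = \<xi> m w + t * \<xi> n w" "\<xi> q w = \<xi> m w - t * \<xi> n w" if "w \<in> space W" for w
    using \<xi>_linear[OF that, of 1 m t n] \<xi>_linear[OF that, of 1 m "- t" n] by (simp_all add: p_def q_def)
  have i: "integrable W (\<lambda>w. cos (\<xi> r w))" "integrable W (\<lambda>w. sin (\<xi> r w))" if "r \<in> MT" for r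
    using measurable_\<xi>[OF that] by (auto intro!: integrable_const_bound[where B=1])
  have ex: "exp (- (cov p p / 2)) = exp (- (cov m m / 2)) * exp (- (t\<^sup>2 * cov n n / 2))"
    "exp (- (cov q q / 2)) = exp (- (cov m m / 2)) * exp (- (t\<^sup>2 * cov n n / 2))"
    unfolding c by (simp_all add: exp_add[symmetric] add_divide_distrib)
  note E = expectation_cos_\<xi>[OF pq(1)] expectation_cos_\<xi>[OF pq(2)]
    expectation_sin_\<xi>[OF pq(1)] expectation_sin_\<xi>[OF pq(2)]
  have "expectation (\<lambda>w. cos (\<xi> m w) * cos (t * \<xi> n w)) = expectation (\<lambda>w. (cos (\<xi> q w) + cos (\<xi> p w)) / 2)"
    by (intro Bochner_Integration.integral_cong refl) (simp add: e cos_times_cos)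
  thus "expectation (\<lambda>w. cos (\<xi> m w) * cos (t * \<xi> n w)) = exp (- (cov m m / 2)) * exp (- (t\<^sup>2 * cov n n / 2))"
    using i pq by (simp add: E ex)
  have "expectation (\<lambda>w. cos (\<xi> m w) * sin (t * \<xi> n w)) = expectation (\<lambda>w. (sin (\<xi> p w) - sin (\<xi> q w)) / 2)"
    by (intro Bochner_Integration.integral_cong refl) (simp add: e cos_times_sin)
  thus "expectation (\<lambda>w. cos (\<xi> m w) * sin (t * \<xi> n w)) = 0"
    using i pq by (simp add: E)
  have "expectation (\<lambda>w. sin (\<xi> m w) * cos (t * \<xi> n w)) = expectation (\<lambda>w. (sin (\<xi> p w) + sin (\<xi> q w)) / 2)"
    by (intro Bochner_Integration.integral_cong refl) (simp add: e sin_times_cos)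
  thus "expectation (\<lambda>w. sin (\<xi> m w) * cos (t * \<xi> n w)) = 0"
    using i pq by (simp add: E)
  have "expectation (\<lambda>w. sin (\<xi> m w) * sin (t * \<xi> n w)) = expectation (\<lambda>w. (cos (\<xi> q w) - cos (\<xi> p w)) / 2)"
    by (intro Bochner_Integration.integral_cong refl) (simp add: e sin_times_sin)
  thus "expectation (\<lambda>w. sin (\<xi> m w) * sin (t * \<xi> n w)) = 0"
    using i pq by (simp add: E ex)
qed

text \<open>Uncorrelated implies independent, in the form needed below. The univariate uniqueness theorem
  is applied to \<open>\<langle>n, Z\<rangle>\<close> under the weights \<open>1 + cos \<langle>m, Z\<rangle>\<close> and \<open>1 + sin \<langle>m, Z\<rangle>\<close>.\<close>

lemma uncorrelated_factor:
  fixes \<psi> :: "real \<Rightarrow> real"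
  assumes m: "m \<in> MT" and n: "n \<in> MT" and 0: "cov m n = 0"
    and [measurable]: "\<psi> \<in> borel_measurable borel" and int: "integrable W (\<lambda>w. \<psi> (\<xi> n w))"
  shows "expectation (\<lambda>w. cos (\<xi> m w) * \<psi> (\<xi> n w)) = exp (- (cov m m / 2)) * expectation (\<lambda>w. \<psi> (\<xi> n w))"
    and "expectation (\<lambda>w. sin (\<xi> m w) * \<psi> (\<xi> n w)) = 0"
proof -
  have [measurable]: "\<xi> m \<in> borel_measurable W" "\<xi> n \<in> borel_measurable W"
    by (rule measurable_\<xi>[OF m], rule measurable_\<xi>[OF n])
  define e where "e = exp (- (cov m m / 2))"
  have e: "0 \<le> 1 + e" unfolding e_def by (intro add_nonneg_nonneg) simp_all
  note E = uncorrelated_trig[OF m n 0, folded e_def]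
  have c1: "expectation (\<lambda>w. cos (t * \<xi> n w)) = exp (- (t\<^sup>2 * cov n n / 2))"
    "expectation (\<lambda>w. sin (t * \<xi> n w)) = 0" for t
    using centered_normal_props(5,6)[OF normal_\<xi>[OF n], of t] by (simp_all add: cov_square)
  have ib: "integrable W (\<lambda>w. u (\<xi> m w) * v (t * \<xi> n w))" "integrable W (\<lambda>w. v (t * \<xi> n w))"
    if [measurable]: "u \<in> borel_measurable borel" "v \<in> borel_measurable borel"
      and "\<And>x. \<bar>u x\<bar> \<le> 1" "\<And>x. \<bar>v x\<bar> \<le> (1::real)" for u v and t :: real
    using that(3,4) by (auto intro!: integrable_const_bound[where B=1] simp: abs_mult mult_le_one)
  have ii: "integrable W (\<lambda>w. u (\<xi> m w) * \<psi> (\<xi> n w))"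
    if [measurable]: "u \<in> borel_measurable borel" and "\<And>x. \<bar>u x\<bar> \<le> (1::real)" for u
  proof (rule Bochner_Integration.integrable_bound[OF int])
    show "AE w in W. norm (u (\<xi> m w) * \<psi> (\<xi> n w)) \<le> norm (\<psi> (\<xi> n w))"
      using that(2) by (intro AE_I2) (simp add: abs_mult mult_left_le_one_le)
  qed simp
  have b: "0 \<le> 1 + cos x" "1 + cos x \<le> 2" "0 \<le> 1 + sin x" "1 + sin x \<le> 2" for x :: real
    using cos_ge_minus_one[of x] sin_ge_minus_one[of x] cos_le_one[of x] sin_le_one[of x] by linarith+
  have "expectation (\<lambda>w. (1 + cos (\<xi> m w)) *\<^sub>R \<psi> (\<xi> n w)) = expectation (\<lambda>w. (1 + e) *\<^sub>R \<psi> (\<xi> n w))"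
  proof (rule weighted_trig_eq_imp_integral_eq[OF finite_measure_axioms finite_measure_axioms, where B=2 and C="1+e"
        and X="\<xi> n" and Y="\<xi> n" and h="\<lambda>w. 1 + cos (\<xi> m w)" and k="\<lambda>w. 1 + e" and \<psi>=\<psi>])
    show "expectation (\<lambda>w. (1 + cos (\<xi> m w)) * cos (t * \<xi> n w)) = expectation (\<lambda>w. (1 + e) * cos (t * \<xi> n w))" for t
      using ib[of cos cos t] E(1)[of t] c1(1)[of t] by (simp add: distrib_right)
    show "expectation (\<lambda>w. (1 + cos (\<xi> m w)) * sin (t * \<xi> n w)) = expectation (\<lambda>w. (1 + e) * sin (t * \<xi> n w))" for t
      using ib[of cos sin t] E(2)[of t] c1(2)[of t] by (simp add: distrib_right)
  qed (use b e in simp_all)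
  thus "expectation (\<lambda>w. cos (\<xi> m w) * \<psi> (\<xi> n w)) = exp (- (cov m m / 2)) * expectation (\<lambda>w. \<psi> (\<xi> n w))"
    using int ii[of cos] by (simp add: distrib_right e_def)
  have "expectation (\<lambda>w. (1 + sin (\<xi> m w)) *\<^sub>R \<psi> (\<xi> n w)) = expectation (\<lambda>w. 1 *\<^sub>R \<psi> (\<xi> n w))"
  proof (rule weighted_trig_eq_imp_integral_eq[OF finite_measure_axioms finite_measure_axioms, where B=2 and C=1
        and X="\<xi> n" and Y="\<xi> n" and h="\<lambda>w. 1 + sin (\<xi> m w)" and k="\<lambda>w. 1" and \<psi>=\<psi>])
    show "expectation (\<lambda>w. (1 + sin (\<xi> m w)) * cos (t * \<xi> n w)) = expectation (\<lambda>w. 1 * cos (t * \<xi> n w))" for t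
      using ib[of sin cos t] E(3)[of t] by (simp add: distrib_right)
    show "expectation (\<lambda>w. (1 + sin (\<xi> m w)) * sin (t * \<xi> n w)) = expectation (\<lambda>w. 1 * sin (t * \<xi> n w))" for t
      using ib[of sin sin t] E(4)[of t] by (simp add: distrib_right)
  qed (use b in simp_all)
  thus "expectation (\<lambda>w. sin (\<xi> m w) * \<psi> (\<xi> n w)) = 0"
    using int ii[of sin] by (simp add: distrib_right)
qed

text \<open>The characteristic functional of \<open>Z\<close> under the density \<open>exp (\<langle>n, Z\<rangle> - v / 2)\<close>, with \<open>v\<close> the
  variance of \<open>\<langle>n, Z\<rangle>\<close>: every \<open>\<langle>m, Z\<rangle>\<close> is shifted by its covariance with \<open>\<langle>n, Z\<rangle>\<close>.\<close>

lemma expectation_exp_mult_trig: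
  assumes m: "m \<in> MT" and n: "n \<in> MT"
  shows "expectation (\<lambda>w. exp (\<xi> n w - cov n n / 2) * cos (\<xi> m w)) = exp (- (cov m m / 2)) * cos (cov m n)"
    and "expectation (\<lambda>w. exp (\<xi> n w - cov n n / 2) * sin (\<xi> m w)) = exp (- (cov m m / 2)) * sin (cov m n)"
proof -
  have [measurable]: "\<xi> n \<in> borel_measurable W" by (rule measurable_\<xi>[OF n])
  define v where "v = cov n n"
  \<comment> \<open>The regression coefficient of \<open>\<langle>m, Z\<rangle>\<close> on \<open>\<langle>n, Z\<rangle>\<close>, which is \<open>0\<close> if \<open>v = 0\<close>.\<close>
  define c where "c = cov m n / v"
  define k where "k = m + (- c) *\<^sub>R n"
  have k: "k \<in> MT" using MT_linear[OF m n, of 1 "- c"] by (simp add: k_def)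
  have cv: "c * v = cov m n"
  proof (cases "v = 0")
    case True
    have "AE w in W. (\<xi> n w)\<^sup>2 = 0"
      using True square_integrable_\<xi>[OF n]
      by (subst integral_nonneg_eq_0_iff_AE[symmetric]) (simp_all add: v_def cov_square)
    hence "AE w in W. \<xi> m w * \<xi> n w = 0" by eventually_elim simp
    hence "cov m n = 0" unfolding cov_def by (rule integral_eq_zero_AE)
    thus ?thesis using True by simp
  qed (simp add: c_def)
  have kn: "cov k n = 0"
    using cov_linear_left[OF m n n, of 1 "- c"] cv by (simp add: k_def v_def)
  have mm: "m = k + c *\<^sub>R n" by (simp add: k_def)
  have cm: "cov m m = cov k k + c\<^sup>2 * v"
    unfolding v_def by (subst (1 2) mm, subst cov_add_scaled[OF k n]) (simp add: kn)
  have e: "\<xi> m w = \<xi> k w + c * \<xi> n w" if "w \<in> space W" for w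
    using \<xi>_linear[OF that, of 1 k c n] by (simp add: mm[symmetric])
  have iexp: "integrable W (\<lambda>w. exp (\<xi> n w - v / 2))"
    using centered_normal_props(4)[OF normal_\<xi>[OF n]] by (simp add: exp_diff)
  have ie: "integrable W (\<lambda>w. exp (\<xi> n w - v / 2) * u (c * \<xi> n w))"
    if [measurable]: "u \<in> borel_measurable borel" and "\<And>x. \<bar>u x\<bar> \<le> (1::real)" for u
  proof (rule Bochner_Integration.integrable_bound[OF iexp])
    show "AE w in W. norm (exp (\<xi> n w - v / 2) * u (c * \<xi> n w)) \<le> norm (exp (\<xi> n w - v / 2))"
      using that(2) by (intro AE_I2) (simp add: abs_mult mult_left_le)
  qed simp
  have trig: "expectation (\<lambda>w. cos (c * \<xi> n w)) = exp (- (c\<^sup>2 * v / 2))" "expectation (\<lambda>w. sin (c * \<xi> n w)) = 0"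
    using centered_normal_props(5,6)[OF normal_\<xi>[OF n], of c] by (simp_all add: cov_square v_def)
  have ib: "integrable W (\<lambda>w. cos (c * \<xi> n w))" "integrable W (\<lambda>w. sin (c * \<xi> n w))"
    by (auto intro!: integrable_const_bound[where B=1])
  have g: "expectation (\<lambda>w. exp (\<xi> n w - v / 2) * u (c * \<xi> n w)) = expectation (\<lambda>w. u (c * \<xi> n w + cov m n))"
    if [measurable]: "u \<in> borel_measurable borel" for u :: "real \<Rightarrow> real"
    using centered_normal_props(7)[OF normal_\<xi>[OF n], of "\<lambda>x. u (c * x)"] cv
    by (simp add: cov_square[symmetric] v_def[symmetric] distrib_left)
  have gc: "expectation (\<lambda>w. exp (\<xi> n w - v / 2) * cos (c * \<xi> n w)) = exp (- (c\<^sup>2 * v / 2)) * cos (cov m n)"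
    using ib by (subst g) (simp_all add: cos_add trig)
  have gs: "expectation (\<lambda>w. exp (\<xi> n w - v / 2) * sin (c * \<xi> n w)) = exp (- (c\<^sup>2 * v / 2)) * sin (cov m n)"
    using ib by (subst g) (simp_all add: sin_add trig)
  have F: "expectation (\<lambda>w. cos (\<xi> k w) * (exp (\<xi> n w - v / 2) * u (c * \<xi> n w))) =
      exp (- (cov k k / 2)) * expectation (\<lambda>w. exp (\<xi> n w - v / 2) * u (c * \<xi> n w))"
    "expectation (\<lambda>w. sin (\<xi> k w) * (exp (\<xi> n w - v / 2) * u (c * \<xi> n w))) = 0"
    "integrable W (\<lambda>w. cos (\<xi> k w) * (exp (\<xi> n w - v / 2) * u (c * \<xi> n w)))"
    "integrable W (\<lambda>w. sin (\<xi> k w) * (exp (\<xi> n w - v / 2) * u (c * \<xi> n w)))"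
    if [measurable]: "u \<in> borel_measurable borel" and u: "\<And>x. \<bar>u x\<bar> \<le> (1::real)" for u
  proof -
    have [measurable]: "\<xi> k \<in> borel_measurable W" by (rule measurable_\<xi>[OF k])
    have [measurable]: "(\<lambda>x. exp (x - v / 2) * u (c * x)) \<in> borel_measurable borel" by simp
    note U = uncorrelated_factor[OF k n kn this ie[OF that]]
    show "expectation (\<lambda>w. cos (\<xi> k w) * (exp (\<xi> n w - v / 2) * u (c * \<xi> n w))) =
      exp (- (cov k k / 2)) * expectation (\<lambda>w. exp (\<xi> n w - v / 2) * u (c * \<xi> n w))" by (rule U(1))
    show "expectation (\<lambda>w. sin (\<xi> k w) * (exp (\<xi> n w - v / 2) * u (c * \<xi> n w))) = 0" by (rule U(2))
    have le: "\<bar>a * y\<bar> \<le> \<bar>y\<bar>" if "\<bar>a\<bar> \<le> 1" for a y :: real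
      using that by (simp add: abs_mult mult_left_le_one_le)
    show "integrable W (\<lambda>w. cos (\<xi> k w) * (exp (\<xi> n w - v / 2) * u (c * \<xi> n w)))"
      by (rule Bochner_Integration.integrable_bound[OF ie[OF that]])
         (simp, intro AE_I2, unfold real_norm_def, rule le[OF abs_cos_le_one])
    show "integrable W (\<lambda>w. sin (\<xi> k w) * (exp (\<xi> n w - v / 2) * u (c * \<xi> n w)))"
      by (rule Bochner_Integration.integrable_bound[OF ie[OF that]])
         (simp, intro AE_I2, unfold real_norm_def, rule le[OF abs_sin_le_one])
  qed
  have ek: "exp (- (cov k k / 2)) * exp (- (c\<^sup>2 * v / 2)) = exp (- (cov m m / 2))"
    unfolding cm by (simp add: exp_add[symmetric] add_divide_distrib)
  have "expectation (\<lambda>w. exp (\<xi> n w - v / 2) * cos (\<xi> m w)) =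
      expectation (\<lambda>w. cos (\<xi> k w) * (exp (\<xi> n w - v / 2) * cos (c * \<xi> n w))
        - sin (\<xi> k w) * (exp (\<xi> n w - v / 2) * sin (c * \<xi> n w)))"
    by (intro Bochner_Integration.integral_cong refl) (simp add: e cos_add algebra_simps)
  also have "\<dots> = exp (- (cov k k / 2)) * (exp (- (c\<^sup>2 * v / 2)) * cos (cov m n))"
    using F[of cos] F[of sin] gc by simp
  finally show "expectation (\<lambda>w. exp (\<xi> n w - cov n n / 2) * cos (\<xi> m w)) = exp (- (cov m m / 2)) * cos (cov m n)"
    unfolding v_def[symmetric] ek[symmetric] by (simp only: mult.assoc)
  have "expectation (\<lambda>w. exp (\<xi> n w - v / 2) * sin (\<xi> m w)) =
      expectation (\<lambda>w. sin (\<xi> k w) * (exp (\<xi> n w - v / 2) * cos (c * \<xi> n w))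
        + cos (\<xi> k w) * (exp (\<xi> n w - v / 2) * sin (c * \<xi> n w)))"
    by (intro Bochner_Integration.integral_cong refl) (simp add: e sin_add algebra_simps)
  also have "\<dots> = exp (- (cov k k / 2)) * (exp (- (c\<^sup>2 * v / 2)) * sin (cov m n))"
    using F[of cos] F[of sin] gs by simp
  finally show "expectation (\<lambda>w. exp (\<xi> n w - cov n n / 2) * sin (\<xi> m w)) = exp (- (cov m m / 2)) * sin (cov m n)"
    unfolding v_def[symmetric] ek[symmetric] by (simp only: mult.assoc)
qed

lemma measurable_residual:
  assumes h: "continuous_on T h"
  shows "(\<lambda>x. signed_integral T n (\<lambda>t. (x t - h t) / \<epsilon>)) \<in> borel_measurable (C_borel T)"
proof (rule borel_measurable_C_borelI[OF compact_T])
  fix x y :: "real \<Rightarrow> real" and r :: real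
  assume x: "x \<in> mspace (C_space T)" and y: "y \<in> mspace (C_space T)" and r: "r \<ge> 0"
    and le: "\<And>t. t \<in> T \<Longrightarrow> \<bar>x t - y t\<bar> \<le> r"
  have c: "continuous_on T x" "continuous_on T y" using x y by (simp_all add: mspace_C_space compact_T)
  have e: "signed_integral T n (\<lambda>t. (z t - h t) / \<epsilon>) = (1/\<epsilon>) * signed_integral T n z + (- 1/\<epsilon>) * signed_integral T n h"
    if "continuous_on T z" for z
    using signed_integral_linear_fun[OF compact_T that h, of n "1/\<epsilon>" "- 1/\<epsilon>"]
    by (simp add: diff_divide_distrib)
  have "signed_integral T n (\<lambda>t. 1 * x t + (- 1) * y t) = 1 * signed_integral T n x + (- 1) * signed_integral T n y"
    by (rule signed_integral_linear_fun[OF compact_T c])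
  moreover have "\<bar>signed_integral T n (\<lambda>t. 1 * x t + (- 1) * y t)\<bar> \<le> 2 * norm n * r"
    using c le r by (intro abs_signed_integral_le[OF compact_T]) (auto intro!: continuous_intros)
  ultimately have "\<bar>signed_integral T n x - signed_integral T n y\<bar> \<le> 2 * norm n * r" by simp
  hence "\<bar>1/\<epsilon>\<bar> * \<bar>signed_integral T n x - signed_integral T n y\<bar> \<le> \<bar>1/\<epsilon>\<bar> * (2 * norm n * r)"
    by (rule mult_left_mono) simp
  also have "\<bar>1/\<epsilon>\<bar> * \<bar>signed_integral T n x - signed_integral T n y\<bar> =
      \<bar>signed_integral T n (\<lambda>t. (x t - h t) / \<epsilon>) - signed_integral T n (\<lambda>t. (y t - h t) / \<epsilon>)\<bar>"
    unfolding e[OF c(1)] e[OF c(2)] abs_mult[symmetric] by (simp add: right_diff_distrib)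
  finally show "\<bar>signed_integral T n (\<lambda>t. (x t - h t) / \<epsilon>) - signed_integral T n (\<lambda>t. (y t - h t) / \<epsilon>)\<bar>
      \<le> \<bar>1/\<epsilon>\<bar> * 2 * norm n * r" by (simp only: mult.assoc)
qed

lemma measurable_signal_plus_noise:
  assumes h: "continuous_on T h"
  shows "(\<lambda>w. \<lambda>t\<in>T. h t + \<epsilon> * Z w t) \<in> measurable W (C_borel T)"
  using measurable_compose[OF Z_measurable measurable_affine_C_borel[OF compact_T h, of \<epsilon>]] .

lemma residual_signal_plus_noise:
  assumes w: "w \<in> space W" and h: "continuous_on T h" and "\<epsilon> \<noteq> 0"
  shows "signed_integral T n (\<lambda>s. ((\<lambda>t\<in>T. h t + \<epsilon> * Z w t) s - h s) / \<epsilon>) = \<xi> n w"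
  unfolding \<xi>_def using assms by (intro signed_integral_cong) simp

text \<open>The Cameron--Martin theorem in \<open>C(T)\<close> for shifts \<open>K n\<close>. The signal \<open>h\<close> and the noise level
  \<open>\<epsilon>\<close> are built in, so that the density is a function of the observation.\<close>

lemma cameron_martin:
  assumes h: "continuous_on T h" and n: "n \<in> MT" and \<epsilon>: "\<epsilon> \<noteq> 0"
  shows "distr W (C_borel T) (\<lambda>w. \<lambda>t\<in>T. (h t + \<epsilon> * cov_op W T Z n t) + \<epsilon> * Z w t) =
    density (distr W (C_borel T) (\<lambda>w. \<lambda>t\<in>T. h t + \<epsilon> * Z w t))
      (\<lambda>x. ennreal (exp (signed_integral T n (\<lambda>t. (x t - h t) / \<epsilon>) - cov n n / 2)))"
    (is "distr W _ ?\<Psi> = density (distr W _ ?\<Phi>) (\<lambda>x. ennreal (?G x))")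
proof -
  let ?C = "mspace (C_space T)"
  have hn: "continuous_on T (\<lambda>t. h t + \<epsilon> * cov_op W T Z n t)"
    by (intro continuous_intros h continuous_cov_op[OF n])
  have [measurable]: "?\<Psi> \<in> measurable W (C_borel T)" "?\<Phi> \<in> measurable W (C_borel T)"
    by (rule measurable_signal_plus_noise[OF hn], rule measurable_signal_plus_noise[OF h])
  have [measurable]: "?G \<in> borel_measurable (C_borel T)"
    using measurable_residual[OF h, of n \<epsilon>] by measurable
  have G: "?G (?\<Phi> w) = exp (\<xi> n w - cov n n / 2)" if "w \<in> space W" for w
    using residual_signal_plus_noise[OF that h \<epsilon>] by simp
  have iG: "integrable W (\<lambda>w. exp (\<xi> n w - cov n n / 2))"
    using centered_normal_props(4)[OF normal_\<xi>[OF n]] by (simp add: exp_diff)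
  \<comment> \<open>Integration against \<open>m\<close> is linear in \<open>m\<close> on \<open>C(T)\<close> only, hence the default value \<open>0\<close> elsewhere.\<close>
  define f where "f m x = (if x \<in> ?C then signed_integral T m x else 0)" for m x
  have cont: "continuous_on T x" if "x \<in> ?C" for x using that by (simp add: mspace_C_space compact_T)
  have f_meas [measurable]: "f m \<in> borel_measurable (C_borel T)" for m
  proof -
    have "(\<lambda>x. signed_integral T m (\<lambda>t. (x t - 0) / 1)) \<in> borel_measurable (C_borel T)"
      by (rule measurable_residual) simp
    thus ?thesis by (subst measurable_cong[of _ _ "signed_integral T m"]) (simp_all add: f_def)
  qed
  have f_aff: "f m (\<lambda>t\<in>T. g t + \<epsilon> * Z w t) = signed_integral T m g + \<xi> (\<epsilon> *\<^sub>R m) w"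
    if w: "w \<in> space W" and g: "continuous_on T g" for m g w
  proof -
    have "f m (\<lambda>t\<in>T. g t + \<epsilon> * Z w t) = signed_integral T m (\<lambda>t\<in>T. g t + \<epsilon> * Z w t)"
      using affine_in_C_space[OF compact_T g Z_in_C[OF w], of \<epsilon>] by (simp add: f_def)
    also have "\<dots> = signed_integral T m (\<lambda>t. 1 * g t + \<epsilon> * Z w t)"
      by (rule signed_integral_cong) simp
    also have "\<dots> = 1 * signed_integral T m g + \<epsilon> * signed_integral T m (Z w)"
      by (rule signed_integral_linear_fun[OF compact_T g Z_continuous[OF w]])
    finally show ?thesis
      using \<xi>_linear[OF w, of \<epsilon> m 0 0] by (simp add: \<xi>_def)
  qed
  have zero: "0 \<in> MT" by (simp add: signed_measures_on_def zero_signed_measure.rep_eq)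
  show ?thesis
  proof (rule measures_eq_if_trig_integrals_eq[where F="f ` MT"])
    show "finite_measure (distr W (C_borel T) ?\<Psi>)" by (rule finite_measure_distr) simp
    show "finite_measure (density (distr W (C_borel T) ?\<Phi>) (\<lambda>x. ennreal (?G x)))"
    proof (rule finite_measureI)
      have "emeasure (density (distr W (C_borel T) ?\<Phi>) (\<lambda>x. ennreal (?G x))) ?C
          = (\<integral>\<^sup>+x. ennreal (?G x) * indicator ?C x \<partial>distr W (C_borel T) ?\<Phi>)"
        by (subst emeasure_density) (auto simp: space_C_borel[symmetric] simp del: space_C_borel)
      also have "\<dots> = (\<integral>\<^sup>+x. ennreal (?G x) \<partial>distr W (C_borel T) ?\<Phi>)"
        by (rule nn_integral_cong) (simp add: indicator_def)
      also have "\<dots> = (\<integral>\<^sup>+w. ennreal (?G (?\<Phi> w)) \<partial>W)"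
        by (subst nn_integral_distr) simp_all
      also have "\<dots> = (\<integral>\<^sup>+w. ennreal (exp (\<xi> n w - cov n n / 2)) \<partial>W)"
        by (rule nn_integral_cong) (simp only: G)
      also have "\<dots> = ennreal (expectation (\<lambda>w. exp (\<xi> n w - cov n n / 2)))"
        by (rule nn_integral_eq_integral[OF iG]) simp
      finally show "emeasure (density (distr W (C_borel T) ?\<Phi>) (\<lambda>x. ennreal (?G x)))
          (space (density (distr W (C_borel T) ?\<Phi>) (\<lambda>x. ennreal (?G x)))) \<noteq> \<infinity>" by simp
    qed
    show "sets (density (distr W (C_borel T) ?\<Phi>) (\<lambda>x. ennreal (?G x))) = sets (distr W (C_borel T) ?\<Psi>)"
      by simp
    show "g \<in> borel_measurable (distr W (C_borel T) ?\<Psi>)" if "g \<in> f ` MT" for g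
      using that by auto
    have "f 0 = (\<lambda>x. 0)" by (rule ext) (simp add: f_def signed_integral_def)
    thus "(\<lambda>x. 0) \<in> f ` MT" using zero by (metis imageI)
    show "(\<lambda>x. g x + c * k x) \<in> f ` MT" if gk: "g \<in> f ` MT" "k \<in> f ` MT" for g k c
    proof -
      obtain m p where mp: "m \<in> MT" "p \<in> MT" "g = f m" "k = f p" using gk by blast
      have "(\<lambda>x. g x + c * k x) = f (1 *\<^sub>R m + c *\<^sub>R p)"
        using signed_integral_linear_measure[OF compact_T cont, of _ 1 m c p]
        by (intro ext) (simp add: mp f_def)
      thus ?thesis using MT_linear[OF mp(1,2)] by blast
    qed
    show "sets (distr W (C_borel T) ?\<Psi>) \<subseteq> sigma_sets (space (distr W (C_borel T) ?\<Psi>))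
        {g -` A \<inter> space (distr W (C_borel T) ?\<Psi>) |g A. g \<in> f ` MT \<and> A \<in> sets borel}"
    proof -
      have "{(\<lambda>z. z t) -` A \<inter> ?C | t A. t \<in> T \<and> A \<in> sets borel} \<subseteq>
          {g -` A \<inter> ?C |g A. g \<in> f ` MT \<and> A \<in> sets borel}"
      proof (rule subsetI)
        fix B assume "B \<in> {(\<lambda>z. z t) -` A \<inter> ?C | t A. t \<in> T \<and> A \<in> sets borel}"
        then obtain t A where tA: "t \<in> T" "A \<in> sets borel" "B = (\<lambda>z. z t) -` A \<inter> ?C" by blast
        have "B = f (point_mass t) -` A \<inter> ?C"
          unfolding tA(3) using signed_integral_point_mass[OF compact_T cont tA(1)]
          by (auto simp: f_def)
        thus "B \<in> {g -` A \<inter> ?C |g A. g \<in> f ` MT \<and> A \<in> sets borel}"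
          using point_mass_on[OF tA(1)] tA(2) by blast
      qed
      from order_trans[OF sets_C_borel_subset_evaluations[OF T_eq] sigma_sets_mono'[OF this]]
      show ?thesis by simp
    qed
  next
    fix g assume "g \<in> f ` MT"
    then obtain m where m: "m \<in> MT" and g: "g = f m" by blast
    let ?a = "signed_integral T m h" and ?k = "\<epsilon> *\<^sub>R m"
    have k: "?k \<in> MT" using MT_linear[OF m zero, of \<epsilon> 0] by simp
    have kn: "cov ?k n = \<epsilon> * cov m n" using cov_linear_left[OF m zero n, of \<epsilon> 0] by simp
    have \<Psi>: "f m (?\<Psi> w) = (?a + cov ?k n) + \<xi> ?k w" if "w \<in> space W" for w
    proof -
      have "signed_integral T m (\<lambda>t. 1 * h t + \<epsilon> * cov_op W T Z n t) = ?a + \<epsilon> * cov m n"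
        by (subst signed_integral_linear_fun[OF compact_T h continuous_cov_op[OF n]])
           (simp add: signed_integral_cov_op[OF n])
      thus ?thesis using f_aff[OF that hn, of m] by (simp add: kn)
    qed
    have \<Phi>: "f m (?\<Phi> w) = ?a + \<xi> ?k w" if "w \<in> space W" for w
      using f_aff[OF that h, of m] .
    have [measurable]: "\<xi> ?k \<in> borel_measurable W" "\<xi> n \<in> borel_measurable W"
      by (rule measurable_\<xi>[OF k], rule measurable_\<xi>[OF n])
    have ib: "integrable W (\<lambda>w. cos (\<xi> ?k w))" "integrable W (\<lambda>w. sin (\<xi> ?k w))"
      by (auto intro!: integrable_const_bound[where B=1])
    have ie: "integrable W (\<lambda>w. exp (\<xi> n w - cov n n / 2) * u (\<xi> ?k w))"
      if [measurable]: "u \<in> borel_measurable borel" and "\<And>x. \<bar>u x\<bar> \<le> (1::real)" for u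
    proof (rule Bochner_Integration.integrable_bound[OF iG])
      show "AE w in W. norm (exp (\<xi> n w - cov n n / 2) * u (\<xi> ?k w)) \<le> norm (exp (\<xi> n w - cov n n / 2))"
        using that(2) by (intro AE_I2) (simp add: abs_mult mult_left_le)
    qed simp
    have L: "(LINT x|distr W (C_borel T) ?\<Psi>. u (f m x)) = expectation (\<lambda>w. u ((?a + cov ?k n) + \<xi> ?k w))"
      if [measurable]: "u \<in> borel_measurable borel" for u :: "real \<Rightarrow> real"
    proof -
      have "(LINT x|distr W (C_borel T) ?\<Psi>. u (f m x)) = expectation (\<lambda>w. u (f m (?\<Psi> w)))"
        by (rule integral_distr) simp_all
      also have "\<dots> = expectation (\<lambda>w. u ((?a + cov ?k n) + \<xi> ?k w))"
        by (rule Bochner_Integration.integral_cong[OF refl]) (simp only: \<Psi>)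
      finally show ?thesis .
    qed
    have R: "(LINT x|density (distr W (C_borel T) ?\<Phi>) (\<lambda>x. ennreal (?G x)). u (f m x)) =
        expectation (\<lambda>w. exp (\<xi> n w - cov n n / 2) * u (?a + \<xi> ?k w))"
      if [measurable]: "u \<in> borel_measurable borel" for u :: "real \<Rightarrow> real"
    proof -
      have "(LINT x|density (distr W (C_borel T) ?\<Phi>) (\<lambda>x. ennreal (?G x)). u (f m x)) =
          (LINT x|distr W (C_borel T) ?\<Phi>. ?G x *\<^sub>R u (f m x))"
        by (rule integral_density) simp_all
      also have "\<dots> = expectation (\<lambda>w. ?G (?\<Phi> w) *\<^sub>R u (f m (?\<Phi> w)))"
        by (rule integral_distr) simp_all
      also have "\<dots> = expectation (\<lambda>w. exp (\<xi> n w - cov n n / 2) * u (?a + \<xi> ?k w))"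
        by (rule Bochner_Integration.integral_cong[OF refl]) (simp only: G \<Phi> real_scaleR_def)
      finally show ?thesis .
    qed
    note E = expectation_exp_mult_trig[OF k n] expectation_cos_\<xi>[OF k] expectation_sin_\<xi>[OF k]
    have "expectation (\<lambda>w. exp (\<xi> n w - cov n n / 2) * cos (?a + \<xi> ?k w)) =
        expectation (\<lambda>w. cos ?a * (exp (\<xi> n w - cov n n / 2) * cos (\<xi> ?k w))
          - sin ?a * (exp (\<xi> n w - cov n n / 2) * sin (\<xi> ?k w)))"
      by (rule Bochner_Integration.integral_cong[OF refl]) (simp add: cos_add algebra_simps)
    also have "\<dots> = exp (- (cov ?k ?k / 2)) * cos (?a + cov ?k n)"
      using ie[of cos] ie[of sin] by (simp add: E) (simp add: cos_add algebra_simps)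
    also have "\<dots> = expectation (\<lambda>w. cos ((?a + cov ?k n) + \<xi> ?k w))"
      unfolding cos_add[of "?a + cov ?k n"] using ib by (simp add: E)
    finally show "(LINT x|distr W (C_borel T) ?\<Psi>. cos (g x)) =
        (LINT x|density (distr W (C_borel T) ?\<Phi>) (\<lambda>x. ennreal (?G x)). cos (g x))"
      using L[of cos] R[of cos] g by simp
    have "expectation (\<lambda>w. exp (\<xi> n w - cov n n / 2) * sin (?a + \<xi> ?k w)) =
        expectation (\<lambda>w. sin ?a * (exp (\<xi> n w - cov n n / 2) * cos (\<xi> ?k w))
          + cos ?a * (exp (\<xi> n w - cov n n / 2) * sin (\<xi> ?k w)))"
      by (rule Bochner_Integration.integral_cong[OF refl]) (simp add: sin_add algebra_simps)
    also have "\<dots> = exp (- (cov ?k ?k / 2)) * sin (?a + cov ?k n)"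
      using ie[of cos] ie[of sin] by (simp add: E) (simp add: sin_add algebra_simps)
    also have "\<dots> = expectation (\<lambda>w. sin ((?a + cov ?k n) + \<xi> ?k w))"
      unfolding sin_add[of "?a + cov ?k n"] using ib by (simp add: E)
    finally show "(LINT x|distr W (C_borel T) ?\<Psi>. sin (g x)) =
        (LINT x|density (distr W (C_borel T) ?\<Phi>) (\<lambda>x. ennreal (?G x)). sin (g x))"
      using L[of sin] R[of sin] g by simp
  qed
qed

lemma shifted_law_density:
  assumes m: "m \<in> MT" and n: "n \<in> MT" and \<epsilon>: "\<epsilon> \<noteq> 0"
  shows "shifted_law W T Z (m + \<epsilon> *\<^sub>R n) \<epsilon> = density (shifted_law W T Z m \<epsilon>)
      (\<lambda>x. ennreal (exp (signed_integral T n (\<lambda>t. (x t - cov_op W T Z m t) / \<epsilon>) - cov n n / 2)))"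
proof -
  have s: "m + \<epsilon> *\<^sub>R n \<in> MT" using MT_linear[OF m n, of 1 \<epsilon>] by simp
  have "cov_op W T Z (m + \<epsilon> *\<^sub>R n) t = cov_op W T Z m t + \<epsilon> * cov_op W T Z n t" if "t \<in> T" for t
    using cov_linear_right[OF m n point_mass_on[OF that], of 1 \<epsilon>]
    by (simp add: cov_op_eq[OF s that] cov_op_eq[OF m that] cov_op_eq[OF n that])
  hence "shifted_law W T Z (m + \<epsilon> *\<^sub>R n) \<epsilon> =
      distr W (C_borel T) (\<lambda>w. \<lambda>t\<in>T. (cov_op W T Z m t + \<epsilon> * cov_op W T Z n t) + \<epsilon> * Z w t)"
    unfolding shifted_law_def by (intro distr_cong refl restrict_ext) simp
  thus ?thesis
    unfolding cameron_martin[OF continuous_cov_op[OF m] n \<epsilon>] shifted_law_def .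
qed

end

section \<open>The standard normal law\<close>

lemma integral_lborel_prod:
  fixes f :: "'a::euclidean_space \<Rightarrow> real \<Rightarrow> complex"
  assumes int: "\<And>b. b \<in> Basis \<Longrightarrow> integrable lborel (f b)"
  shows "(LINT x|lborel. (\<Prod>b\<in>Basis. f b (x \<bullet> b))) = (\<Prod>b\<in>Basis. (LINT x|lborel. f b x))"
proof -
  interpret product_sigma_finite "\<lambda>b::'a. lborel :: real measure" ..
  have [measurable]: "f b \<in> borel_measurable borel" if "b \<in> Basis" for b
    using borel_measurable_integrable[OF int[OF that]] by simp
  have "(LINT x|lborel. (\<Prod>b\<in>Basis. f b (x \<bullet> b))) =
      (LINT g|(\<Pi>\<^sub>M b\<in>Basis. lborel). (\<Prod>b\<in>Basis. f b ((\<Sum>c\<in>Basis. g c *\<^sub>R c) \<bullet> b)))"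
    by (subst lborel_eq, rule integral_distr) measurable
  also have "\<dots> = (LINT g|(\<Pi>\<^sub>M b\<in>Basis. lborel). (\<Prod>b\<in>Basis. f b (g b)))"
    by (intro Bochner_Integration.integral_cong refl prod.cong) simp
  also have "\<dots> = (\<Prod>b\<in>Basis. (LINT x|lborel. f b x))"
    by (rule product_integral_prod) (simp_all add: int)
  finally show ?thesis .
qed

lemma prod_Basis_vec: "(\<Prod>b\<in>(Basis :: (real^'p::finite) set). F (x \<bullet> b)) = (\<Prod>i\<in>UNIV. F (x $ i))"
proof -
  have B: "(Basis :: (real^'p) set) = (\<lambda>i. axis i 1) ` UNIV"
    by (auto simp: Basis_vec_def)
  have "inj_on (\<lambda>i. axis i 1 :: real^'p) UNIV" by (auto simp: inj_on_def axis_eq_axis)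
  thus ?thesis unfolding B by (subst prod.reindex) (simp_all add: inner_axis)
qed

lemma std_normal_vec_eq:
  "std_normal_vec = density lborel (\<lambda>x :: real^'p::finite. ennreal (\<Prod>b\<in>Basis. std_normal_density (x \<bullet> b)))"
  unfolding std_normal_vec_def prod_Basis_vec by (simp add: prod_ennreal)

lemma prob_space_std_normal_vec: "prob_space (std_normal_vec :: (real^'p::finite) measure)"
proof
  have 1: "(\<integral>\<^sup>+x. ennreal (std_normal_density x) \<partial>lborel) = 1"
    using prob_space.emeasure_space_1[OF prob_space_normal_density[of 1 0]]
    by (simp add: emeasure_density)
  have "emeasure std_normal_vec (space std_normal_vec :: (real^'p) set) =
      (\<integral>\<^sup>+x. ennreal (\<Prod>b\<in>Basis. std_normal_density (x \<bullet> b)) \<partial>(lborel :: (real^'p) measure))"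
    unfolding std_normal_vec_eq by (simp add: emeasure_density)
  also have "\<dots> = (\<integral>\<^sup>+x. (\<Prod>b\<in>Basis. ennreal (std_normal_density (x \<bullet> b))) \<partial>(lborel :: (real^'p) measure))"
    by (simp add: prod_ennreal)
  also have "\<dots> = (\<Prod>b\<in>(Basis :: (real^'p) set). (\<integral>\<^sup>+x. ennreal (std_normal_density x) \<partial>lborel))"
    by (rule nn_integral_lborel_prod) simp_all
  finally show "emeasure std_normal_vec (space std_normal_vec :: (real^'p) set) = 1"
    by (simp add: 1)
qed

lemma iexp_std_normal_vec:
  fixes u :: "real^'p::finite"
  shows "(CLINT y|std_normal_vec. iexp (u \<bullet> y)) = complex_of_real (exp (- ((norm u)\<^sup>2 / 2)))"
proof -
  define F where "F b x = complex_of_real (std_normal_density x) * iexp ((u \<bullet> b) * x)" for b :: "real^'p" and x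
  have F1: "integrable lborel (F b) \<and> (LINT x|lborel. F b x) = complex_of_real (exp (- ((u \<bullet> b)\<^sup>2 / 2)))" for b
  proof
    show "integrable lborel (F b)"
    proof (rule Bochner_Integration.integrable_bound)
      show "integrable lborel std_normal_density" by simp
      show "F b \<in> borel_measurable lborel" unfolding F_def by measurable
      show "AE x in lborel. norm (F b x) \<le> norm (std_normal_density x)"
        by (intro AE_I2) (simp add: F_def norm_mult del: of_real_mult)
    qed
    have "char std_normal_distribution (u \<bullet> b) = (LINT x|lborel. std_normal_density x *\<^sub>R iexp ((u \<bullet> b) * x))"
      unfolding char_def by (rule integral_density) simp_all
    thus "(LINT x|lborel. F b x) = complex_of_real (exp (- ((u \<bullet> b)\<^sup>2 / 2)))"
      unfolding char_std_normal_distribution F_def by (simp add: scaleR_conv_of_real)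
  qed
  have "(CLINT y|std_normal_vec. iexp (u \<bullet> y)) =
      (LINT y|lborel. (\<Prod>b\<in>Basis. std_normal_density (y \<bullet> b)) *\<^sub>R iexp (u \<bullet> y))"
    unfolding std_normal_vec_eq by (rule integral_density) (simp_all add: prod_nonneg)
  also have "\<dots> = (LINT y|lborel. (\<Prod>b\<in>Basis. F b (y \<bullet> b)))"
  proof (rule Bochner_Integration.integral_cong[OF refl])
    fix y :: "real^'p"
    have "iexp (u \<bullet> y) = (\<Prod>b\<in>Basis. iexp ((u \<bullet> b) * (y \<bullet> b)))"
      by (subst euclidean_inner) (simp add: exp_sum[symmetric] sum_distrib_left)
    thus "(\<Prod>b\<in>Basis. std_normal_density (y \<bullet> b)) *\<^sub>R iexp (u \<bullet> y) = (\<Prod>b\<in>Basis. F b (y \<bullet> b))"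
      unfolding F_def scaleR_conv_of_real of_real_prod by (simp only: prod.distrib)
  qed
  also have "\<dots> = (\<Prod>b\<in>Basis. complex_of_real (exp (- ((u \<bullet> b)\<^sup>2 / 2))))"
    using F1 by (subst integral_lborel_prod) auto
  also have "\<dots> = complex_of_real (exp (\<Sum>b\<in>Basis. - ((u \<bullet> b)\<^sup>2 / 2)))"
    by (simp add: exp_sum)
  also have "(\<Sum>b\<in>Basis. - ((u \<bullet> b)\<^sup>2 / 2)) = - ((norm u)\<^sup>2 / 2)"
    unfolding power2_norm_eq_inner by (subst euclidean_inner) (simp add: sum_negf sum_divide_distrib power2_eq_square)
  finally show ?thesis .
qed

text \<open>The Cramer--Wold device for the standard normal law: the expectations of \<open>cos (u \<bullet> X)\<close> and
  \<open>sin (u \<bullet> X)\<close> over all \<open>u\<close> are the characteristic function of \<open>X\<close>.\<close>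

lemma distr_eq_std_normal_vec:
  fixes X :: "'w \<Rightarrow> real^'p::finite"
  assumes M: "prob_space M" and X [measurable]: "X \<in> borel_measurable M"
    and c: "\<And>u. (LINT w|M. cos (u \<bullet> X w)) = exp (- ((norm u)\<^sup>2 / 2))"
    and s: "\<And>u. (LINT w|M. sin (u \<bullet> X w)) = 0"
  shows "distr M borel X = std_normal_vec"
proof (rule measures_eq_if_trig_integrals_eq[where F="range (\<lambda>(u :: real^'p) x. u \<bullet> x)"])
  interpret N: prob_space "std_normal_vec :: (real^'p) measure" by (rule prob_space_std_normal_vec)
  have sets_N [measurable_cong]: "sets (std_normal_vec :: (real^'p) measure) = sets borel"
    by (simp add: std_normal_vec_def)
  show "finite_measure (distr M borel X)"
    by (rule finite_measure.finite_measure_distr[OF prob_space.finite_measure[OF M] X])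
  show "finite_measure (std_normal_vec :: (real^'p) measure)" by (rule N.finite_measure_axioms)
  show "sets (std_normal_vec :: (real^'p) measure) = sets (distr M borel X)" by (simp add: sets_N)
  show "f \<in> borel_measurable (distr M borel X)" if "f \<in> range (\<lambda>(u :: real^'p) x. u \<bullet> x)" for f
    using that by auto
  show "(\<lambda>x. 0) \<in> range (\<lambda>(u :: real^'p) x. u \<bullet> x)" by (rule range_eqI[of _ _ 0]) simp
  show "(\<lambda>x. f x + c * g x) \<in> range (\<lambda>(u :: real^'p) x. u \<bullet> x)"
    if fg: "f \<in> range (\<lambda>(u :: real^'p) x. u \<bullet> x)" "g \<in> range (\<lambda>(u :: real^'p) x. u \<bullet> x)" for f g c
  proof -
    obtain u v where "f = (\<lambda>x. u \<bullet> x)" "g = (\<lambda>x. v \<bullet> x)" using fg by blast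
    thus ?thesis by (intro range_eqI[of _ _ "u + c *\<^sub>R v"]) (simp add: inner_add_left)
  qed
  show "sets (distr M borel X) \<subseteq> sigma_sets (space (distr M borel X))
      {f -` A \<inter> space (distr M borel X) |f A. f \<in> range (\<lambda>(u :: real^'p) x. u \<bullet> x) \<and> A \<in> sets borel}"
  proof -
    have "(\<lambda>(a, i). {x :: real^'p. x \<bullet> i < a}) ` (UNIV \<times> Basis) \<subseteq>
        {f -` A \<inter> UNIV |f A. f \<in> range (\<lambda>(u :: real^'p) x. u \<bullet> x) \<and> A \<in> sets borel}"
    proof (rule image_subsetI)
      fix p :: "real \<times> (real^'p)"
      have "(case p of (a, i) \<Rightarrow> {x :: real^'p. x \<bullet> i < a}) = (\<lambda>x. snd p \<bullet> x) -` {..<fst p} \<inter> UNIV"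
        by (auto simp: inner_commute split: prod.splits)
      moreover have "{..<fst p} \<in> sets borel" by simp
      ultimately show "(case p of (a, i) \<Rightarrow> {x :: real^'p. x \<bullet> i < a}) \<in>
          {f -` A \<inter> UNIV |f A. f \<in> range (\<lambda>(u :: real^'p) x. u \<bullet> x) \<and> A \<in> sets borel}" by blast
    qed
    from sigma_sets_mono'[OF this, of UNIV]
    show ?thesis by (subst sets_distr, subst borel_eq_halfspace_less) simp
  qed
next
  fix f assume "f \<in> range (\<lambda>(u :: real^'p) x. u \<bullet> x)"
  then obtain u where f: "f = (\<lambda>x. u \<bullet> x)" by blast
  interpret N: prob_space "std_normal_vec :: (real^'p) measure" by (rule prob_space_std_normal_vec)
  have [measurable_cong]: "sets (std_normal_vec :: (real^'p) measure) = sets borel"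
    by (simp add: std_normal_vec_def)
  have i: "integrable std_normal_vec (\<lambda>y. iexp (u \<bullet> y))"
    by (rule N.integrable_const_bound[where B=1]) (auto intro!: AE_I2)
  have "(LINT y|std_normal_vec. cos (u \<bullet> y)) = exp (- ((norm u)\<^sup>2 / 2))" "(LINT y|std_normal_vec. sin (u \<bullet> y)) = 0"
    using integral_bounded_linear[OF bounded_linear_Re i] integral_bounded_linear[OF bounded_linear_Im i]
    unfolding iexp_std_normal_vec by (simp_all add: Re_exp Im_exp)
  moreover have "(LINT x|distr M borel X. cos (u \<bullet> x)) = (LINT w|M. cos (u \<bullet> X w))"
    "(LINT x|distr M borel X. sin (u \<bullet> x)) = (LINT w|M. sin (u \<bullet> X w))"
    by (simp_all add: integral_distr)
  ultimately show "(LINT x|distr M borel X. cos (f x)) = (LINT x|std_normal_vec. cos (f x))"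
    "(LINT x|distr M borel X. sin (f x)) = (LINT x|std_normal_vec. sin (f x))"
    by (simp_all add: f c s)
qed

section \<open>Orthonormalisation and difference quotients\<close>

lemma linear_vec_sum:
  fixes f :: "real^'p::finite \<Rightarrow> 'b::real_vector"
  assumes "linear f"
  shows "f u = (\<Sum>i\<in>UNIV. (u $ i) *\<^sub>R f (axis i 1))"
proof -
  have "f u = f (\<Sum>i\<in>UNIV. (u $ i) *\<^sub>R axis i 1)"
    using basis_expansion[of u] by (simp add: scalar_mult_eq_scaleR)
  also have "\<dots> = (\<Sum>i\<in>UNIV. (u $ i) *\<^sub>R f (axis i 1))"
    by (simp add: linear_sum[OF assms] linear_cmul[OF assms])
  finally show ?thesis .
qed

text \<open>Gram--Schmidt orthonormalisation for the inner product with matrix \<open>S\<close>: the columns of \<open>A\<close> are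
  an orthonormal basis, in other words the transpose of \<open>A\<close> times \<open>S A\<close> is the identity.\<close>

lemma orthonormalizing_matrix:
  fixes Q :: "real^'p::finite \<Rightarrow> real^'p \<Rightarrow> real" and S :: "real^'p^'p"
  assumes Q: "\<And>u v. Q u v = u \<bullet> (S *v v)" and sym: "\<And>u v. Q u v = Q v u"
    and pos: "\<And>v. v \<noteq> 0 \<Longrightarrow> Q v v > 0"
  obtains A :: "real^'p^'p" where "\<And>u v. Q (A *v u) (A *v v) = u \<bullet> v"
proof -
  have lin1: "linear (\<lambda>u. Q u v)" for v
    unfolding Q by (intro linearI) (simp_all add: inner_add_left)
  have lin2: "linear (\<lambda>v. Q u v)" for u
    unfolding sym[of u] by (rule lin1)
  have "\<exists>e. \<forall>i\<in>I. \<forall>j\<in>I. Q (e i) (e j) = (if i = j then 1 else 0)" if "finite I" for I :: "'p set"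
    using that
  proof (induction I)
    case (insert k I)
    then obtain e where e: "\<And>i j. i \<in> I \<Longrightarrow> j \<in> I \<Longrightarrow> Q (e i) (e j) = (if i = j then 1 else 0)" by blast
    let ?B = "(\<lambda>j. S *v e j) ` I"
    have "dim ?B \<le> card ?B" by (rule dim_le_card') (use insert in simp)
    also have "\<dots> \<le> card I" using insert by (intro card_image_le)
    also have "\<dots> < card (UNIV :: 'p set)" using insert by (intro psubset_card_mono) auto
    finally have "dim ?B < DIM(real^'p)" by simp
    then obtain x where x: "x \<noteq> 0" "\<And>y. y \<in> span ?B \<Longrightarrow> orthogonal x y"
      by (rule orthogonal_to_subspace_exists) blast
    have x0: "Q x (e j) = 0" if "j \<in> I" for j
      using x(2)[OF span_base[OF imageI[OF that]]] by (simp add: Q orthogonal_def)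
    define y where "y = (1 / sqrt (Q x x)) *\<^sub>R x"
    have yy: "Q y y = 1"
      using pos[OF x(1)] linear_cmul[OF lin1] linear_cmul[OF lin2] unfolding y_def by simp
    have yj: "Q y (e j) = 0" "Q (e j) y = 0" if "j \<in> I" for j
      using x0[OF that] linear_cmul[OF lin1] sym[of "e j" y] unfolding y_def by simp_all
    show ?case
      by (rule exI[of _ "e(k := y)"]) (use insert.hyps e yy yj in auto)
  qed simp
  from this[OF finite, of UNIV] obtain e :: "'p \<Rightarrow> real^'p"
    where e: "\<And>i j. Q (e i) (e j) = (if i = j then 1 else 0)"
    by auto
  define A :: "real^'p^'p" where "A = (\<chi> k i. e i $ k)"
  have Ai: "A *v axis i 1 = e i" for i
    unfolding matrix_vector_mult_basis by (simp add: A_def column_def)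
  have "Q (A *v u) (A *v v) = u \<bullet> v" for u v
  proof -
    have l1: "linear (\<lambda>u. Q (A *v u) w)" for w
      using linear_compose[OF matrix_vector_mul_linear[of A] lin1[of w]] by (simp add: comp_def)
    have l2: "linear (\<lambda>v. Q w (A *v v))" for w
      using linear_compose[OF matrix_vector_mul_linear[of A] lin2[of w]] by (simp add: comp_def)
    have "Q (A *v u) (A *v v) = (\<Sum>i\<in>UNIV. (u $ i) *\<^sub>R (\<Sum>j\<in>UNIV. (v $ j) *\<^sub>R Q (e i) (e j)))"
      by (subst linear_vec_sum[OF l1], subst linear_vec_sum[OF l2]) (simp add: Ai)
    also have "\<dots> = u \<bullet> v"
      by (simp add: e inner_vec_def if_distrib[of "\<lambda>x. _ * x"] cong: if_cong)
    finally show ?thesis .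
  qed
  thus ?thesis by (rule that)
qed

lemma difference_quotient_tendsto:
  fixes f :: "'a::real_normed_vector \<Rightarrow> 'b::real_normed_vector"
  assumes "(f has_derivative f') (at x)"
  shows "((\<lambda>\<epsilon>. (1 / \<epsilon>) *\<^sub>R (f (x + \<epsilon> *\<^sub>R v) - f x)) \<longlongrightarrow> f' v) (at_right 0)"
proof -
  have f: "(f has_derivative f') (at (x + 0 *\<^sub>R v))" using assms by simp
  have g: "((\<lambda>\<epsilon>. x + \<epsilon> *\<^sub>R v) has_derivative (\<lambda>\<epsilon>. \<epsilon> *\<^sub>R v)) (at 0)"
    by (auto intro!: derivative_eq_intros)
  have "((\<lambda>\<epsilon>. f (x + \<epsilon> *\<^sub>R v)) has_derivative (\<lambda>\<epsilon>. f' (\<epsilon> *\<^sub>R v))) (at 0)"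
    by (rule has_derivative_compose[OF g f])
  hence l: "((\<lambda>\<epsilon>. norm (f (x + \<epsilon> *\<^sub>R v) - f x - f' (\<epsilon> *\<^sub>R v)) / norm \<epsilon>) \<longlongrightarrow> 0) (at 0)"
    by (simp add: has_derivative_at)
  have "((\<lambda>\<epsilon>. norm ((1 / \<epsilon>) *\<^sub>R (f (x + \<epsilon> *\<^sub>R v) - f x) - f' v)) \<longlongrightarrow> 0) (at 0)"
  proof (rule Lim_transform_eventually[OF l])
    have "norm (f (x + \<epsilon> *\<^sub>R v) - f x - f' (\<epsilon> *\<^sub>R v)) / norm \<epsilon> =
        norm ((1 / \<epsilon>) *\<^sub>R (f (x + \<epsilon> *\<^sub>R v) - f x) - f' v)" if "\<epsilon> \<noteq> 0" for \<epsilon>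
    proof -
      have "f' (\<epsilon> *\<^sub>R v) = \<epsilon> *\<^sub>R f' v"
        using assms by (simp add: linear_cmul has_derivative_linear)
      hence "(1 / \<epsilon>) *\<^sub>R (f (x + \<epsilon> *\<^sub>R v) - f x) - f' v = (1 / \<epsilon>) *\<^sub>R (f (x + \<epsilon> *\<^sub>R v) - f x - f' (\<epsilon> *\<^sub>R v))"
        using that by (simp add: scaleR_diff_right)
      thus ?thesis by (simp add: divide_inverse mult.commute)
    qed
    thus "\<forall>\<^sub>F \<epsilon> in at 0. norm (f (x + \<epsilon> *\<^sub>R v) - f x - f' (\<epsilon> *\<^sub>R v)) / norm \<epsilon> =
        norm ((1 / \<epsilon>) *\<^sub>R (f (x + \<epsilon> *\<^sub>R v) - f x) - f' v)"
      by (simp add: eventually_at_filter)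
  qed
  hence "((\<lambda>\<epsilon>. norm ((1 / \<epsilon>) *\<^sub>R (f (x + \<epsilon> *\<^sub>R v) - f x) - f' v)) \<longlongrightarrow> 0) (at_right 0)"
    by (rule filterlim_mono) (simp_all add: at_le)
  thus ?thesis by (simp add: tendsto_norm_zero_iff LIM_zero_iff)
qed

lemma signed_measures_on_limit:
  assumes "(f \<longlongrightarrow> m) F" "F \<noteq> bot" "\<forall>\<^sub>F x in F. f x \<in> signed_measures_on T"
  shows "m \<in> signed_measures_on T"
  unfolding signed_measures_on_def
proof (intro CollectI ballI impI)
  fix A :: "real set" assume A: "A \<in> sets borel" "A \<inter> T = {}"
  have "((\<lambda>x. norm (m - f x)) \<longlongrightarrow> norm (m - m)) F"
    by (intro tendsto_intros assms)
  moreover have "\<forall>\<^sub>F x in F. \<bar>sm m A\<bar> \<le> norm (m - f x)"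
    using assms(3)
  proof eventually_elim
    case (elim x)
    hence "sm (m - f x) A = sm m A"
      using A by (simp add: signed_measures_on_def minus_signed_measure.rep_eq)
    thus ?case using abs_sm_le_norm[OF A(1), of "m - f x"] by simp
  qed
  ultimately have "\<bar>sm m A\<bar> \<le> norm (m - m)"
    using assms(2) tendsto_lowerbound by blast
  thus "sm m A = 0" by simp
qed

section \<open>Local asymptotic normality\<close>

context gaussian_vector
begin

lemma abs_cov_le_norm:
  assumes n: "n \<in> MT"
  obtains C where "\<And>m. \<bar>cov m n\<bar> \<le> C * norm m"
proof -
  have "bounded ((\<lambda>s. cov (point_mass s) n) ` T)"
    by (intro compact_imp_bounded compact_continuous_image continuous_cov_point_mass n compact_T)
  then obtain C where C: "C > 0" "\<And>s. s \<in> T \<Longrightarrow> \<bar>cov (point_mass s) n\<bar> \<le> C"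
    by (auto simp: bounded_pos)
  have "\<bar>cov m n\<bar> \<le> 2 * norm m * C" for m
    by (subst cov_eq_signed_integral[OF n],
        rule abs_signed_integral_le[OF compact_T continuous_cov_point_mass[OF n]]) (use C in auto)
  thus ?thesis by (intro that[of "2 * C"]) (simp add: mult_ac)
qed

lemma sets_shifted_law: "sets (shifted_law W T Z m \<epsilon>) = sets (C_borel T)"
  by (simp add: shifted_law_def)

lemma prob_space_shifted_law:
  assumes m: "m \<in> MT"
  shows "prob_space (shifted_law W T Z m \<epsilon>)"
  unfolding shifted_law_def
  by (rule prob_space_distr) (rule measurable_signal_plus_noise[OF continuous_cov_op[OF m]])

text \<open>The log-likelihood ratio in direction \<open>n\<close> against the quadratic expansion in direction \<open>d\<close>.
  Under the law of the observation the difference is \<open>\<langle>n - d, Z\<rangle>\<close> minus a constant, and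
  Chebyshev's inequality applies.\<close>

lemma log_likelihood_remainder_bound:
  assumes m: "m \<in> MT" and n: "n \<in> MT" and d: "d \<in> MT" and \<epsilon>: "\<epsilon> \<noteq> 0" and \<delta>: "\<delta> > 0"
  defines "P \<equiv> shifted_law W T Z m \<epsilon>" and "P' \<equiv> shifted_law W T Z (m + \<epsilon> *\<^sub>R n) \<epsilon>"
    and "L \<equiv> \<lambda>k x. signed_integral T k (\<lambda>t. (x t - cov_op W T Z m t) / \<epsilon>)"
  shows "measure P {x\<in>space P. ereal \<delta> < \<bar>log_ennreal (RN_deriv P P' x) - ereal (L d x - cov d d / 2)\<bar>}
    \<le> (cov (n - d) (n - d) + ((cov n n - cov d d) / 2)\<^sup>2) / \<delta>\<^sup>2"
proof -
  define r where "r = n - d"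
  define c where "c = (cov n n - cov d d) / 2"
  have r: "r \<in> MT" using MT_linear[OF n d, of 1 "- 1"] by (simp add: r_def)
  have h: "continuous_on T (cov_op W T Z m)" by (rule continuous_cov_op[OF m])
  interpret P: prob_space P unfolding P_def by (rule prob_space_shifted_law[OF m])
  have [measurable_cong]: "sets P = sets (C_borel T)" unfolding P_def by (rule sets_shifted_law)
  have spP: "space P = mspace (C_space T)" unfolding P_def shifted_law_def by simp
  have L_meas [measurable]: "L k \<in> borel_measurable P" for k
    using measurable_residual[OF h, of k \<epsilon>] unfolding L_def by (simp cong: measurable_cong_sets add: \<open>sets P = _\<close>)
  have dens: "P' = density P (\<lambda>x. ennreal (exp (L n x - cov n n / 2)))"
    unfolding P_def P'_def L_def by (rule shifted_law_density[OF m n \<epsilon>])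
  have "AE x in P. ennreal (exp (L n x - cov n n / 2)) = RN_deriv P P' x"
    by (rule P.RN_deriv_unique) (simp_all add: dens)
  hence log: "AE x in P. log_ennreal (RN_deriv P P' x) = ereal (L n x - cov n n / 2)"
  proof eventually_elim
    case (elim x)
    show ?case unfolding elim[symmetric] by (simp add: log_ennreal_def)
  qed
  have "measure P {x\<in>space P. ereal \<delta> < \<bar>log_ennreal (RN_deriv P P' x) - ereal (L d x - cov d d / 2)\<bar>}
      \<le> measure P {x\<in>space P. \<delta>\<^sup>2 \<le> ((L n x - L d x) - c)\<^sup>2}"
  proof (rule P.finite_measure_mono_AE)
    show "AE x in P. x \<in> {x\<in>space P. ereal \<delta> < \<bar>log_ennreal (RN_deriv P P' x) - ereal (L d x - cov d d / 2)\<bar>}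
        \<longrightarrow> x \<in> {x\<in>space P. \<delta>\<^sup>2 \<le> ((L n x - L d x) - c)\<^sup>2}"
      using log
    proof eventually_elim
      case (elim x)
      have 1: "(L n x - cov n n / 2) - (L d x - cov d d / 2) = (L n x - L d x) - c"
        by (simp add: c_def field_simps)
      have 2: "\<delta>\<^sup>2 \<le> y\<^sup>2" if "\<delta> < \<bar>y\<bar>" for y
        using that \<delta> power_mono[of \<delta> "\<bar>y\<bar>" 2] by simp
      have "\<delta>\<^sup>2 \<le> ((L n x - L d x) - c)\<^sup>2"
        if "ereal \<delta> < \<bar>log_ennreal (RN_deriv P P' x) - ereal (L d x - cov d d / 2)\<bar>"
        using that unfolding elim ereal_minus(1) 1 by (intro 2) simp
      thus ?case by blast
    qed
  qed measurable
  also have "\<dots> = measure W {w\<in>space W. \<delta>\<^sup>2 \<le> (\<xi> r w - c)\<^sup>2}"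
  proof -
    let ?\<Phi> = "\<lambda>w. \<lambda>t\<in>T. cov_op W T Z m t + \<epsilon> * Z w t"
    have \<Phi>: "?\<Phi> \<in> measurable W (C_borel T)" by (rule measurable_signal_plus_noise[OF h])
    have "{x\<in>space P. \<delta>\<^sup>2 \<le> ((L n x - L d x) - c)\<^sup>2} \<in> sets P" by measurable
    hence B: "{x\<in>space P. \<delta>\<^sup>2 \<le> ((L n x - L d x) - c)\<^sup>2} \<in> sets (C_borel T)"
      using \<open>sets P = _\<close> by simp
    have "measure P {x\<in>space P. \<delta>\<^sup>2 \<le> ((L n x - L d x) - c)\<^sup>2} =
        measure W (?\<Phi> -` {x\<in>space P. \<delta>\<^sup>2 \<le> ((L n x - L d x) - c)\<^sup>2} \<inter> space W)"
      by (subst P_def, unfold shifted_law_def, rule measure_distr[OF \<Phi> B])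
    also have "?\<Phi> -` {x\<in>space P. \<delta>\<^sup>2 \<le> ((L n x - L d x) - c)\<^sup>2} \<inter> space W =
        {w\<in>space W. \<delta>\<^sup>2 \<le> (\<xi> r w - c)\<^sup>2}"
    proof -
      have "L k (?\<Phi> w) = \<xi> k w" if "w \<in> space W" for k w
        unfolding L_def by (rule residual_signal_plus_noise[OF that h \<epsilon>])
      moreover have "\<xi> n w - \<xi> d w = \<xi> r w" if "w \<in> space W" for w
        using \<xi>_linear[OF that, of 1 n "- 1" d] by (simp add: r_def)
      moreover have "?\<Phi> w \<in> space P" if "w \<in> space W" for w
        using measurable_space[OF \<Phi> that] by (simp add: spP)
      ultimately show ?thesis by auto
    qed
    finally show ?thesis .
  qed
  also have "\<dots> \<le> expectation (\<lambda>w. (\<xi> r w - c)\<^sup>2) / \<delta>\<^sup>2"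
  proof (rule integral_Markov_inequality_measure[where A="{}"])
    have "integrable W (\<lambda>w. (\<xi> r w)\<^sup>2 - 2 * c * \<xi> r w + c\<^sup>2)"
      using square_integrable_\<xi>[OF r] square_integrable_imp_integrable[OF measurable_\<xi>[OF r] square_integrable_\<xi>[OF r]]
      by simp
    thus "integrable W (\<lambda>w. (\<xi> r w - c)\<^sup>2)" by (simp add: power2_diff algebra_simps)
  qed (use \<delta> in auto)
  also have "expectation (\<lambda>w. (\<xi> r w - c)\<^sup>2) = cov r r + c\<^sup>2"
  proof -
    have i: "integrable W (\<xi> r)"
      by (rule square_integrable_imp_integrable[OF measurable_\<xi>[OF r] square_integrable_\<xi>[OF r]])
    have "expectation (\<lambda>w. (\<xi> r w - c)\<^sup>2) = expectation (\<lambda>w. (\<xi> r w)\<^sup>2 - 2 * c * \<xi> r w + c\<^sup>2)"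
      by (rule Bochner_Integration.integral_cong[OF refl]) (simp add: power2_diff algebra_simps)
    also have "\<dots> = cov r r + c\<^sup>2"
      using i square_integrable_\<xi>[OF r] expectation_\<xi>[OF r] by (simp add: cov_square prob_space)
    finally show ?thesis .
  qed
  finally show ?thesis unfolding r_def c_def .
qed

end

theorem theorem3p19:
  fixes a b :: real and T :: "real set"
    and W :: "'w measure" and Z :: "'w \<Rightarrow> real \<Rightarrow> real"
    and \<Theta> :: "(real^'p) set" and \<theta>\<^sub>0 :: "real^'p"
    and \<mu> :: "real^'p \<Rightarrow> signed_measure"
    and \<Sigma> :: "real^'p^'p"
  assumes "a \<le> b" and "T = {a..b}"
    and "prob_space W" and "centered_gaussian_vector W T Z"
    and "compact \<Theta>" and "convex \<Theta>" and "\<theta>\<^sub>0 \<in> interior \<Theta>"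
    and "continuous_on \<Theta> \<mu>" and "\<mu> \<in> C_k 2 \<Theta> (signed_measures_on T)"
    and "\<forall>\<theta>\<in>\<Theta>. (\<forall>t\<in>T. cov_op W T Z (\<mu> \<theta>) t = cov_op W T Z (\<mu> \<theta>\<^sub>0) t) \<longrightarrow> \<theta> = \<theta>\<^sub>0"
    and "\<Sigma> = (\<chi> i j. signed_integral T (partial_deriv i \<mu> \<theta>\<^sub>0)
                        (cov_op W T Z (partial_deriv j \<mu> \<theta>\<^sub>0)))"
    and "invertible \<Sigma>"
  shows "locally_asymptotically_normal \<Theta> (\<lambda>\<epsilon> \<theta>. shifted_law W T Z (\<mu> \<theta>) \<epsilon>) \<theta>\<^sub>0"
proof -
  interpret gaussian_vector W a b T Z
    using assms(1-4) by (simp add: gaussian_vector_def gaussian_vector_axioms_def)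
  define D where "D = frechet_derivative \<mu> (at \<theta>\<^sub>0)"
  have \<mu>_MT: "\<mu> \<theta> \<in> MT" if "\<theta> \<in> \<Theta>" for \<theta>
    using assms(9) that unfolding C_k_def by blast
  have \<theta>0: "\<theta>\<^sub>0 \<in> \<Theta>" using assms(7) interior_subset by blast
  have "\<mu> differentiable (at \<theta>\<^sub>0)"
    using assms(7,9) by (simp add: C_k_def numeral_2_eq_2)
  hence deriv: "(\<mu> has_derivative D) (at \<theta>\<^sub>0)"
    unfolding D_def frechet_derivative_works .
  have lin: "linear D" using has_derivative_linear[OF deriv] .
  have near: "\<forall>\<^sub>F \<epsilon> in at_right 0. \<theta>\<^sub>0 + \<epsilon> *\<^sub>R v \<in> \<Theta>" for v
  proof -
    have "((\<lambda>\<epsilon>. \<theta>\<^sub>0 + \<epsilon> *\<^sub>R v) \<longlongrightarrow> \<theta>\<^sub>0 + 0 *\<^sub>R v) (at_right 0)" by (intro tendsto_intros)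
    hence "\<forall>\<^sub>F \<epsilon> in at_right 0. \<theta>\<^sub>0 + \<epsilon> *\<^sub>R v \<in> interior \<Theta>"
      by (rule topological_tendstoD) (simp_all add: assms(7))
    thus ?thesis by eventually_elim (use interior_subset in blast)
  qed
  have pos: "\<forall>\<^sub>F \<epsilon> in at_right 0. (0::real) < \<epsilon>"
    by (simp add: eventually_at_right_less)
  \<comment> \<open>Difference quotients: the shift of the signal in units of the noise level.\<close>
  define N where "N v \<epsilon> = (1 / \<epsilon>) *\<^sub>R (\<mu> (\<theta>\<^sub>0 + \<epsilon> *\<^sub>R v) - \<mu> \<theta>\<^sub>0)" for v \<epsilon>
  have N_MT: "N v \<epsilon> \<in> MT" if "\<theta>\<^sub>0 + \<epsilon> *\<^sub>R v \<in> \<Theta>" for v \<epsilon>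
    using MT_linear[OF \<mu>_MT[OF that] \<mu>_MT[OF \<theta>0], of "1 / \<epsilon>" "- (1 / \<epsilon>)"]
    by (simp add: N_def scaleR_diff_right)
  have N_lim: "(N v \<longlongrightarrow> D v) (at_right 0)" for v
    unfolding N_def by (rule difference_quotient_tendsto[OF deriv])
  have D_MT: "D v \<in> MT" for v
    by (rule signed_measures_on_limit[OF N_lim]) (use near[of v] N_MT in \<open>auto elim: eventually_mono\<close>)
  have cov_lin: "linear (\<lambda>u. cov (D u) k)" if "k \<in> MT" for k
  proof (rule linearI)
    show "cov (D (u + v)) k = cov (D u) k + cov (D v) k" for u v
      using cov_linear_left[OF D_MT D_MT that, of 1 u 1 v] by (simp add: linear_add[OF lin])
    show "cov (D (c *\<^sub>R u)) k = c *\<^sub>R cov (D u) k" for c u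
      using cov_linear_left[OF D_MT D_MT that, of c u 0 u] by (simp add: linear_cmul[OF lin])
  qed
  have \<Sigma>_cov: "\<Sigma> $ i $ j = cov (D (axis i 1)) (D (axis j 1))" for i j
    unfolding assms(11) partial_deriv_def D_def[symmetric]
    by (simp add: signed_integral_cov_op[OF D_MT])
  have Q: "cov (D u) (D v) = u \<bullet> (\<Sigma> *v v)" for u v
  proof -
    have "cov (D u) (D v) = (\<Sum>i\<in>UNIV. u $ i * (\<Sum>j\<in>UNIV. v $ j * \<Sigma> $ i $ j))"
      by (subst linear_vec_sum[OF cov_lin[OF D_MT]], subst cov_commute, subst linear_vec_sum[OF cov_lin[OF D_MT]])
         (simp add: \<Sigma>_cov cov_commute)
    thus ?thesis by (simp add: inner_vec_def matrix_vector_mult_def mult.commute)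
  qed
  \<comment> \<open>If the variance vanishes, so do all covariances, hence \<open>\<Sigma> *v v\<close>.\<close>
  have pos_def: "cov (D v) (D v) > 0" if "v \<noteq> 0" for v
  proof (rule ccontr)
    assume "\<not> cov (D v) (D v) > 0"
    hence 0: "cov (D v) (D v) = 0" using cov_nonneg[of "D v"] by simp
    have "AE w in W. (\<xi> (D v) w)\<^sup>2 = 0"
      using 0 square_integrable_\<xi>[OF D_MT]
      by (subst integral_nonneg_eq_0_iff_AE[symmetric]) (simp_all add: cov_square)
    hence "AE w in W. \<xi> (D u) w * \<xi> (D v) w = 0" for u by eventually_elim simp
    hence "cov (D u) (D v) = 0" for u unfolding cov_def by (rule integral_eq_zero_AE)
    hence "(\<Sigma> *v v) \<bullet> (\<Sigma> *v v) = 0" by (simp add: Q)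
    hence "\<Sigma> *v v = 0" by simp
    with assms(12) have "v = 0"
      using matrix_left_invertible_ker invertible_left_inverse by blast
    with that show False by simp
  qed
  obtain A :: "real^'p^'p" where A: "\<And>u v. cov (D (A *v u)) (D (A *v v)) = u \<bullet> v"
    by (rule orthonormalizing_matrix[of "\<lambda>u v. cov (D u) (D v)", OF Q cov_commute pos_def]) blast+
  define \<phi> where "\<phi> \<epsilon> = \<epsilon> *\<^sub>R A" for \<epsilon> :: real
  define h where "h = cov_op W T Z (\<mu> \<theta>\<^sub>0)"
  have h: "continuous_on T h" unfolding h_def by (rule continuous_cov_op[OF \<mu>_MT[OF \<theta>0]])
  define \<Delta> where "\<Delta> \<epsilon> x = (\<chi> i. signed_integral T (D (A *v axis i 1)) (\<lambda>t. (x t - h t) / \<epsilon>))"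
    for \<epsilon> and x :: "real \<Rightarrow> real"
  let ?P = "\<lambda>\<epsilon> \<theta>. shifted_law W T Z (\<mu> \<theta>) \<epsilon>"
  have linA: "linear (\<lambda>u. D (A *v u))"
    using linear_compose[OF matrix_vector_mul_linear[of A] lin] by (simp add: comp_def)
  have u_\<Delta>: "u \<bullet> \<Delta> \<epsilon> x = signed_integral T (D (A *v u)) (\<lambda>t. (x t - h t) / \<epsilon>)"
    if "x \<in> mspace (C_space T)" for u \<epsilon> x
  proof -
    have c: "continuous_on T (\<lambda>t. (x t - h t) / \<epsilon>)"
      using that h unfolding divide_inverse by (auto simp: mspace_C_space compact_T intro!: continuous_intros)
    have "linear (\<lambda>u. signed_integral T (D (A *v u)) (\<lambda>t. (x t - h t) / \<epsilon>))"
    proof (rule linearI)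
      show "signed_integral T (D (A *v (u + v))) (\<lambda>t. (x t - h t) / \<epsilon>) =
          signed_integral T (D (A *v u)) (\<lambda>t. (x t - h t) / \<epsilon>) + signed_integral T (D (A *v v)) (\<lambda>t. (x t - h t) / \<epsilon>)" for u v
        using signed_integral_linear_measure[OF compact_T c, of 1 _ 1] by (simp add: linear_add[OF linA])
      show "signed_integral T (D (A *v (k *\<^sub>R u))) (\<lambda>t. (x t - h t) / \<epsilon>) =
          k *\<^sub>R signed_integral T (D (A *v u)) (\<lambda>t. (x t - h t) / \<epsilon>)" for k u
        using signed_integral_linear_measure[OF compact_T c, of k _ 0] by (simp add: linear_cmul[OF linA])
    qed
    from linear_vec_sum[OF this, of u] show ?thesis
      by (simp add: \<Delta>_def inner_vec_def)
  qed
  have \<phi>_u: "\<theta>\<^sub>0 + \<phi> \<epsilon> *v u = \<theta>\<^sub>0 + \<epsilon> *\<^sub>R (A *v u)" for \<epsilon> u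
    by (simp add: \<phi>_def scaleR_matrix_vector_assoc)
  have shift: "?P \<epsilon> (\<theta>\<^sub>0 + \<phi> \<epsilon> *v u) = shifted_law W T Z (\<mu> \<theta>\<^sub>0 + \<epsilon> *\<^sub>R N (A *v u) \<epsilon>) \<epsilon>"
    if "\<epsilon> > 0" for \<epsilon> u
    using that by (simp add: \<phi>_u N_def)
  have ex: "\<forall>\<^sub>F \<epsilon> in at_right 0. 0 < \<epsilon> \<and> \<theta>\<^sub>0 + \<epsilon> *\<^sub>R (A *v u) \<in> \<Theta>" for u
    using pos near[of "A *v u"] by eventually_elim simp
  have "\<phi> \<epsilon> *v v = 0 \<Longrightarrow> v = 0" if "\<epsilon> > 0" for \<epsilon> v
  proof -
    assume "\<phi> \<epsilon> *v v = 0"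
    hence "A *v v = 0" using that by (simp add: \<phi>_def scaleR_matrix_vector_assoc[symmetric])
    hence "D (A *v v) = D (0 *\<^sub>R v)" by simp
    hence "D (A *v v) = 0" unfolding linear_cmul[OF lin] by simp
    moreover have "cov 0 k = 0" for k by (simp add: cov_def \<xi>_def signed_integral_def)
    ultimately have "v \<bullet> v = 0" using A[of v v] by simp
    thus "v = 0" by simp
  qed
  hence inv: "\<forall>\<epsilon>>0. invertible (\<phi> \<epsilon>)"
    unfolding invertible_left_inverse matrix_left_invertible_ker by blast
  have \<phi>_lim: "(\<phi> \<longlongrightarrow> 0) (at_right 0)"
  proof -
    have "((\<lambda>\<epsilon>. \<epsilon> *\<^sub>R A) \<longlongrightarrow> 0 *\<^sub>R A) (at_right 0)" by (intro tendsto_intros)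
    thus ?thesis by (simp add: \<phi>_def[abs_def])
  qed
  have \<Delta>_meas: "\<Delta> \<epsilon> \<in> borel_measurable (C_borel T)" for \<epsilon>
  proof (subst borel_measurable_euclidean_space, intro ballI)
    fix i :: "real^'p" assume "i \<in> Basis"
    then obtain j where i: "i = axis j 1" by (auto simp: Basis_vec_def)
    have "(\<lambda>x. signed_integral T (D (A *v axis j 1)) (\<lambda>t. (x t - h t) / \<epsilon>)) \<in> borel_measurable (C_borel T)"
      by (rule measurable_residual[OF h])
    thus "(\<lambda>x. \<Delta> \<epsilon> x \<bullet> i) \<in> borel_measurable (C_borel T)"
      by (simp add: i inner_axis \<Delta>_def)
  qed
  have abs_cont: "\<forall>\<^sub>F \<epsilon> in at_right 0. \<theta>\<^sub>0 + \<phi> \<epsilon> *v u \<in> \<Theta> \<and>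
      absolutely_continuous (?P \<epsilon> \<theta>\<^sub>0) (?P \<epsilon> (\<theta>\<^sub>0 + \<phi> \<epsilon> *v u))" for u
    using ex[of u]
  proof eventually_elim
    case (elim \<epsilon>)
    hence \<epsilon>: "0 < \<epsilon>" and N': "N (A *v u) \<epsilon> \<in> MT" by (simp, intro N_MT, simp)
    have "(\<lambda>x. signed_integral T (N (A *v u) \<epsilon>) (\<lambda>t. (x t - cov_op W T Z (\<mu> \<theta>\<^sub>0) t) / \<epsilon>)) \<in> borel_measurable (C_borel T)"
      by (rule measurable_residual[OF h[unfolded h_def]])
    hence "absolutely_continuous (?P \<epsilon> \<theta>\<^sub>0) (?P \<epsilon> (\<theta>\<^sub>0 + \<phi> \<epsilon> *v u))"
      unfolding shift[OF \<epsilon>] shifted_law_density[OF \<mu>_MT[OF \<theta>0] N' less_imp_neq[OF \<epsilon>, symmetric]]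
      by (intro absolutely_continuousI_density) (simp add: shifted_law_def)
    thus ?case using elim by (simp add: \<phi>_u)
  qed
  have remainder: "small_o_prob (at_right 0) (\<lambda>\<epsilon>. ?P \<epsilon> \<theta>\<^sub>0)
      (\<lambda>\<epsilon> x. log_ennreal (RN_deriv (?P \<epsilon> \<theta>\<^sub>0) (?P \<epsilon> (\<theta>\<^sub>0 + \<phi> \<epsilon> *v u)) x)
         - ereal (u \<bullet> \<Delta> \<epsilon> x - (norm u)\<^sup>2 / 2))" for u
    unfolding small_o_prob_def
  proof (intro allI impI)
    fix \<delta> :: real assume \<delta>: "\<delta> > 0"
    let ?d = "D (A *v u)" and ?n = "N (A *v u)"
    obtain C where C: "C \<ge> 0" "\<And>m. m \<in> MT \<Longrightarrow> cov m m \<le> C * (norm m)\<^sup>2"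
      by (rule cov_le_norm) blast
    obtain B where B: "\<And>m. \<bar>cov m ?d\<bar> \<le> B * norm m"
      by (rule abs_cov_le_norm[OF D_MT[of "A *v u"]]) blast
    \<comment> \<open>The bound of the previous lemma is a polynomial in \<open>g \<epsilon>\<close> without constant term.\<close>
    define g where "g \<epsilon> = norm (?n \<epsilon> - ?d)" for \<epsilon>
    have g: "(g \<longlongrightarrow> 0) (at_right 0)"
      using N_lim[of "A *v u"] unfolding g_def by (simp add: tendsto_norm_zero_iff LIM_zero_iff)
    define bound where "bound \<epsilon> = (C * (g \<epsilon>)\<^sup>2 + (B * g \<epsilon> + C * (g \<epsilon>)\<^sup>2 / 2)\<^sup>2) / \<delta>\<^sup>2" for \<epsilon>
    have "((\<lambda>\<epsilon>. (C * (g \<epsilon>)\<^sup>2 + (B * g \<epsilon> + C * (g \<epsilon>)\<^sup>2 / 2)\<^sup>2) / \<delta>\<^sup>2) \<longlongrightarrow>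
        (C * 0\<^sup>2 + (B * 0 + C * 0\<^sup>2 / 2)\<^sup>2) / \<delta>\<^sup>2) (at_right 0)"
      using \<delta> by (intro tendsto_intros g) auto
    hence bound: "(bound \<longlongrightarrow> 0) (at_right 0)" by (simp add: bound_def[abs_def])
    show "((\<lambda>\<epsilon>. measure (?P \<epsilon> \<theta>\<^sub>0) {x \<in> space (?P \<epsilon> \<theta>\<^sub>0). ereal \<delta> <
        \<bar>log_ennreal (RN_deriv (?P \<epsilon> \<theta>\<^sub>0) (?P \<epsilon> (\<theta>\<^sub>0 + \<phi> \<epsilon> *v u)) x)
           - ereal (u \<bullet> \<Delta> \<epsilon> x - (norm u)\<^sup>2 / 2)\<bar>}) \<longlongrightarrow> 0) (at_right 0)"
    proof (rule tendsto_sandwich[OF _ _ tendsto_const bound])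
      show "\<forall>\<^sub>F \<epsilon> in at_right 0. measure (?P \<epsilon> \<theta>\<^sub>0) {x \<in> space (?P \<epsilon> \<theta>\<^sub>0). ereal \<delta> <
        \<bar>log_ennreal (RN_deriv (?P \<epsilon> \<theta>\<^sub>0) (?P \<epsilon> (\<theta>\<^sub>0 + \<phi> \<epsilon> *v u)) x)
           - ereal (u \<bullet> \<Delta> \<epsilon> x - (norm u)\<^sup>2 / 2)\<bar>} \<le> bound \<epsilon>"
        using ex[of u]
      proof eventually_elim
        case (elim \<epsilon>)
        hence \<epsilon>: "\<epsilon> > 0" by simp
        have N': "?n \<epsilon> \<in> MT" using elim by (intro N_MT) simp
        let ?r = "?n \<epsilon> - ?d"
        have r: "?r \<in> MT" using MT_linear[OF N' D_MT, of 1 "- 1"] by simp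
        have nd: "cov (?n \<epsilon>) (?n \<epsilon>) - cov ?d ?d = 2 * cov ?r ?d + cov ?r ?r"
          using cov_add_scaled[OF D_MT[of "A *v u"] r, of 1] by (simp add: cov_commute)
        have rr: "cov ?r ?r \<le> C * (g \<epsilon>)\<^sup>2" unfolding g_def by (rule C(2)[OF r])
        have "\<bar>cov ?r ?d + cov ?r ?r / 2\<bar> \<le> \<bar>cov ?r ?d\<bar> + \<bar>cov ?r ?r / 2\<bar>" by (rule abs_triangle_ineq)
        also have "\<dots> \<le> B * g \<epsilon> + C * (g \<epsilon>)\<^sup>2 / 2"
          using B[of ?r] rr cov_nonneg[of ?r] by (intro add_mono) (simp_all add: g_def)
        finally have "\<bar>(cov (?n \<epsilon>) (?n \<epsilon>) - cov ?d ?d) / 2\<bar> \<le> B * g \<epsilon> + C * (g \<epsilon>)\<^sup>2 / 2"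
          unfolding nd by (simp add: add_divide_distrib)
        hence sq: "((cov (?n \<epsilon>) (?n \<epsilon>) - cov ?d ?d) / 2)\<^sup>2 \<le> (B * g \<epsilon> + C * (g \<epsilon>)\<^sup>2 / 2)\<^sup>2"
          by (metis abs_ge_zero power2_abs power_mono)
        have eq: "{x \<in> space (?P \<epsilon> \<theta>\<^sub>0). ereal \<delta> <
            \<bar>log_ennreal (RN_deriv (?P \<epsilon> \<theta>\<^sub>0) (?P \<epsilon> (\<theta>\<^sub>0 + \<phi> \<epsilon> *v u)) x)
              - ereal (u \<bullet> \<Delta> \<epsilon> x - (norm u)\<^sup>2 / 2)\<bar>} =
          {x \<in> space (?P \<epsilon> \<theta>\<^sub>0). ereal \<delta> <
            \<bar>log_ennreal (RN_deriv (?P \<epsilon> \<theta>\<^sub>0) (shifted_law W T Z (\<mu> \<theta>\<^sub>0 + \<epsilon> *\<^sub>R ?n \<epsilon>) \<epsilon>) x)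
              - ereal (signed_integral T ?d (\<lambda>t. (x t - cov_op W T Z (\<mu> \<theta>\<^sub>0) t) / \<epsilon>) - cov ?d ?d / 2)\<bar>}"
        proof (intro Collect_cong conj_cong refl)
          fix x assume "x \<in> space (?P \<epsilon> \<theta>\<^sub>0)"
          hence x: "x \<in> mspace (C_space T)" by (simp add: shifted_law_def)
          show "ereal \<delta> < \<bar>log_ennreal (RN_deriv (?P \<epsilon> \<theta>\<^sub>0) (?P \<epsilon> (\<theta>\<^sub>0 + \<phi> \<epsilon> *v u)) x)
              - ereal (u \<bullet> \<Delta> \<epsilon> x - (norm u)\<^sup>2 / 2)\<bar> \<longleftrightarrow>
            ereal \<delta> < \<bar>log_ennreal (RN_deriv (?P \<epsilon> \<theta>\<^sub>0) (shifted_law W T Z (\<mu> \<theta>\<^sub>0 + \<epsilon> *\<^sub>R ?n \<epsilon>) \<epsilon>) x)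
              - ereal (signed_integral T ?d (\<lambda>t. (x t - cov_op W T Z (\<mu> \<theta>\<^sub>0) t) / \<epsilon>) - cov ?d ?d / 2)\<bar>"
            unfolding shift[OF \<epsilon>] u_\<Delta>[OF x] A power2_norm_eq_inner h_def ..
        qed
        have "measure (?P \<epsilon> \<theta>\<^sub>0) {x \<in> space (?P \<epsilon> \<theta>\<^sub>0). ereal \<delta> <
            \<bar>log_ennreal (RN_deriv (?P \<epsilon> \<theta>\<^sub>0) (?P \<epsilon> (\<theta>\<^sub>0 + \<phi> \<epsilon> *v u)) x)
              - ereal (u \<bullet> \<Delta> \<epsilon> x - (norm u)\<^sup>2 / 2)\<bar>}
            \<le> (cov ?r ?r + ((cov (?n \<epsilon>) (?n \<epsilon>) - cov ?d ?d) / 2)\<^sup>2) / \<delta>\<^sup>2"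
          unfolding eq
          by (rule log_likelihood_remainder_bound[OF \<mu>_MT[OF \<theta>0] N' D_MT _ \<delta>]) (use \<epsilon> in simp)
        also have "\<dots> \<le> bound \<epsilon>"
          unfolding bound_def by (intro divide_right_mono add_mono rr sq) simp
        finally show ?case .
      qed
    qed simp
  qed
  \<comment> \<open>The law of \<open>\<Delta> \<epsilon>\<close> is standard normal for every \<open>\<epsilon> > 0\<close>.\<close>
  have law: "converges_in_law (at_right 0) (\<lambda>\<epsilon>. ?P \<epsilon> \<theta>\<^sub>0) \<Delta> std_normal_vec"
    unfolding converges_in_law_def
  proof
    fix f :: "(real^'p) \<Rightarrow>\<^sub>C real"
    have f_meas [measurable]: "apply_bcontfun f \<in> borel_measurable borel"
      by (intro borel_measurable_continuous_onI) simp
    have "(LINT x|?P \<epsilon> \<theta>\<^sub>0. f (\<Delta> \<epsilon> x)) = (LINT y|std_normal_vec. f y)" if \<epsilon>: "\<epsilon> > 0" for \<epsilon>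
    proof -
      let ?\<Phi> = "\<lambda>w. \<lambda>t\<in>T. h t + \<epsilon> * Z w t"
      have [measurable]: "?\<Phi> \<in> measurable W (C_borel T)" by (rule measurable_signal_plus_noise[OF h])
      have [measurable]: "\<Delta> \<epsilon> \<in> borel_measurable (C_borel T)" by (rule \<Delta>_meas)
      have u: "u \<bullet> \<Delta> \<epsilon> (?\<Phi> w) = \<xi> (D (A *v u)) w" if "w \<in> space W" for u w
        using u_\<Delta>[OF affine_in_C_space[OF compact_T h Z_in_C[OF that]]]
          residual_signal_plus_noise[OF that h, of \<epsilon>] \<epsilon> by simp
      have std: "distr W borel (\<lambda>w. \<Delta> \<epsilon> (?\<Phi> w)) = std_normal_vec"
      proof (rule distr_eq_std_normal_vec[OF prob_space_axioms])
        fix u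
        have "expectation (\<lambda>w. cos (u \<bullet> \<Delta> \<epsilon> (?\<Phi> w))) = expectation (\<lambda>w. cos (\<xi> (D (A *v u)) w))"
          by (rule Bochner_Integration.integral_cong[OF refl]) (simp only: u)
        thus "expectation (\<lambda>w. cos (u \<bullet> \<Delta> \<epsilon> (?\<Phi> w))) = exp (- ((norm u)\<^sup>2 / 2))"
          by (simp add: expectation_cos_\<xi>[OF D_MT] A power2_norm_eq_inner)
        have "expectation (\<lambda>w. sin (u \<bullet> \<Delta> \<epsilon> (?\<Phi> w))) = expectation (\<lambda>w. sin (\<xi> (D (A *v u)) w))"
          by (rule Bochner_Integration.integral_cong[OF refl]) (simp only: u)
        thus "expectation (\<lambda>w. sin (u \<bullet> \<Delta> \<epsilon> (?\<Phi> w))) = 0"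
          by (simp add: expectation_sin_\<xi>[OF D_MT])
      qed measurable
      have "(LINT x|?P \<epsilon> \<theta>\<^sub>0. f (\<Delta> \<epsilon> x)) = expectation (\<lambda>w. f (\<Delta> \<epsilon> (?\<Phi> w)))"
        unfolding shifted_law_def h_def[symmetric] by (rule integral_distr) measurable
      also have "\<dots> = (LINT y|distr W borel (\<lambda>w. \<Delta> \<epsilon> (?\<Phi> w)). f y)"
        by (rule integral_distr[symmetric]) measurable
      finally show ?thesis unfolding std .
    qed
    hence "\<forall>\<^sub>F \<epsilon> in at_right 0. (LINT y|std_normal_vec. f y) = (LINT x|?P \<epsilon> \<theta>\<^sub>0. f (\<Delta> \<epsilon> x))"
      using pos by (auto elim: eventually_mono)
    thus "((\<lambda>\<epsilon>. LINT x|?P \<epsilon> \<theta>\<^sub>0. f (\<Delta> \<epsilon> x)) \<longlongrightarrow> (LINT y|std_normal_vec. f y)) (at_right 0)"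
      by (rule Lim_transform_eventually[OF tendsto_const])
  qed
  show ?thesis
    unfolding locally_asymptotically_normal_def
  proof (intro exI[of _ \<phi>] exI[of _ \<Delta>] conjI allI impI)
    show "\<Delta> \<epsilon> \<in> borel_measurable (?P \<epsilon> \<theta>\<^sub>0)" for \<epsilon>
      using \<Delta>_meas[of \<epsilon>] by (simp add: shifted_law_def)
  qed (use inv \<phi>_lim abs_cont remainder law in blast)+
qed

end
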